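(* Let $A$ be a closed symmetric linear relation with defect numbers $n_\pm(A)=p<\infty$ in a Hilbert space $\mathfrak H$, let $\Pi=(\mathbb C^p,\Gamma_0,\Gamma_1)$ be a boundary triple for $A^*$, $A_0=\ker\Gamma_0$, and let $(\mathbb C^p,\widehat\Gamma_0,\widehat\Gamma_1)$ be the extended boundary triple for $A^{\langle*\rangle}$. Let $\mathfrak L$ be a subspace of $\mathfrak H_-$ such that $\rho(A,\mathfrak L)\ne\emptyset$, let $L:\mathbb C^p\to\mathfrak L$ be a linear bijection, and let $$\widehat W(z):=\begin{bmatrix} -\widehat\Gamma_0\widehat{\mathcal Q}(z)^{\langle*\rangle} & \widehat\Gamma_0\widehat{\mathcal P}(z)^{\langle*\rangle} \\ -\widehat\Gamma_1\widehat{\mathcal Q}(z)^{\langle*\rangle} & \widehat\Gamma_1\widehat{\mathcal P}(z)^{\langle*\rangle} \end{bmatrix}^*,\qquad z\in\rho(A,\mathfrak L).$$ Then: (i) The kernel $$\mathsf K_\zeta^{\widehat W}(z):=\frac{\widetilde J_p-\widehat W(z)\widetilde J_p\widehat W(\zeta)^*}{-i(z-\bar\zeta)},\qquad z,\zeta\in\rho(A,\mathfrak L),\ z\neq\bar\zeta,$$ admits the factorization $\mathsf K_\zeta^{\widehat W}(z)=\mathcal G(z)\mathcal G(\zeta)^{\langle*\rangle}$, where $\mathcal G(z)=\begin{bmatrix} -\mathcal Q(z) \\ \mathcal P(z) \end{bmatrix}$ and $\mathcal G(\zeta)^{\langle*\rangle}=\begin{bmatrix} -\mathcal Q(\zeta)^{\langle*\rangle}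 & \mathcal P(\zeta)^{\langle*\rangle} \end{bmatrix}:\mathbb C^{2p}\to\mathfrak H$. (ii) If, in addition, $\rho_s(A,\mathfrak L):=\rho(A,\mathfrak L)\cap\overline{\rho(A,\mathfrak L)}\neq\emptyset$ (the bar denoting complex conjugation of the set), then $\widehat W(z)$ is invertible for $z\in\rho_s(A,\mathfrak L)$ and coincides on $\rho_s(A,\mathfrak L)\cap\rho(A_0)$ with the $\Pi\mathfrak L$-resolvent matrix $W_{\Pi\mathfrak L}(z)$ of $A$.
   Context: Inner products are linear in the first argument. A linear relation $T$ in $\mathfrak H$ is a linear subspace of $\mathfrak H\times\mathfrak H$; $\mathrm{mul}\,T=\{g:\mathrm{col}\{0,g\}\in T\}$; $T^*=\{\mathrm{col}\{u,f\}:(f,v)=(u,g)\ \forall\,\mathrm{col}\{v,g\}\in T\}$; $A$ symmetric means $A\subseteq A^*$. $\mathfrak N_z=\ker(A^*-zI)$, $\widehat{\mathfrak N}_z=\{\mathrm{col}\{f,zf\}:f\in\mathfrak N_z\}$; $n_\pm(A)=\dim\mathfrak N_z$, $z\in\mathbb C_\pm$; $\widehat\rho(A)$ is the set of $z$ with $\ker(A-zI)=\{0\}$ and $\mathrm{ran}(A-zI)$ closed. Boundary triple for $A^*$: linear maps $\Gamma_0,\Gamma_1:A^*\to\mathbb C^p$ with $(f',g)-(f,g')=(\Gamma_0\widehat g)^*(\Gamma_1\widehat f)-(\Gamma_1\widehat g)^*(\Gamma_0\widehat f)$ for $\widehat f=\mathrm{col}\{f,f'\},\widehat g=\mathrm{col}\{g,g'\}\in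 A^*$ and $\mathrm{col}\{\Gamma_0,\Gamma_1\}$ onto $\mathbb C^{2p}$. $A_0=\ker\Gamma_0$ is selfadjoint, $R_z^0=(A_0-zI)^{-1}$. For $z\in\rho(A_0)$, $\gamma(z)$ is the first component of $\widehat\gamma(z)=(\Gamma_0\upharpoonright\widehat{\mathfrak N}_z)^{-1}$ and $M(z)=\Gamma_1\widehat\gamma(z)$. Rigging $\mathfrak H_+\subset\mathfrak H\subset\mathfrak H_-$ associated with $A$: with $\mathfrak H_0=\overline{\mathrm{dom}\,A}$, $\mathfrak H_+=\mathrm{dom}\,A^*\oplus\mathrm{mul}\,A$ with norm $\|h_0+h_1\|_+^2=\|h_0\|^2+\|P_{\mathfrak H_0}h_0'\|^2+\|h_1\|^2$ for $h_0\in\mathrm{dom}\,A^*$, $h_1\in\mathrm{mul}\,A$, $\mathrm{col}\{h_0,h_0'\}\in A^*$; $\mathfrak H_-$ is the space of bounded conjugate-linear functionals on $\mathfrak H_+$, $\langle\mathfrak f,h\rangle_{-,+}:=\mathfrak f(h)$, $\langle h,\mathfrak f\rangle_{+,-}:=\overline{\mathfrak f(h)}$; $f\in\mathfrak H$ is identified with $h\mapsto(f,h)$. Adjoints: for $T\in\mathcal B(\mathfrak H,\mathfrak H_+)$, $(T^{\langle*\rangle}\mathfrak f,g)=\langle\mathfrak f,Tg\rangle_{-,+}$; for $T\in\mathcal B(\mathfrak H_-,\mathbb C^p)$, $T^{\langle*\rangle}\in\mathcal B(\mathbb C^p,\mathfrak H_+)$ with $\langle\mathfrak f,T^{\langle*\rangle}\xi\rangle_{-,+}=\xi^*(T\mathfrak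 f)$; for $T\in\mathcal B(\mathfrak H,\mathbb C^p)$, $T^{\langle*\rangle}:=T^*$; $\xi^*(\gamma(\bar z)^{\langle*\rangle}\mathfrak f)=\langle\mathfrak f,\gamma(\bar z)\xi\rangle_{-,+}$; $\xi^*(L^{\langle*\rangle}h)=\langle h,L\xi\rangle_{+,-}$, $h\in\mathfrak H_+$. Put $\widetilde R_z^0=(R^0_{\bar z})^{\langle*\rangle}$, $\mathbf R^0=\big(\tfrac12(R_i^0+R_{-i}^0)\big)^{\langle*\rangle}$, $\widehat R_z^0=\widetilde R_z^0-\mathbf R^0\in\mathcal B(\mathfrak H_-,\mathfrak H_+)$. For $B\in\{A^*,A_0,A\}$ the set of all $\mathrm{col}\{f,\mathfrak f'\}\in\mathfrak H\times\mathfrak H_-$ with $\langle\mathfrak f',h\rangle_{-,+}=(f,h')$ for all $\mathrm{col}\{h,h'\}\in B$ is denoted $\mathbf A$ ($B=A^*$), $\mathbf A_0$ ($B=A_0$), $A^{\langle*\rangle}$ ($B=A$). For $z\in\rho(A_0)$, $\mathbf A_0=\{\mathrm{col}\{\widetilde R_z^0\mathfrak f,\mathfrak f+z\widetilde R_z^0\mathfrak f\}:\mathfrak f\in\mathfrak H_-\}$ and $A^{\langle*\rangle}=\mathbf A_0\dotplus\widehat{\mathfrak N}_z$. The extended boundary triple consists of the bounded (in $\mathfrak H\times\mathfrak H_-$) continuations $\widehat\Gamma_j:A^{\langle*\rangle}\to\mathbb C^p$ of $\Gamma_j$, determined by $\widehat\Gamma_0\,\mathrm{col}\{\widetilde R_z^0\mathfrak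 f,\mathfrak f+z\widetilde R_z^0\mathfrak f\}=0$, $\widehat\Gamma_1\,\mathrm{col}\{\widetilde R_z^0\mathfrak f,\mathfrak f+z\widetilde R_z^0\mathfrak f\}=\gamma(\bar z)^{\langle*\rangle}\mathfrak f$, $\widehat\Gamma_j=\Gamma_j$ on $\widehat{\mathfrak N}_z$. Gauge and $\mathcal P,\mathcal Q$: for closed $\mathfrak L\subset\mathfrak H_-$, $\rho(A,\mathfrak L)$ is the set of $z\in\widehat\rho(A)$ with $\mathfrak H_-=\mathrm{ran}(\mathbf A-zI)\dotplus\mathfrak L$; $\Pi_{\mathfrak L}^z$ is the skew projection in $\mathfrak H_-$ onto $\mathfrak L$ parallel to $\mathrm{ran}(\mathbf A-zI)$. $\mathcal P(z)=L^{-1}\Pi_{\mathfrak L}^z\in\mathcal B(\mathfrak H_-,\mathbb C^p)$. A generalized resolvent of $A$ is $\mathbf R_z=P_{\mathfrak H}(\widetilde A-z)^{-1}|_{\mathfrak H}$ for a selfadjoint extension $\widetilde A\supseteq A$ in a Hilbert space $\widetilde{\mathfrak H}\supseteq\mathfrak H$; $\widetilde{\mathbf R}_z=(\mathbf R_{\bar z})^{\langle*\rangle}$, $\widehat{\mathbf R}_z=\widetilde{\mathbf R}_z-\mathbf R^0\in\mathcal B(\mathfrak H_-,\mathfrak H_+)$. $\mathcal Q(z)=L^{\langle*\rangle}(\mathbf R_z-\widehat{\mathbf R}_z\Pi_{\mathfrak L}^z)\in\mathcal B(\mathfrak H,\mathbb C^p)$, $z\in\rho(A,\mathfrak L)$,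 for any generalized resolvent holomorphic at $z$ (independent of the choice). Further $$\widehat{\mathcal P}(z)^{\langle*\rangle}=\begin{bmatrix} \mathcal P(z)^{\langle*\rangle} \\ \bar z\mathcal P(z)^{\langle*\rangle} \end{bmatrix},\qquad \widehat{\mathcal Q}(z)^{\langle*\rangle}=\begin{bmatrix} \mathcal Q(z)^{\langle*\rangle} \\ \bar z\mathcal Q(z)^{\langle*\rangle}+L \end{bmatrix},$$ which map $\mathbb C^p$ into $A^{\langle*\rangle}$. $J_p=\begin{bmatrix} 0 & -I_p \\ I_p & 0 \end{bmatrix}$, $\widetilde J_p=iJ_p$. The (right) $\Pi\mathfrak L$-resolvent matrix is defined for $z\in\rho(A,\mathfrak L)\cap\rho(A_0)$ by $$W_{\Pi\mathfrak L}(z)=\begin{bmatrix} \mathfrak a_{22}\mathfrak a_{12}^{-1} & \mathfrak a_{22}\mathfrak a_{12}^{-1}\mathfrak a_{11}-\mathfrak a_{21} \\ \mathfrak a_{12}^{-1} & \mathfrak a_{12}^{-1}\mathfrak a_{11} \end{bmatrix}(z),\qquad \begin{bmatrix} \mathfrak a_{11} & \mathfrak a_{12} \\ \mathfrak a_{21} & \mathfrak a_{22} \end{bmatrix}(z)=\begin{bmatrix} M(z) & \gamma(\bar z)^{\langle*\rangle}L \\ L^{\langle*\rangle}\gamma(z) & L^{\langle*\rangle}\widehat R_z^0L \end{bmatrix}.$$ *)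

theory Defs
  imports
    "HOL-Analysis.Complex_Analysis_Basics"
    "Jordan_Normal_Form.Schur_Decomposition"
begin

unbundle no vec_syntax
unbundle no inner_syntax

section \<open>Complex Hilbert spaces\<close>

text \<open>
  The library only has real inner product spaces. The inner product is linear in the first
  argument and induces the norm; completeness and compatibility with the real scalar
  multiplication come from \<^class>\<open>banach\<close>.
\<close>

class complex_hilbert = banach +
  fixes scaleC :: "complex \<Rightarrow> 'a \<Rightarrow> 'a" (infixr \<open>*\<^sub>C\<close> 75)
    and cinner :: "'a \<Rightarrow> 'a \<Rightarrow> complex"
  assumes scaleC_add_right: "c *\<^sub>C (x + y) = c *\<^sub>C x + c *\<^sub>C y"
    and scaleC_add_left: "(c + d) *\<^sub>C x = c *\<^sub>C x + d *\<^sub>C x"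
    and scaleC_scaleC: "c *\<^sub>C d *\<^sub>C x = (c * d) *\<^sub>C x"
    and scaleR_scaleC: "scaleR r x = complex_of_real r *\<^sub>C x"
    and cinner_add_left: "cinner (x + y) z = cinner x z + cinner y z"
    and cinner_scaleC_left: "cinner (c *\<^sub>C x) y = c * cinner x y"
    and cinner_commute: "cinner x y = cnj (cinner y x)"
    and cinner_self: "cinner x x = complex_of_real ((norm x)\<^sup>2)"

lemma scaleC_one: "1 *\<^sub>C x = (x :: 'a :: complex_hilbert)"
  using scaleR_scaleC[of 1 x] by simp

global_interpretation complex_vs: vector_space "scaleC :: complex \<Rightarrow> 'a \<Rightarrow> 'a :: complex_hilbert"
  by unfold_locales
    (simp_all add: scaleC_add_right scaleC_add_left scaleC_scaleC scaleC_one)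

definition has_cdim :: "'a :: complex_hilbert set \<Rightarrow> nat \<Rightarrow> bool" where
  "has_cdim N n \<longleftrightarrow>
     (\<exists>B. finite B \<and> card B = n \<and> complex_vs.independent B \<and> complex_vs.span B = N)"

definition bounded_op :: "('a :: complex_hilbert \<Rightarrow> 'b :: complex_hilbert) \<Rightarrow> bool" where
  "bounded_op T \<longleftrightarrow> bounded_linear T \<and> (\<forall>c x. T (c *\<^sub>C x) = c *\<^sub>C T x)"

definition ortho_proj :: "'a :: complex_hilbert set \<Rightarrow> 'a \<Rightarrow> 'a" where
  "ortho_proj S x = (THE y. y \<in> S \<and> (\<forall>s\<in>S. cinner (x - y) s = 0))"

definition hilbert_adjoint ::
  "('a :: complex_hilbert \<Rightarrow> 'b :: complex_hilbert) \<Rightarrow> 'b \<Rightarrow> 'a" where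
  "hilbert_adjoint V u = (THE w. \<forall>h. cinner w h = cinner u (V h))"


section \<open>Linear relations\<close>

definition linear_relation :: "('a :: complex_hilbert \<times> 'a) set \<Rightarrow> bool" where
  "linear_relation T \<longleftrightarrow>
     (0, 0) \<in> T \<and>
     (\<forall>(f, f')\<in>T. \<forall>(g, g')\<in>T. (f + g, f' + g') \<in> T) \<and>
     (\<forall>(f, f')\<in>T. \<forall>c. (c *\<^sub>C f, c *\<^sub>C f') \<in> T)"

definition rel_adjoint :: "('a :: complex_hilbert \<times> 'a) set \<Rightarrow> ('a \<times> 'a) set" where
  "rel_adjoint T = {(u, f). \<forall>(v, g)\<in>T. cinner f v = cinner u g}"

definition mul_part :: "('a :: complex_hilbert \<times> 'a) set \<Rightarrow> 'a set" where
  "mul_part T = {g. (0, g) \<in> T}"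

definition symmetric_rel :: "('a :: complex_hilbert \<times> 'a) set \<Rightarrow> bool" where
  "symmetric_rel T \<longleftrightarrow> linear_relation T \<and> T \<subseteq> rel_adjoint T"

definition selfadjoint_rel :: "('a :: complex_hilbert \<times> 'a) set \<Rightarrow> bool" where
  "selfadjoint_rel T \<longleftrightarrow> linear_relation T \<and> T = rel_adjoint T"

definition eigen_ker :: "('a :: complex_hilbert \<times> 'a) set \<Rightarrow> complex \<Rightarrow> 'a set" where
  "eigen_ker T z = {f. (f, z *\<^sub>C f) \<in> T}"

definition ran_shift :: "('a :: complex_hilbert \<times> 'a) set \<Rightarrow> complex \<Rightarrow> 'a set" where
  "ran_shift T z = {f' - z *\<^sub>C f |f f'. (f, f') \<in> T}"

definition resolvent_op :: "('a :: complex_hilbert \<times> 'a) set \<Rightarrow> complex \<Rightarrow> 'a \<Rightarrow> 'a" where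
  "resolvent_op T z f = (THE u. (u, f + z *\<^sub>C u) \<in> T)"

definition resolvent_set :: "('a :: complex_hilbert \<times> 'a) set \<Rightarrow> complex set" where
  "resolvent_set T =
     {z. (\<forall>f. \<exists>!u. (u, f + z *\<^sub>C u) \<in> T) \<and> bounded_op (resolvent_op T z)}"

definition regular_points :: "('a :: complex_hilbert \<times> 'a) set \<Rightarrow> complex set" where
  "regular_points T = {z. eigen_ker T z = {0} \<and> closed (ran_shift T z)}"

abbreviation defect_space :: "('a :: complex_hilbert \<times> 'a) set \<Rightarrow> complex \<Rightarrow> 'a set" where
  "defect_space A z \<equiv> eigen_ker (rel_adjoint A) z"

definition defect_space_hat ::
  "('a :: complex_hilbert \<times> 'a) set \<Rightarrow> complex \<Rightarrow> ('a \<times> 'a) set" where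
  "defect_space_hat A z = {(f, z *\<^sub>C f) |f. f \<in> defect_space A z}"

definition defect_numbers :: "('a :: complex_hilbert \<times> 'a) set \<Rightarrow> nat \<Rightarrow> nat \<Rightarrow> bool" where
  "defect_numbers A m n \<longleftrightarrow>
     (\<forall>z. Im z > 0 \<longrightarrow> has_cdim (defect_space A z) m) \<and>
     (\<forall>z. Im z < 0 \<longrightarrow> has_cdim (defect_space A z) n)"


section \<open>Boundary triples\<close>

text \<open>
  The coefficient space $C^p$ is \<^term>\<open>carrier_vec p :: complex vec set\<close>. For vectors
  \<open>v\<close>, \<open>w\<close> of this space, the scalar \<open>v \<bullet>c w\<close> is $w^* v$.
\<close>

definition linear_on_rel ::
  "nat \<Rightarrow> ('a :: complex_hilbert \<times> 'a) set \<Rightarrow> ('a \<times> 'a \<Rightarrow> complex vec) \<Rightarrow> bool" where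
  "linear_on_rel p T G \<longleftrightarrow>
     (\<forall>x\<in>T. G x \<in> carrier_vec p) \<and>
     (\<forall>(f, f')\<in>T. \<forall>(g, g')\<in>T. G (f + g, f' + g') = G (f, f') + G (g, g')) \<and>
     (\<forall>(f, f')\<in>T. \<forall>c. G (c *\<^sub>C f, c *\<^sub>C f') = c \<cdot>\<^sub>v G (f, f'))"

definition boundary_triple ::
  "nat \<Rightarrow> ('a :: complex_hilbert \<times> 'a) set \<Rightarrow> ('a \<times> 'a \<Rightarrow> complex vec) \<Rightarrow>
     ('a \<times> 'a \<Rightarrow> complex vec) \<Rightarrow> bool" where
  "boundary_triple p A G0 G1 \<longleftrightarrow>
     linear_on_rel p (rel_adjoint A) G0 \<and>
     linear_on_rel p (rel_adjoint A) G1 \<and>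
     (\<forall>(f, f')\<in>rel_adjoint A. \<forall>(g, g')\<in>rel_adjoint A.
        cinner f' g - cinner f g' =
          G1 (f, f') \<bullet>c G0 (g, g') - G0 (f, f') \<bullet>c G1 (g, g')) \<and>
     (\<forall>a\<in>carrier_vec p. \<forall>b\<in>carrier_vec p. \<exists>x\<in>rel_adjoint A. G0 x = a \<and> G1 x = b)"

definition ker_rel ::
  "nat \<Rightarrow> ('a :: complex_hilbert \<times> 'a) set \<Rightarrow> ('a \<times> 'a \<Rightarrow> complex vec) \<Rightarrow> ('a \<times> 'a) set" where
  "ker_rel p A G0 = {x \<in> rel_adjoint A. G0 x = 0\<^sub>v p}"

definition gamma_hat ::
  "('a :: complex_hilbert \<times> 'a) set \<Rightarrow> ('a \<times> 'a \<Rightarrow> complex vec) \<Rightarrow> complex \<Rightarrow>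
     complex vec \<Rightarrow> 'a \<times> 'a" where
  "gamma_hat A G0 z = inv_into (defect_space_hat A z) G0"

definition gamma_field ::
  "('a :: complex_hilbert \<times> 'a) set \<Rightarrow> ('a \<times> 'a \<Rightarrow> complex vec) \<Rightarrow> complex \<Rightarrow>
     complex vec \<Rightarrow> 'a" where
  "gamma_field A G0 z \<xi> = fst (gamma_hat A G0 z \<xi>)"

definition weyl_fun ::
  "('a :: complex_hilbert \<times> 'a) set \<Rightarrow> ('a \<times> 'a \<Rightarrow> complex vec) \<Rightarrow>
     ('a \<times> 'a \<Rightarrow> complex vec) \<Rightarrow> complex \<Rightarrow> complex vec \<Rightarrow> complex vec" where
  "weyl_fun A G0 G1 z \<xi> = G1 (gamma_hat A G0 z \<xi>)"


section \<open>The rigging\<close>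

definition plus_space :: "('a :: complex_hilbert \<times> 'a) set \<Rightarrow> 'a set" where
  "plus_space A = {h0 + h1 |h0 h1. h0 \<in> Domain (rel_adjoint A) \<and> h1 \<in> mul_part A}"

text \<open>
  The value does not depend on the choice of \<open>h0'\<close>, because the multivalued part of the adjoint
  is the orthogonal complement of the closure of the domain of \<open>A\<close>.
\<close>

definition plus_norm :: "('a :: complex_hilbert \<times> 'a) set \<Rightarrow> 'a \<Rightarrow> real" where
  "plus_norm A h =
     (THE r. \<exists>h0 h0' h1. (h0, h0') \<in> rel_adjoint A \<and> h1 \<in> mul_part A \<and> h = h0 + h1 \<and>
        r = sqrt ((norm h0)\<^sup>2 + (norm (ortho_proj (closure (Domain A)) h0'))\<^sup>2 + (norm h1)\<^sup>2))"

text \<open>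
  Elements of the negative space are functions on the whole type that vanish outside the
  positive space, so that equality of functions is equality of functionals. The pairing of
  \<open>\<phi>\<close> with \<open>h\<close> is \<open>\<phi> h\<close>.
\<close>

definition minus_space :: "('a :: complex_hilbert \<times> 'a) set \<Rightarrow> ('a \<Rightarrow> complex) set" where
  "minus_space A =
     {\<phi>. (\<forall>x\<in>plus_space A. \<forall>y\<in>plus_space A. \<phi> (x + y) = \<phi> x + \<phi> y) \<and>
         (\<forall>c. \<forall>x\<in>plus_space A. \<phi> (c *\<^sub>C x) = cnj c * \<phi> x) \<and>
         (\<exists>C. \<forall>x\<in>plus_space A. cmod (\<phi> x) \<le> C * plus_norm A x) \<and>
         (\<forall>x. x \<notin> plus_space A \<longrightarrow> \<phi> x = 0)}"

definition minus_norm :: "('a :: complex_hilbert \<times> 'a) set \<Rightarrow> ('a \<Rightarrow> complex) \<Rightarrow> real" where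
  "minus_norm A \<phi> = Sup {cmod (\<phi> h) |h. h \<in> plus_space A \<and> plus_norm A h \<le> 1}"

definition emb :: "('a :: complex_hilbert \<times> 'a) set \<Rightarrow> 'a \<Rightarrow> 'a \<Rightarrow> complex" where
  "emb A f = (\<lambda>h. if h \<in> plus_space A then cinner f h else 0)"

definition minus_subspace ::
  "('a :: complex_hilbert \<times> 'a) set \<Rightarrow> ('a \<Rightarrow> complex) set \<Rightarrow> bool" where
  "minus_subspace A S \<longleftrightarrow>
     S \<subseteq> minus_space A \<and> (\<lambda>h. 0) \<in> S \<and>
     (\<forall>\<phi>\<in>S. \<forall>\<psi>\<in>S. (\<lambda>h. \<phi> h + \<psi> h) \<in> S) \<and>
     (\<forall>\<phi>\<in>S. \<forall>c. (\<lambda>h. c * \<phi> h) \<in> S)"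

definition linear_bij_minus ::
  "nat \<Rightarrow> (complex vec \<Rightarrow> 'a \<Rightarrow> complex) \<Rightarrow> ('a :: complex_hilbert \<Rightarrow> complex) set \<Rightarrow> bool" where
  "linear_bij_minus p L S \<longleftrightarrow>
     bij_betw L (carrier_vec p) S \<and>
     (\<forall>\<xi>\<in>carrier_vec p. \<forall>\<eta>\<in>carrier_vec p. L (\<xi> + \<eta>) = (\<lambda>h. L \<xi> h + L \<eta> h)) \<and>
     (\<forall>\<xi>\<in>carrier_vec p. \<forall>c. L (c \<cdot>\<^sub>v \<xi>) = (\<lambda>h. c * L \<xi> h))"


section \<open>Adjoints with respect to the rigging\<close>

text \<open>
  One adjoint for each type of operator. Below, H, H+, H- stand for the middle, positive and
  negative space.
\<close>

text \<open>\<open>T\<close> from H to H+, adjoint from H- to H\<close>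

definition adj_H_plus ::
  "('a :: complex_hilbert \<Rightarrow> 'a) \<Rightarrow> ('a \<Rightarrow> complex) \<Rightarrow> 'a" where
  "adj_H_plus T \<phi> = (THE u. \<forall>g. cinner u g = \<phi> (T g))"

text \<open>\<open>T\<close> from H- to $C^p$, adjoint from $C^p$ to H+\<close>

definition adj_minus_C ::
  "('a :: complex_hilbert \<times> 'a) set \<Rightarrow> (('a \<Rightarrow> complex) \<Rightarrow> complex vec) \<Rightarrow>
     complex vec \<Rightarrow> 'a" where
  "adj_minus_C A T \<xi> = (THE h. h \<in> plus_space A \<and> (\<forall>\<phi>\<in>minus_space A. \<phi> h = T \<phi> \<bullet>c \<xi>))"

text \<open>\<open>T\<close> from H to $C^p$, adjoint from $C^p$ to H\<close>

definition adj_H_C :: "('a :: complex_hilbert \<Rightarrow> complex vec) \<Rightarrow> complex vec \<Rightarrow> 'a" where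
  "adj_H_C T \<xi> = (THE u. \<forall>f. cinner f u = T f \<bullet>c \<xi>)"

text \<open>\<open>T\<close> from $C^p$ to H+, adjoint from H- to $C^p$\<close>

definition adj_C_plus ::
  "nat \<Rightarrow> (complex vec \<Rightarrow> 'a :: complex_hilbert) \<Rightarrow> ('a \<Rightarrow> complex) \<Rightarrow> complex vec" where
  "adj_C_plus p T \<phi> =
     (THE v. v \<in> carrier_vec p \<and> (\<forall>\<xi>\<in>carrier_vec p. v \<bullet>c \<xi> = \<phi> (T \<xi>)))"

text \<open>\<open>L\<close> from $C^p$ to H-, adjoint from H+ to $C^p$\<close>

definition adj_C_minus ::
  "nat \<Rightarrow> (complex vec \<Rightarrow> 'a :: complex_hilbert \<Rightarrow> complex) \<Rightarrow> 'a \<Rightarrow> complex vec" where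
  "adj_C_minus p L h =
     (THE v. v \<in> carrier_vec p \<and> (\<forall>\<xi>\<in>carrier_vec p. v \<bullet>c \<xi> = cnj (L \<xi> h)))"


section \<open>Extended relations and the extended boundary triple\<close>

definition ext_rel ::
  "('a :: complex_hilbert \<times> 'a) set \<Rightarrow> ('a \<times> 'a) set \<Rightarrow> ('a \<times> ('a \<Rightarrow> complex)) set" where
  "ext_rel A B = {(f, \<phi>). \<phi> \<in> minus_space A \<and> (\<forall>(h, h')\<in>B. \<phi> h = cinner f h')}"

text \<open>
  \<open>R\<close> is a family of operators on H, either the resolvent of the kernel of \<open>G0\<close> or a
  generalized resolvent of \<open>A\<close>.
\<close>

definition R_tilde ::
  "(complex \<Rightarrow> 'a :: complex_hilbert \<Rightarrow> 'a) \<Rightarrow> complex \<Rightarrow> ('a \<Rightarrow> complex) \<Rightarrow> 'a" where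
  "R_tilde R z = adj_H_plus (R (cnj z))"

definition R_bold ::
  "nat \<Rightarrow> ('a :: complex_hilbert \<times> 'a) set \<Rightarrow> ('a \<times> 'a \<Rightarrow> complex vec) \<Rightarrow>
     ('a \<Rightarrow> complex) \<Rightarrow> 'a" where
  "R_bold p A G0 =
     adj_H_plus (\<lambda>g. (1 / 2) *\<^sub>C
       (resolvent_op (ker_rel p A G0) \<i> g + resolvent_op (ker_rel p A G0) (- \<i>) g))"

definition R_hat ::
  "nat \<Rightarrow> ('a :: complex_hilbert \<times> 'a) set \<Rightarrow> ('a \<times> 'a \<Rightarrow> complex vec) \<Rightarrow>
     (complex \<Rightarrow> 'a \<Rightarrow> 'a) \<Rightarrow> complex \<Rightarrow> ('a \<Rightarrow> complex) \<Rightarrow> 'a" where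
  "R_hat p A G0 R z \<phi> = R_tilde R z \<phi> - R_bold p A G0 \<phi>"

definition linear_bounded_on_ext ::
  "nat \<Rightarrow> ('a :: complex_hilbert \<times> 'a) set \<Rightarrow> ('a \<times> ('a \<Rightarrow> complex) \<Rightarrow> complex vec) \<Rightarrow> bool"
  where
  "linear_bounded_on_ext p A G \<longleftrightarrow>
     (\<forall>x\<in>ext_rel A A. G x \<in> carrier_vec p) \<and>
     (\<forall>(f, \<phi>)\<in>ext_rel A A. \<forall>(g, \<psi>)\<in>ext_rel A A.
        G (f + g, \<lambda>h. \<phi> h + \<psi> h) = G (f, \<phi>) + G (g, \<psi>)) \<and>
     (\<forall>(f, \<phi>)\<in>ext_rel A A. \<forall>c. G (c *\<^sub>C f, \<lambda>h. c * \<phi> h) = c \<cdot>\<^sub>v G (f, \<phi>)) \<and>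
     (\<exists>C. \<forall>(f, \<phi>)\<in>ext_rel A A.
        Re (G (f, \<phi>) \<bullet>c G (f, \<phi>)) \<le> C * ((norm f)\<^sup>2 + (minus_norm A \<phi>)\<^sup>2))"

text \<open>
  The extensions agree with \<open>G0\<close>, \<open>G1\<close> on the adjoint of \<open>A\<close>, hence on its defect spaces.
  The last condition is redundant given boundedness, and, together with the values on one
  defect space, it determines the extensions.
\<close>

definition extended_boundary_triple ::
  "nat \<Rightarrow> ('a :: complex_hilbert \<times> 'a) set \<Rightarrow> ('a \<times> 'a \<Rightarrow> complex vec) \<Rightarrow>
     ('a \<times> 'a \<Rightarrow> complex vec) \<Rightarrow> ('a \<times> ('a \<Rightarrow> complex) \<Rightarrow> complex vec) \<Rightarrow>
     ('a \<times> ('a \<Rightarrow> complex) \<Rightarrow> complex vec) \<Rightarrow> bool" where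
  "extended_boundary_triple p A G0 G1 E0 E1 \<longleftrightarrow>
     linear_bounded_on_ext p A E0 \<and> linear_bounded_on_ext p A E1 \<and>
     (\<forall>(f, f')\<in>rel_adjoint A. E0 (f, emb A f') = G0 (f, f') \<and> E1 (f, emb A f') = G1 (f, f')) \<and>
     (\<forall>z\<in>resolvent_set (ker_rel p A G0). \<forall>\<phi>\<in>minus_space A.
        let u = R_tilde (resolvent_op (ker_rel p A G0)) z \<phi>;
            x = (u, \<lambda>h. \<phi> h + emb A (z *\<^sub>C u) h)
        in E0 x = 0\<^sub>v p \<and> E1 x = adj_C_plus p (gamma_field A G0 (cnj z)) \<phi>)"


section \<open>Gauges, generalized resolvents and the operator functions P and Q\<close>

definition ran_ext :: "('a :: complex_hilbert \<times> 'a) set \<Rightarrow> complex \<Rightarrow> ('a \<Rightarrow> complex) set" where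
  "ran_ext A z = {(\<lambda>h. \<phi> h - emb A (z *\<^sub>C f) h) |f \<phi>. (f, \<phi>) \<in> ext_rel A (rel_adjoint A)}"

text \<open>
  Closedness of \<open>S\<close> is not required here: in the theorem \<open>S\<close> is finite-dimensional.
\<close>

definition gauge_set ::
  "('a :: complex_hilbert \<times> 'a) set \<Rightarrow> ('a \<Rightarrow> complex) set \<Rightarrow> complex set" where
  "gauge_set A S =
     {z \<in> regular_points A.
        ran_ext A z \<subseteq> minus_space A \<and> S \<subseteq> minus_space A \<and>
        (\<forall>\<phi>\<in>minus_space A. \<exists>!xy. fst xy \<in> ran_ext A z \<and> snd xy \<in> S \<and>
           \<phi> = (\<lambda>h. fst xy h + snd xy h))}"

definition skew_proj ::
  "('a :: complex_hilbert \<times> 'a) set \<Rightarrow> ('a \<Rightarrow> complex) set \<Rightarrow> complex \<Rightarrow>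
     ('a \<Rightarrow> complex) \<Rightarrow> 'a \<Rightarrow> complex" where
  "skew_proj A S z \<phi> = (THE y. y \<in> S \<and> (\<exists>x\<in>ran_ext A z. \<phi> = (\<lambda>h. x h + y h)))"

definition P_op ::
  "nat \<Rightarrow> ('a :: complex_hilbert \<times> 'a) set \<Rightarrow> ('a \<Rightarrow> complex) set \<Rightarrow>
     (complex vec \<Rightarrow> 'a \<Rightarrow> complex) \<Rightarrow> complex \<Rightarrow> ('a \<Rightarrow> complex) \<Rightarrow> complex vec" where
  "P_op p A S L z \<phi> = inv_into (carrier_vec p) L (skew_proj A S z \<phi>)"

text \<open>
  The inclusion of H into the larger Hilbert space is the isometry \<open>V\<close>, so compression is
  \<open>hilbert_adjoint V\<close> after restriction along \<open>V\<close>. The family \<open>R\<close> is the generalized resolvent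
  on a domain of holomorphy \<open>D\<close>; it is the compressed resolvent wherever the latter exists,
  and its holomorphic continuation at the remaining (real) points of \<open>D\<close>. Weak holomorphy of a
  family of bounded operators is equivalent to holomorphy in operator norm.
\<close>

definition generalized_resolvent ::
  "('a :: complex_hilbert \<times> 'a) set \<Rightarrow> ('a \<Rightarrow> 'b :: complex_hilbert) \<Rightarrow> ('b \<times> 'b) set \<Rightarrow>
     complex set \<Rightarrow> (complex \<Rightarrow> 'a \<Rightarrow> 'a) \<Rightarrow> bool" where
  "generalized_resolvent A V At D R \<longleftrightarrow>
     bounded_op V \<and> (\<forall>x y. cinner (V x) (V y) = cinner x y) \<and>
     selfadjoint_rel At \<and> (\<forall>(f, f')\<in>A. (V f, V f') \<in> At) \<and>
     open D \<and> cnj ` D = D \<and> - \<real> \<subseteq> D \<and>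
     (\<forall>z\<in>D. bounded_op (R z)) \<and>
     (\<forall>f g. (\<lambda>z. cinner (R z f) g) holomorphic_on D) \<and>
     (\<forall>z\<in>D \<inter> resolvent_set At. \<forall>f. R z f = hilbert_adjoint V (resolvent_op At z (V f)))"

definition Q_op ::
  "nat \<Rightarrow> ('a :: complex_hilbert \<times> 'a) set \<Rightarrow> ('a \<times> 'a \<Rightarrow> complex vec) \<Rightarrow>
     ('a \<Rightarrow> complex) set \<Rightarrow> (complex vec \<Rightarrow> 'a \<Rightarrow> complex) \<Rightarrow> (complex \<Rightarrow> 'a \<Rightarrow> 'a) \<Rightarrow>
     complex \<Rightarrow> 'a \<Rightarrow> complex vec" where
  "Q_op p A G0 S L R z f =
     adj_C_minus p L (R z f - R_hat p A G0 R z (skew_proj A S z (emb A f)))"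

definition P_hat_adj ::
  "('a :: complex_hilbert \<times> 'a) set \<Rightarrow> (complex \<Rightarrow> ('a \<Rightarrow> complex) \<Rightarrow> complex vec) \<Rightarrow> complex \<Rightarrow>
     complex vec \<Rightarrow> 'a \<times> ('a \<Rightarrow> complex)" where
  "P_hat_adj A P z \<xi> = (adj_minus_C A (P z) \<xi>, emb A (cnj z *\<^sub>C adj_minus_C A (P z) \<xi>))"

definition Q_hat_adj ::
  "('a :: complex_hilbert \<times> 'a) set \<Rightarrow> (complex vec \<Rightarrow> 'a \<Rightarrow> complex) \<Rightarrow>
     (complex \<Rightarrow> 'a \<Rightarrow> complex vec) \<Rightarrow> complex \<Rightarrow> complex vec \<Rightarrow> 'a \<times> ('a \<Rightarrow> complex)" where
  "Q_hat_adj A L Q z \<xi> =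
     (adj_H_C (Q z) \<xi>, \<lambda>h. emb A (cnj z *\<^sub>C adj_H_C (Q z) \<xi>) h + L \<xi> h)"


section \<open>Matrix functions\<close>

definition op_mat :: "nat \<Rightarrow> (complex vec \<Rightarrow> complex vec) \<Rightarrow> complex mat" where
  "op_mat p T = mat p p (\<lambda>(i, j). T (unit_vec p j) $ i)"

definition J_tilde :: "nat \<Rightarrow> complex mat" where
  "J_tilde p = \<i> \<cdot>\<^sub>m four_block_mat (0\<^sub>m p p) (- 1\<^sub>m p) (1\<^sub>m p) (0\<^sub>m p p)"

definition W_hat ::
  "nat \<Rightarrow> ('a :: complex_hilbert \<times> 'a) set \<Rightarrow> ('a \<times> ('a \<Rightarrow> complex) \<Rightarrow> complex vec) \<Rightarrow>
     ('a \<times> ('a \<Rightarrow> complex) \<Rightarrow> complex vec) \<Rightarrow> (complex vec \<Rightarrow> 'a \<Rightarrow> complex) \<Rightarrow>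
     (complex \<Rightarrow> ('a \<Rightarrow> complex) \<Rightarrow> complex vec) \<Rightarrow> (complex \<Rightarrow> 'a \<Rightarrow> complex vec) \<Rightarrow>
     complex \<Rightarrow> complex mat" where
  "W_hat p A E0 E1 L P Q z =
     mat_adjoint (four_block_mat
       (- op_mat p (\<lambda>\<xi>. E0 (Q_hat_adj A L Q z \<xi>))) (op_mat p (\<lambda>\<xi>. E0 (P_hat_adj A P z \<xi>)))
       (- op_mat p (\<lambda>\<xi>. E1 (Q_hat_adj A L Q z \<xi>))) (op_mat p (\<lambda>\<xi>. E1 (P_hat_adj A P z \<xi>))))"

definition W_kernel :: "nat \<Rightarrow> (complex \<Rightarrow> complex mat) \<Rightarrow> complex \<Rightarrow> complex \<Rightarrow> complex mat" where
  "W_kernel p W \<zeta> z =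
     (1 / (- \<i> * (z - cnj \<zeta>))) \<cdot>\<^sub>m (J_tilde p - W z * J_tilde p * mat_adjoint (W \<zeta>))"

text \<open>The operator $G(z)$ from H to $C^{2p}$; \<open>P z\<close> is applied to H as a subspace of H-.\<close>

definition G_op ::
  "('a :: complex_hilbert \<times> 'a) set \<Rightarrow> (complex \<Rightarrow> ('a \<Rightarrow> complex) \<Rightarrow> complex vec) \<Rightarrow>
     (complex \<Rightarrow> 'a \<Rightarrow> complex vec) \<Rightarrow> complex \<Rightarrow> 'a \<Rightarrow> complex vec" where
  "G_op A P Q z f = (- Q z f) @\<^sub>v P z (emb A f)"

definition G_adj ::
  "nat \<Rightarrow> ('a :: complex_hilbert \<times> 'a) set \<Rightarrow> (complex \<Rightarrow> ('a \<Rightarrow> complex) \<Rightarrow> complex vec) \<Rightarrow>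
     (complex \<Rightarrow> 'a \<Rightarrow> complex vec) \<Rightarrow> complex \<Rightarrow> complex vec \<Rightarrow> 'a" where
  "G_adj p A P Q \<zeta> v =
     - adj_H_C (Q \<zeta>) (vec_first v p) + adj_minus_C A (P \<zeta>) (vec_last v p)"

definition resolvent_matrix ::
  "nat \<Rightarrow> ('a :: complex_hilbert \<times> 'a) set \<Rightarrow> ('a \<times> 'a \<Rightarrow> complex vec) \<Rightarrow>
     ('a \<times> 'a \<Rightarrow> complex vec) \<Rightarrow> (complex vec \<Rightarrow> 'a \<Rightarrow> complex) \<Rightarrow> complex \<Rightarrow> complex mat" where
  "resolvent_matrix p A G0 G1 L z =
     (let a11 = op_mat p (weyl_fun A G0 G1 z);
          a12 = op_mat p (\<lambda>\<xi>. adj_C_plus p (gamma_field A G0 (cnj z)) (L \<xi>));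
          a21 = op_mat p (\<lambda>\<xi>. adj_C_minus p L (gamma_field A G0 z \<xi>));
          a22 = op_mat p (\<lambda>\<xi>. adj_C_minus p L
                  (R_hat p A G0 (resolvent_op (ker_rel p A G0)) z (L \<xi>)));
          a12i = the (mat_inverse a12)
      in four_block_mat (a22 * a12i) (a22 * a12i * a11 - a21) a12i (a12i * a11))"

end

theory Submission
  imports Defs
begin

text \<open>
  Green's identity extends to the extended triple once every functional \<open>\<phi>\<close> is paired only with
  vectors from which the symmetric mean \<open>\<^bold>R\<^sup>0\<close> of the resolvents at \<open>\<plusminus>\<i>\<close> has been subtracted.
  For the elements \<open>-Q\<^sup>*x + P\<^sup>*y\<close> these regularized pairings with \<open>L\<close> are just \<open>y\<close>: \<open>P\<close> is a left
  inverse of \<open>L\<close>, and the \<open>L\<close>-part of \<open>Q\<^sup>*x - \<^bold>R\<^sup>0 L x\<close> vanishes because the regularized generalized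
  resolvent is symmetric. The extended identity for two such elements is the kernel identity.
  At \<open>\<zeta> = cnj z\<close> it reads \<open>W(z) J W(cnj z)\<^sup>* = J\<close>, so \<open>W(z)\<close> is invertible; writing the same elements
  at \<open>cnj z\<close> through the resolvent of \<open>A0\<close> and the gamma field then determines \<open>W(z)\<close>.

  Every functional on the positive space is of the form \<open>h \<mapsto> (a, h) + (b, h')\<close> on the graph of the
  adjoint. This makes the adjoints explicit, at real points as well, and replaces density arguments.
\<close>

section \<open>Orthogonal projections and the Riesz representation\<close>

text \<open>The first component of an element of the extended relation is only in the middle space,
  so pairing a functional with it makes no sense by itself. The subtraction works because the part
  outside the domain of the adjoint does not depend on the resolvent: if \<open>\<phi>\<close> is
  given by \<open>(a, b)\<close>, every extended resolvent sends it to \<open>b\<close> plus a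
  vector of that domain. Any combination of resolvents with weights of sum 1 would remove
  \<open>b\<close>; equal weights at two conjugate points also make the Green form of two means
  vanish, by selfadjointness of \<open>A0\<close>, and make the regularized pairings hermitian. The
  pair \<open>(a, b)\<close> comes from Riesz on the graph of the adjoint, a closed subspace of the
  product space whose norm dominates the positive norm. The generalized resolvent behind
  \<open>Q\<close> may change from point to point. So the argument uses, at each \<open>z\<close>,
  only that its values at \<open>z\<close> and \<open>cnj z\<close> are adjoint to each other and
  are left inverses of the shifts of \<open>A\<close>; holomorphy serves to reach real points.
  Elements built from different resolvents are compared by uniqueness: a defect vector annihilated
  by the range of \<open>L\<close> is zero.\<close>

lemma cinner_add_right: "cinner x (y + z) = cinner x y + cinner (x :: 'a :: complex_hilbert) z"
  by (subst (1 2 3) cinner_commute) (simp add: cinner_add_left)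

lemma cinner_scaleC_right: "cinner x (c *\<^sub>C y) = cnj c * cinner (x :: 'a :: complex_hilbert) y"
  by (subst (1 2) cinner_commute) (simp add: cinner_scaleC_left)

lemma cinner_zero_left [simp]: "cinner 0 (x :: 'a :: complex_hilbert) = 0"
  using cinner_add_left[of 0 0 x] by simp

lemma cinner_zero_right [simp]: "cinner (x :: 'a :: complex_hilbert) 0 = 0"
  using cinner_add_right[of x 0 0] by simp

lemma cinner_minus_left: "cinner (- x) y = - cinner (x :: 'a :: complex_hilbert) y"
  using cinner_add_left[of x "- x" y] by (simp add: add_eq_0_iff2)

lemma cinner_minus_right: "cinner x (- y) = - cinner (x :: 'a :: complex_hilbert) y"
  using cinner_add_right[of x y "- y"] by (simp add: add_eq_0_iff2)

lemma cinner_diff_left: "cinner (x - y) z = cinner x z - cinner (y :: 'a :: complex_hilbert) z"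
  using cinner_add_left[of x "- y" z] by (simp add: cinner_minus_left)

lemma cinner_diff_right: "cinner z (x - y) = cinner z x - cinner (z :: 'a :: complex_hilbert) y"
  using cinner_add_right[of z x "- y"] by (simp add: cinner_minus_right)

lemmas cinner_simps = cinner_add_left cinner_add_right cinner_diff_left cinner_diff_right
  cinner_minus_left cinner_minus_right cinner_scaleC_left cinner_scaleC_right

lemma cinner_eq_zero_iff [simp]: "cinner x x = 0 \<longleftrightarrow> (x :: 'a :: complex_hilbert) = 0"
  by (simp add: cinner_self)

lemma cinner_ext:
  fixes x y :: "'a :: complex_hilbert"
  assumes "\<And>z. cinner x z = cinner y z"
  shows "x = y"
proof -
  have "cinner (x - y) (x - y) = 0" using assms by (simp add: cinner_diff_left)
  then show ?thesis by simp
qed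

lemma cinner_ext_right:
  fixes x y :: "'a :: complex_hilbert"
  assumes "\<And>z. cinner z x = cinner z y"
  shows "x = y"
  by (rule cinner_ext) (metis assms cinner_commute)

lemma norm_add_sq:
  fixes x y :: "'a :: complex_hilbert"
  shows "(norm (x + y))\<^sup>2 = (norm x)\<^sup>2 + (norm y)\<^sup>2 + 2 * Re (cinner x y)"
proof -
  have "complex_of_real ((norm (x + y))\<^sup>2) = cinner (x + y) (x + y)" by (simp add: cinner_self)
  also have "\<dots> = cinner x x + cinner y y + (cinner x y + cnj (cinner x y))"
    using cinner_commute[of y x] by (simp add: cinner_simps)
  also have "\<dots> = complex_of_real ((norm x)\<^sup>2 + (norm y)\<^sup>2 + 2 * Re (cinner x y))"
    by (simp add: cinner_self complex_eq_iff)
  finally show ?thesis by (simp only: of_real_eq_iff)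
qed

lemma norm_scaleC: "norm (c *\<^sub>C (x :: 'a :: complex_hilbert)) = cmod c * norm x"
proof -
  have "complex_of_real ((norm (c *\<^sub>C x))\<^sup>2) = cinner (c *\<^sub>C x) (c *\<^sub>C x)" by (simp add: cinner_self)
  also have "\<dots> = c * cnj c * cinner x x" by (simp add: cinner_scaleC_left cinner_scaleC_right)
  also have "\<dots> = c * cnj c * complex_of_real ((norm x)\<^sup>2)" by (simp add: cinner_self)
  also have "\<dots> = complex_of_real ((cmod c * norm x)\<^sup>2)"
    by (simp only: power_mult_distrib of_real_mult complex_norm_square)
  finally have "(norm (c *\<^sub>C x))\<^sup>2 = (cmod c * norm x)\<^sup>2" by (simp only: of_real_eq_iff)
  then show ?thesis by simp
qed

text \<open>The subtracted vector is the projection of \<open>x\<close> to the line of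
  \<open>y\<close>. Positivity of the left side is Cauchy-Schwarz; the decrease on the right later
  forces a nearest point to leave an orthogonal remainder.\<close>

lemma norm_diff_best_sq:
  fixes x y :: "'a :: complex_hilbert"
  assumes "y \<noteq> 0"
  shows "(norm (x - (cinner x y / cinner y y) *\<^sub>C y))\<^sup>2 = (norm x)\<^sup>2 - (cmod (cinner x y))\<^sup>2 / (norm y)\<^sup>2"
proof -
  define c where "c = cinner x y / cinner y y"
  have yy: "cinner y y = complex_of_real ((norm y)\<^sup>2)" by (rule cinner_self)
  have "Re (cinner x (- (c *\<^sub>C y))) = - Re (cnj c * cinner x y)" by (simp add: cinner_simps)
  also have "cnj c * cinner x y = (cinner x y * cnj (cinner x y)) / complex_of_real ((norm y)\<^sup>2)"
    unfolding c_def yy by simp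
  also have "\<dots> = complex_of_real ((cmod (cinner x y))\<^sup>2 / (norm y)\<^sup>2)"
    by (simp only: of_real_divide complex_norm_square)
  finally have 1: "Re (cinner x (- (c *\<^sub>C y))) = - ((cmod (cinner x y))\<^sup>2 / (norm y)\<^sup>2)" by simp
  have "(norm (- (c *\<^sub>C y)))\<^sup>2 = (cmod (cinner x y))\<^sup>2 / (norm y)\<^sup>2"
    using assms unfolding c_def yy
    by (simp add: norm_scaleC norm_divide norm_mult field_simps power2_eq_square)
  with 1 norm_add_sq[of x "- (c *\<^sub>C y)"] show ?thesis by (simp add: c_def)
qed

lemma cinner_Cauchy_Schwarz: "cmod (cinner x y) \<le> norm x * norm (y :: 'a :: complex_hilbert)"
proof (cases "y = 0")
  case False
  have "0 \<le> (norm x)\<^sup>2 - (cmod (cinner x y))\<^sup>2 / (norm y)\<^sup>2"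
    unfolding norm_diff_best_sq[OF False, symmetric] by simp
  then have "(cmod (cinner x y))\<^sup>2 \<le> (norm x * norm y)\<^sup>2"
    using False by (simp add: field_simps)
  then show ?thesis by (rule power2_le_imp_le) simp
qed simp

interpretation cinner: bounded_bilinear "cinner :: 'a :: complex_hilbert \<Rightarrow> 'a \<Rightarrow> complex"
proof
  show "\<exists>K. \<forall>a b. norm (cinner a b :: complex) \<le> norm (a :: 'a) * norm b * K"
    by (rule exI[of _ 1]) (simp add: cinner_Cauchy_Schwarz)
qed (simp_all add: cinner_simps scaleR_scaleC scaleR_conv_of_real)

lemma bounded_linear_scaleC: "bounded_linear (\<lambda>x :: 'a :: complex_hilbert. c *\<^sub>C x)"
  by (rule bounded_linear_intro[of _ "cmod c"])
    (simp_all add: scaleC_add_right scaleR_scaleC scaleC_scaleC norm_scaleC mult.commute)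

lemmas tendsto_scaleC = bounded_linear.tendsto[OF bounded_linear_scaleC]

lemma closure_csubspace:
  fixes S :: "'a :: complex_hilbert set"
  assumes S: "complex_vs.subspace S"
  shows "complex_vs.subspace (closure S)"
proof (rule complex_vs.subspaceI)
  show "0 \<in> closure S" using complex_vs.subspace_0[OF S] closure_subset by blast
next
  fix x y assume "x \<in> closure S" "y \<in> closure S"
  then obtain f g where "\<And>n. f n \<in> S" "f \<longlonglongrightarrow> x" "\<And>n. g n \<in> S" "g \<longlonglongrightarrow> y"
    unfolding closure_sequential by blast
  then show "x + y \<in> closure S"
    unfolding closure_sequential
    by (intro exI[of _ "\<lambda>n. f n + g n"]) (auto intro: tendsto_add complex_vs.subspace_add[OF S])
next
  fix x c assume "x \<in> closure S"
  then obtain f where "\<And>n. f n \<in> S" "f \<longlonglongrightarrow> x"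
    unfolding closure_sequential by blast
  then show "c *\<^sub>C x \<in> closure S"
    unfolding closure_sequential
    by (intro exI[of _ "\<lambda>n. c *\<^sub>C f n"]) (auto intro: tendsto_scaleC complex_vs.subspace_scale[OF S])
qed

lemma orthogonal_closure:
  fixes S :: "'a :: complex_hilbert set"
  assumes "\<And>s. s \<in> S \<Longrightarrow> cinner x s = 0" and "y \<in> closure S"
  shows "cinner x y = 0"
proof -
  obtain f where f: "\<And>n. f n \<in> S" "f \<longlonglongrightarrow> y"
    using assms(2) unfolding closure_sequential by blast
  have "(\<lambda>n. cinner x (f n)) \<longlonglongrightarrow> cinner x y" by (intro cinner.tendsto tendsto_const f)
  then show ?thesis using assms(1)[OF f(1)] by (simp add: LIMSEQ_const_iff)
qed

lemma projection_exists:
  fixes M :: "'a :: complex_hilbert set"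
  assumes sub: "complex_vs.subspace M" and cl: "closed M"
  obtains y where "y \<in> M" and "\<And>m. m \<in> M \<Longrightarrow> cinner (x - y) m = 0"
proof -
  let ?N = "(\<lambda>y. (norm (x - y))\<^sup>2) ` M"
  define d where "d = Inf ?N"
  have ne: "?N \<noteq> {}" using complex_vs.subspace_0[OF sub] by blast
  have bdd: "bdd_below ?N" by (rule bdd_belowI[of _ 0]) auto
  have dle: "d \<le> (norm (x - y))\<^sup>2" if "y \<in> M" for y
    unfolding d_def using that bdd by (intro cInf_lower) auto
  have "\<exists>y\<in>M. (norm (x - y))\<^sup>2 < d + inverse (real (Suc n))" for n
  proof -
    have "Inf ?N < d + inverse (real (Suc n))" unfolding d_def by simp
    from cInf_lessD[OF ne this] show ?thesis by auto
  qed
  then obtain Y where YM: "\<And>n. Y n \<in> M"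
    and Yd: "\<And>n. (norm (x - Y n))\<^sup>2 < d + inverse (real (Suc n))"
    by metis
  \<comment> \<open>Parallelogram identity for \<open>x - Y m\<close> and \<open>x - Y n\<close>:
    the midpoint of \<open>Y m\<close> and \<open>Y n\<close> is in \<open>M\<close>, so their sum
    has squared norm at least \<open>4 * d\<close>, and little is left for the difference.\<close>
  have par: "(norm (Y m - Y n))\<^sup>2 \<le> 2 * inverse (real (Suc m)) + 2 * inverse (real (Suc n))" for m n
  proof -
    let ?a = "x - Y m" and ?b = "x - Y n"
    have mid: "(1/2) *\<^sub>C (Y m + Y n) \<in> M"
      by (intro complex_vs.subspace_scale[OF sub] complex_vs.subspace_add[OF sub] YM)
    have "x = (1/2) *\<^sub>C (x + x)"
      by (simp add: scaleC_add_left[symmetric] scaleC_add_right scaleC_one)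
    then have "x - (1/2) *\<^sub>C (Y m + Y n) = (1/2) *\<^sub>C (?a + ?b)"
      by (metis (no_types, lifting) complex_vs.scale_right_diff_distrib add_diff_add)
    with dle[OF mid] have "4 * d \<le> (norm (?a + ?b))\<^sup>2"
      by (simp add: norm_scaleC power_divide norm_divide)
    moreover have "(norm (?a + ?b))\<^sup>2 + (norm (?a + (- ?b)))\<^sup>2 = 2 * (norm ?a)\<^sup>2 + 2 * (norm ?b)\<^sup>2"
      unfolding norm_add_sq by (simp add: cinner_simps norm_minus_commute)
    moreover have "norm (?a + (- ?b)) = norm (Y m - Y n)" by (simp add: norm_minus_commute)
    ultimately show ?thesis using Yd[of m] Yd[of n] by simp
  qed
  have "Cauchy Y"
  proof (rule metric_CauchyI)
    fix e :: real assume e: "e > 0"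
    obtain k :: nat where k: "inverse (real (Suc k)) < e\<^sup>2 / 4"
      using reals_Archimedean[of "e\<^sup>2 / 4"] e by auto
    have "dist (Y m) (Y n) < e" if "m \<ge> k" "n \<ge> k" for m n
    proof -
      have "inverse (real (Suc m)) \<le> inverse (real (Suc k))" "inverse (real (Suc n)) \<le> inverse (real (Suc k))"
        using that by (auto intro!: le_imp_inverse_le)
      then have "(norm (Y m - Y n))\<^sup>2 < e\<^sup>2" using par[of m n] k by linarith
      then show ?thesis unfolding dist_norm using e by (meson less_imp_le power2_less_imp_less)
    qed
    then show "\<exists>k. \<forall>m\<ge>k. \<forall>n\<ge>k. dist (Y m) (Y n) < e" by blast
  qed
  then obtain y where y: "Y \<longlonglongrightarrow> y" using Cauchy_convergent convergent_def by blast
  have yM: "y \<in> M" using cl YM y closed_sequentially by blast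
  have yd: "(norm (x - y))\<^sup>2 \<le> d"
  proof (rule LIMSEQ_le)
    show "(\<lambda>n. (norm (x - Y n))\<^sup>2) \<longlonglongrightarrow> (norm (x - y))\<^sup>2" by (intro tendsto_intros y)
    have "(\<lambda>n. d + inverse (real (Suc n))) \<longlonglongrightarrow> d + 0"
      by (intro tendsto_intros LIMSEQ_inverse_real_of_nat)
    then show "(\<lambda>n. d + inverse (real (Suc n))) \<longlonglongrightarrow> d" by simp
    show "\<exists>N. \<forall>n\<ge>N. (norm (x - Y n))\<^sup>2 \<le> d + inverse (real (Suc n))"
      using Yd less_imp_le by blast
  qed
  have "cinner (x - y) m = 0" if m: "m \<in> M" for m
  proof (cases "m = 0")
    case False
    \<comment> \<open>If the inner product were nonzero, moving from \<open>y\<close> by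
      \<open>?t *\<^sub>C m\<close> would bring the squared distance strictly below the infimum
      \<open>d\<close>.\<close>
    let ?t = "cinner (x - y) m / cinner m m"
    have "y + ?t *\<^sub>C m \<in> M"
      by (intro complex_vs.subspace_add[OF sub] complex_vs.subspace_scale[OF sub] yM m)
    from order_trans[OF yd dle[OF this]]
    have "(norm (x - y))\<^sup>2 \<le> (norm (x - y - ?t *\<^sub>C m))\<^sup>2" by (simp only: diff_diff_eq)
    with norm_diff_best_sq[OF False, of "x - y"]
    have "(cmod (cinner (x - y) m))\<^sup>2 / (norm m)\<^sup>2 \<le> 0" by simp
    then show ?thesis using False by (simp add: divide_le_0_iff)
  qed simp
  with yM that show thesis by blast
qed

lemma orthogonal_eq_UNIV:
  fixes M :: "'a :: complex_hilbert set"
  assumes "complex_vs.subspace M" "closed M" and "\<And>x. (\<And>m. m \<in> M \<Longrightarrow> cinner x m = 0) \<Longrightarrow> x = 0"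
  shows "M = UNIV"
proof -
  have "x \<in> M" for x
    by (rule projection_exists[OF assms(1,2), of x]) (use assms(3) in fastforce)
  then show ?thesis by blast
qed

text \<open>Conjugate linear because the inner product is linear in its first argument; on a
  subspace because the main use is on the graph of an adjoint relation. The representing vector is a
  multiple of the component \<open>u\<close> of some \<open>x\<close> orthogonal to the kernel of
  \<open>F\<close>.\<close>

lemma Riesz:
  fixes M :: "'a :: complex_hilbert set"
  assumes sub: "complex_vs.subspace M" and cl: "closed M"
    and add: "\<And>x y. x \<in> M \<Longrightarrow> y \<in> M \<Longrightarrow> F (x + y) = F x + F y"
    and scale: "\<And>c x. x \<in> M \<Longrightarrow> F (c *\<^sub>C x) = cnj c * F x"
    and bdd: "\<And>x. x \<in> M \<Longrightarrow> cmod (F x) \<le> C * norm x"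
  obtains a where "\<And>x. x \<in> M \<Longrightarrow> F x = cinner a x"
proof (cases "\<forall>x\<in>M. F x = 0")
  case True
  then show ?thesis using that[of 0] by simp
next
  case False
  then obtain x where x: "x \<in> M" "F x \<noteq> 0" by blast
  define K where "K = {y \<in> M. F y = 0}"
  have diff: "F (x - y) = F x - F y" if "x \<in> M" "y \<in> M" for x y
    using add[of x "(-1) *\<^sub>C y"] scale[of y "-1"] that complex_vs.subspace_scale[OF sub, of y "-1"]
    by simp
  have F0: "F 0 = 0" using scale[of 0 0] complex_vs.subspace_0[OF sub] by simp
  have subK: "complex_vs.subspace K"
    unfolding K_def complex_vs.subspace_def
    using sub add scale F0 by (auto simp: complex_vs.subspace_def)
  have clK: "closed K"
  proof (subst closed_sequential_limits, intro allI impI, elim conjE)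
    fix Y y assume Y: "\<forall>n. Y n \<in> K" "Y \<longlonglongrightarrow> y"
    have yM: "y \<in> M" using cl Y unfolding K_def closed_sequential_limits by blast
    have "(\<lambda>n. C * norm (y - Y n)) \<longlonglongrightarrow> C * norm (y - y)" by (intro tendsto_intros Y)
    moreover have "cmod (F y) \<le> C * norm (y - Y n)" for n
    proof -
      have "Y n \<in> M" "F (Y n) = 0" using Y unfolding K_def by auto
      moreover have "y - Y n \<in> M" by (intro complex_vs.subspace_diff[OF sub] yM) fact
      ultimately show ?thesis using bdd[of "y - Y n"] diff[of y "Y n"] yM by simp
    qed
    ultimately have "cmod (F y) \<le> C * norm (y - y)" by (intro LIMSEQ_le_const) auto
    then show "y \<in> K" unfolding K_def using yM by simp
  qed
  obtain k where k: "k \<in> K" "\<And>m. m \<in> K \<Longrightarrow> cinner (x - k) m = 0"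
    using projection_exists[OF subK clK] by blast
  define u where "u = x - k"
  have uM: "u \<in> M" unfolding u_def using x(1) k(1) sub K_def complex_vs.subspace_diff by blast
  have Fu: "F u \<noteq> 0" unfolding u_def using diff[of x k] x k(1) K_def by simp
  then have u0: "u \<noteq> 0" using F0 by auto
  have "F y = cinner ((F u / cinner u u) *\<^sub>C u) y" if y: "y \<in> M" for y
  proof -
    \<comment> \<open>By conjugate linearity \<open>F (c *\<^sub>C u)\<close> equals
      \<open>F y\<close>, so \<open>y - c *\<^sub>C u\<close> falls into the kernel.\<close>
    define c where "c = cnj (F y / F u)"
    have cu: "c *\<^sub>C u \<in> M" by (rule complex_vs.subspace_scale[OF sub uM])
    have "F (y - c *\<^sub>C u) = 0" using diff[OF y cu] scale[OF uM] Fu by (simp add: c_def)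
    then have "y - c *\<^sub>C u \<in> K" unfolding K_def using complex_vs.subspace_diff[OF sub y cu] by blast
    from k(2)[OF this] have "cinner u y = (F y / F u) * cinner u u"
      by (simp add: u_def[symmetric] cinner_simps c_def)
    then show ?thesis using Fu u0 by (simp add: cinner_simps)
  qed
  then show ?thesis using that by blast
qed

text \<open>Relations become subsets of a Hilbert space: projection yields the double adjoint, and
  Riesz represents functionals on the graph of the adjoint.\<close>

instantiation prod :: (complex_hilbert, complex_hilbert) complex_hilbert
begin

definition scaleC_prod :: "complex \<Rightarrow> 'a \<times> 'b \<Rightarrow> 'a \<times> 'b" where
  "scaleC_prod c x = (c *\<^sub>C fst x, c *\<^sub>C snd x)"

definition cinner_prod :: "'a \<times> 'b \<Rightarrow> 'a \<times> 'b \<Rightarrow> complex" where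
  "cinner_prod x y = cinner (fst x) (fst y) + cinner (snd x) (snd y)"

instance
proof
  fix x y z :: "'a \<times> 'b" and c d :: complex and r :: real
  show "cinner x y = cnj (cinner y x)"
    unfolding cinner_prod_def using cinner_commute[of "fst x" "fst y"] cinner_commute[of "snd x" "snd y"] by simp
  show "cinner x x = complex_of_real ((norm x)\<^sup>2)"
    unfolding cinner_prod_def norm_prod_def by (simp add: cinner_self)
qed (auto simp: scaleC_prod_def cinner_prod_def prod_eq_iff scaleC_add_right scaleC_add_left
      scaleC_scaleC scaleR_scaleC cinner_simps algebra_simps)

end

lemma scaleC_Pair [simp]: "c *\<^sub>C (a, b) = (c *\<^sub>C a, c *\<^sub>C b)"
  by (simp add: scaleC_prod_def)

lemma cinner_Pair [simp]: "cinner (a, b) (c, d) = cinner a c + cinner b d"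
  by (simp add: cinner_prod_def)

lemma linear_relation_iff_subspace: "linear_relation T \<longleftrightarrow> complex_vs.subspace T"
  unfolding linear_relation_def complex_vs.subspace_def
  by (auto simp: zero_prod_def Ball_def split_paired_all)

section \<open>Selfadjoint relations and generalized resolvents\<close>

lemma in_rel_adjoint:
  "(u, f) \<in> rel_adjoint T \<longleftrightarrow> (\<forall>v g. (v, g) \<in> T \<longrightarrow> cinner f v = cinner u g)"
  unfolding rel_adjoint_def by auto

lemma rel_adjointD:
  "(u, f) \<in> rel_adjoint T \<Longrightarrow> (v, g) \<in> T \<Longrightarrow> cinner f v = cinner u g"
  by (simp add: in_rel_adjoint)

lemma subspace_rel_adjoint: "complex_vs.subspace (rel_adjoint T)"
  by (rule complex_vs.subspaceI) (auto simp: in_rel_adjoint zero_prod_def cinner_simps)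

lemma closed_rel_adjoint: "closed (rel_adjoint T)"
proof -
  have "rel_adjoint T = (\<Inter>vg\<in>T. {x. cinner (snd x) (fst vg) = cinner (fst x) (snd vg)})"
    by (fastforce simp: rel_adjoint_def)
  moreover have "closed {x :: 'a \<times> 'a. cinner (snd x) v = cinner (fst x) g}" for v g
    by (intro closed_Collect_eq cinner.continuous_on continuous_intros)
  ultimately show ?thesis by auto
qed

lemma subspace_PairD:
  assumes "complex_vs.subspace T" "(a, b) \<in> T" "(c, d) \<in> T"
  shows "(a + c, b + d) \<in> T" "(a - c, b - d) \<in> T" "(k *\<^sub>C a, k *\<^sub>C b) \<in> T"
  using complex_vs.subspace_add[OF assms] complex_vs.subspace_diff[OF assms]
    complex_vs.subspace_scale[OF assms(1,2)] by simp_all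

lemmas rel_adjoint_add = subspace_PairD(1)[OF subspace_rel_adjoint]
lemmas rel_adjoint_diff = subspace_PairD(2)[OF subspace_rel_adjoint]

lemma rel_adjoint_scale: "(a, b) \<in> rel_adjoint T \<Longrightarrow> (c *\<^sub>C a, c *\<^sub>C b) \<in> rel_adjoint T"
  using subspace_PairD(3)[OF subspace_rel_adjoint] by blast

lemma rel_adjoint_zero: "(0, 0) \<in> rel_adjoint T"
  by (simp add: in_rel_adjoint)

text \<open>The adjoint is the orthogonal complement of \<open>T\<close> with \<open>(a, b)\<close>
  turned into \<open>(- b, a)\<close>. The component \<open>(a, b)\<close> of \<open>x\<close>
  orthogonal to \<open>T\<close> thus gives an element of the adjoint, and testing
  \<open>x - y\<close> against it shows that this component is zero.\<close>

lemma rel_adjoint_adjoint: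
  assumes "closed T" "complex_vs.subspace T"
  shows "rel_adjoint (rel_adjoint T) = T"
proof (intro equalityI subsetI)
  fix x assume x: "x \<in> rel_adjoint (rel_adjoint T)"
  obtain y where y: "y \<in> T" "\<And>m. m \<in> T \<Longrightarrow> cinner (x - y) m = 0"
    using projection_exists[OF assms(2,1)] by blast
  obtain a b where ab: "x - y = (a, b)" by fastforce
  have 0: "cinner a v + cinner b g = 0" if "(v, g) \<in> T" for v g
    using y(2)[OF that] by (simp add: ab)
  have "(- b, a) \<in> rel_adjoint T"
    using 0 by (auto simp: in_rel_adjoint cinner_minus_left add_eq_0_iff2)
  moreover have "(u, f) \<in> rel_adjoint T \<Longrightarrow> cinner (snd y) u = cinner (fst y) f" for u f
    using y(1) by (metis cinner_commute prod.collapse rel_adjointD)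
  moreover have "(u, f) \<in> rel_adjoint T \<Longrightarrow> cinner (snd x) u = cinner (fst x) f" for u f
    using x by (metis prod.collapse rel_adjointD)
  ultimately have "cinner (snd (x - y)) (- b) = cinner (fst (x - y)) a"
    by (simp add: cinner_diff_left)
  then have "cinner (x - y) (x - y) = 0"
    by (simp add: ab cinner_minus_right) (metis add.commute neg_eq_iff_add_eq_0)
  then show "x \<in> T" using y(1) by simp
next
  fix x assume "x \<in> T"
  then show "x \<in> rel_adjoint (rel_adjoint T)"
    by (cases x) (auto simp: in_rel_adjoint, metis cinner_commute)
qed

section \<open>Selfadjoint relations away from the real axis\<close>

lemma selfadjoint_rel_swap:
  assumes "selfadjoint_rel T" "(u, u') \<in> T" "(v, v') \<in> T"
  shows "cinner u' v = cinner u v'"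
  using assms unfolding selfadjoint_rel_def by (metis rel_adjointD)

lemma selfadjoint_rel_closed: "selfadjoint_rel T \<Longrightarrow> closed T"
  unfolding selfadjoint_rel_def by (metis closed_rel_adjoint)

lemma selfadjoint_rel_subspace: "selfadjoint_rel T \<Longrightarrow> complex_vs.subspace T"
  unfolding selfadjoint_rel_def by (simp add: linear_relation_iff_subspace)

text \<open>\<open>cinner f' f\<close> is real, so the imaginary part of
  \<open>cinner (f' - z *\<^sub>C f) f\<close> is \<open>- Im z\<close> times the squared norm of
  \<open>f\<close>; Cauchy-Schwarz does the rest.\<close>

lemma selfadjoint_rel_bound:
  assumes T: "selfadjoint_rel T" and f: "(f, f') \<in> T"
  shows "\<bar>Im z\<bar> * norm f \<le> norm (f' - z *\<^sub>C f)"
proof -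
  have "cinner f' f = cnj (cinner f' f)"
    using selfadjoint_rel_swap[OF T f f] cinner_commute[of f f'] by simp
  then have "Im (cinner f' f) = 0" by (simp add: complex_eq_iff)
  then have "Im (cinner (f' - z *\<^sub>C f) f) = - (Im z * (norm f)\<^sup>2)"
    by (simp add: cinner_simps cinner_self flip: of_real_power)
  then have "\<bar>Im z\<bar> * (norm f)\<^sup>2 \<le> cmod (cinner (f' - z *\<^sub>C f) f)"
    using abs_Im_le_cmod[of "cinner (f' - z *\<^sub>C f) f"] by (simp add: abs_mult)
  also have "\<dots> \<le> norm (f' - z *\<^sub>C f) * norm f" by (rule cinner_Cauchy_Schwarz)
  finally have "(\<bar>Im z\<bar> * norm f) * norm f \<le> norm (f' - z *\<^sub>C f) * norm f"
    by (simp add: power2_eq_square mult.assoc)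
  then show ?thesis by (cases "f = 0") auto
qed

lemma ran_shiftI: "(f, f') \<in> T \<Longrightarrow> x = f' - z *\<^sub>C f \<Longrightarrow> x \<in> ran_shift T z"
  unfolding ran_shift_def by blast

lemma ran_shift_subspace:
  assumes T: "complex_vs.subspace T"
  shows "complex_vs.subspace (ran_shift T z)"
proof (rule complex_vs.subspaceI)
  show "0 \<in> ran_shift T z"
    using complex_vs.subspace_0[OF T] by (intro ran_shiftI[of 0 0]) (auto simp: zero_prod_def)
next
  fix x y assume "x \<in> ran_shift T z" "y \<in> ran_shift T z"
  then obtain f f' g g' where fg: "(f, f') \<in> T" "(g, g') \<in> T" "x = f' - z *\<^sub>C f" "y = g' - z *\<^sub>C g"
    unfolding ran_shift_def by blast
  from subspace_PairD(1)[OF T fg(1,2)] show "x + y \<in> ran_shift T z"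
    by (rule ran_shiftI) (simp add: fg scaleC_add_right)
next
  fix x c assume "x \<in> ran_shift T z"
  then obtain f f' where f: "(f, f') \<in> T" "x = f' - z *\<^sub>C f"
    unfolding ran_shift_def by blast
  from subspace_PairD(3)[OF T f(1) f(1), of c] show "c *\<^sub>C x \<in> ran_shift T z"
    by (rule ran_shiftI) (simp add: f scaleC_scaleC mult.commute complex_vs.scale_right_diff_distrib)
qed

text \<open>The lower bound makes the range closed: convergence of
  \<open>f' n - z *\<^sub>C f n\<close> forces convergence of \<open>f n\<close>, hence of
  \<open>f' n\<close>. A vector orthogonal to the range is an eigenvector of \<open>T\<close> at
  \<open>cnj z\<close>, and the same bound makes it zero.\<close>

lemma selfadjoint_rel_ran_shift:
  assumes T: "selfadjoint_rel T" and z: "Im z \<noteq> 0"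
  shows "ran_shift T z = UNIV"
proof (rule orthogonal_eq_UNIV)
  note sub = selfadjoint_rel_subspace[OF T]
  show "complex_vs.subspace (ran_shift T z)" by (rule ran_shift_subspace[OF sub])
  show "closed (ran_shift T z)"
  proof (subst closed_sequential_limits, intro allI impI, elim conjE)
    fix Y y assume Y: "\<forall>n. Y n \<in> ran_shift T z" "Y \<longlonglongrightarrow> y"
    then obtain f f' where ff: "\<And>n :: nat. (f n, f' n) \<in> T" "\<And>n. Y n = f' n - z *\<^sub>C f n"
      unfolding ran_shift_def by simp metis
    have bound: "\<bar>Im z\<bar> * norm (f m - f n) \<le> norm (Y m - Y n)" for m n
    proof -
      have "Y m - Y n = (f' m - f' n) - z *\<^sub>C (f m - f n)"
        by (simp add: ff(2) complex_vs.scale_right_diff_distrib)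
      then show ?thesis
        using selfadjoint_rel_bound[OF T subspace_PairD(2)[OF sub ff(1) ff(1)], of z m n] by simp
    qed
    have "Cauchy f"
    proof (rule metric_CauchyI)
      fix e :: real assume "e > 0"
      then have "\<bar>Im z\<bar> * e > 0" using z by simp
      with LIMSEQ_imp_Cauchy[OF Y(2)]
      obtain k where k: "\<And>m n. m \<ge> k \<Longrightarrow> n \<ge> k \<Longrightarrow> dist (Y m) (Y n) < \<bar>Im z\<bar> * e"
        unfolding Cauchy_def by meson
      have "dist (f m) (f n) < e" if "m \<ge> k" "n \<ge> k" for m n
      proof -
        have "\<bar>Im z\<bar> * norm (f m - f n) < \<bar>Im z\<bar> * e"
          using bound[of m n] k[OF that] by (simp add: dist_norm)
        then show ?thesis using z by (simp add: dist_norm)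
      qed
      then show "\<exists>M. \<forall>m\<ge>M. \<forall>n\<ge>M. dist (f m) (f n) < e" by blast
    qed
    then obtain g where g: "f \<longlonglongrightarrow> g" using Cauchy_convergent convergent_def by blast
    have "(\<lambda>n. Y n + z *\<^sub>C f n) \<longlonglongrightarrow> y + z *\<^sub>C g" by (intro tendsto_add tendsto_scaleC Y g)
    then have "f' \<longlonglongrightarrow> y + z *\<^sub>C g" by (simp add: ff(2))
    then have "(\<lambda>n. (f n, f' n)) \<longlonglongrightarrow> (g, y + z *\<^sub>C g)" by (intro tendsto_Pair g)
    then have "(g, y + z *\<^sub>C g) \<in> T"
      using closed_sequentially[OF selfadjoint_rel_closed[OF T] ff(1)] by simp
    then show "y \<in> ran_shift T z" unfolding ran_shift_def by force
  qed
next
  fix x assume x: "\<And>m. m \<in> ran_shift T z \<Longrightarrow> cinner x m = 0"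
  have "cinner (cnj z *\<^sub>C x) v = cinner x v'" if "(v, v') \<in> T" for v v'
    using x[OF ran_shiftI[OF that refl, of z]] by (simp add: cinner_simps)
  then have "(x, cnj z *\<^sub>C x) \<in> T"
    using T unfolding selfadjoint_rel_def by (auto simp: in_rel_adjoint)
  from selfadjoint_rel_bound[OF T this, of "cnj z"] z show "x = 0" by (simp add: mult_le_0_iff)
qed

lemma selfadjoint_rel_resolvent:
  assumes T: "selfadjoint_rel T" and z: "Im z \<noteq> 0"
  shows "z \<in> resolvent_set T"
proof -
  note sub = selfadjoint_rel_subspace[OF T]
  have ex: "\<exists>!u. (u, f + z *\<^sub>C u) \<in> T" for f
  proof (rule ex_ex1I)
    have "f \<in> ran_shift T z" using selfadjoint_rel_ran_shift[OF T z] by simp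
    then obtain u u' where "(u, u') \<in> T" "f = u' - z *\<^sub>C u" unfolding ran_shift_def by blast
    then show "\<exists>u. (u, f + z *\<^sub>C u) \<in> T" by (intro exI[of _ u]) simp
    fix u v assume "(u, f + z *\<^sub>C u) \<in> T" "(v, f + z *\<^sub>C v) \<in> T"
    from selfadjoint_rel_bound[OF T subspace_PairD(2)[OF sub this], of z]
    have "\<bar>Im z\<bar> * norm (u - v) \<le> 0" by (simp add: complex_vs.scale_right_diff_distrib)
    then show "u = v" using z by (simp add: mult_le_0_iff)
  qed
  define S where "S = resolvent_op T z"
  have S: "(S f, f + z *\<^sub>C S f) \<in> T" for f
    unfolding S_def resolvent_op_def by (rule theI') (rule ex)
  have uniq: "S f = u" if "(u, f + z *\<^sub>C u) \<in> T" for f u using ex S that by blast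
  have "bounded_linear S"
  proof (rule bounded_linear_intro)
    show "S (x + y) = S x + S y" for x y
      using subspace_PairD(1)[OF sub S S, of x y]
      by (intro uniq) (simp add: scaleC_add_right algebra_simps)
    show "S (r *\<^sub>R x) = r *\<^sub>R S x" for r x
      using subspace_PairD(3)[OF sub S S, of "complex_of_real r" x]
      by (intro uniq) (simp add: scaleC_add_right scaleC_scaleC scaleR_scaleC mult.commute)
    show "norm (S x) \<le> norm x * (1 / \<bar>Im z\<bar>)" for x
      using selfadjoint_rel_bound[OF T S, of z x] z by (simp add: field_simps)
  qed
  moreover have "S (c *\<^sub>C x) = c *\<^sub>C S x" for c x
    using subspace_PairD(3)[OF sub S S, of c x]
    by (intro uniq) (simp add: scaleC_add_right scaleC_scaleC mult.commute)
  ultimately show ?thesis using ex unfolding resolvent_set_def bounded_op_def S_def by blast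
qed

text \<open>What is used of a generalized resolvent at a single point \<open>z\<close>: \<open>S\<close> and \<open>S'\<close> are its values at
  \<open>z\<close> and \<open>cnj z\<close>.\<close>

definition resolvent_pair ::
  "('a :: complex_hilbert \<times> 'a) set \<Rightarrow> complex \<Rightarrow> ('a \<Rightarrow> 'a) \<Rightarrow> ('a \<Rightarrow> 'a) \<Rightarrow> bool" where
  "resolvent_pair A z S S' \<longleftrightarrow>
     (\<forall>f g. cinner (S f) g = cinner f (S' g)) \<and>
     (\<forall>(h, h')\<in>A. S (h' - z *\<^sub>C h) = h \<and> S' (h' - cnj z *\<^sub>C h) = h)"

lemma resolvent_pair_sym: "resolvent_pair A z S S' \<Longrightarrow> resolvent_pair A (cnj z) S' S"
proof -
  assume R: "resolvent_pair A z S S'"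
  have "cinner (S' f) g = cinner f (S g)" for f g
  proof -
    have "cinner (S' f) g = cnj (cinner g (S' f))" by (rule cinner_commute)
    also have "cinner g (S' f) = cinner (S g) f" using R by (simp add: resolvent_pair_def)
    also have "cnj (cinner (S g) f) = cinner f (S g)" by (rule cinner_commute[symmetric])
    finally show ?thesis .
  qed
  then show ?thesis using R by (auto simp: resolvent_pair_def)
qed

lemma resolvent_pair_swap: "resolvent_pair A z S S' \<Longrightarrow> cinner (S f) g = cinner f (S' g)"
  unfolding resolvent_pair_def by blast

lemma resolvent_pair_inverse:
  "resolvent_pair A z S S' \<Longrightarrow> (h, h') \<in> A \<Longrightarrow> S (h' - z *\<^sub>C h) = h"
  unfolding resolvent_pair_def by blast

text \<open>By duality: \<open>S'\<close> is a left inverse of \<open>A\<close> shifted by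
  \<open>cnj z\<close>, so its adjoint \<open>S\<close> is a right inverse of the adjoint relation
  shifted by \<open>z\<close>. In particular \<open>S\<close> maps into the domain of the
  adjoint.\<close>

lemma resolvent_pair_adjoint:
  assumes "resolvent_pair A z S S'"
  shows "(S f, f + z *\<^sub>C S f) \<in> rel_adjoint A"
proof -
  have "cinner (f + z *\<^sub>C S f) h = cinner (S f) h'" if h: "(h, h') \<in> A" for h h'
  proof -
    have "cinner f h = cinner (S f) (h' - cnj z *\<^sub>C h)"
      using resolvent_pair_inverse[OF resolvent_pair_sym[OF assms] h]
      by (simp add: resolvent_pair_swap[OF assms])
    then show ?thesis by (simp add: cinner_simps)
  qed
  then show ?thesis by (simp add: in_rel_adjoint)
qed

lemma resolvent_op_in: "z \<in> resolvent_set T \<Longrightarrow> (resolvent_op T z f, f + z *\<^sub>C resolvent_op T z f) \<in> T"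
  unfolding resolvent_op_def resolvent_set_def by (rule theI') blast

lemma resolvent_op_unique: "z \<in> resolvent_set T \<Longrightarrow> (u, f + z *\<^sub>C u) \<in> T \<Longrightarrow> resolvent_op T z f = u"
  using resolvent_op_in unfolding resolvent_set_def by blast

lemma resolvent_set_cnj:
  assumes "selfadjoint_rel T" "z \<in> resolvent_set T"
  shows "cnj z \<in> resolvent_set T"
proof (cases "Im z = 0")
  case True
  then have "cnj z = z" by (simp add: complex_eq_iff)
  then show ?thesis using assms by simp
qed (use selfadjoint_rel_resolvent[OF assms(1)] in simp)

lemma selfadjoint_resolvent_swap:
  assumes T: "selfadjoint_rel T" and z: "z \<in> resolvent_set T"
  shows "cinner (resolvent_op T z f) g = cinner f (resolvent_op T (cnj z) g)"
  using selfadjoint_rel_swap[OF T resolvent_op_in[OF z, of f]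
      resolvent_op_in[OF resolvent_set_cnj[OF T z], of g]]
  by (simp add: cinner_simps)

lemma selfadjoint_resolvent_pair:
  assumes T: "selfadjoint_rel T" and z: "z \<in> resolvent_set T" and "A \<subseteq> T"
  shows "resolvent_pair A z (resolvent_op T z) (resolvent_op T (cnj z))"
  unfolding resolvent_pair_def
  using selfadjoint_resolvent_swap[OF T z] resolvent_op_unique[OF z] assms(3)
    resolvent_op_unique[OF resolvent_set_cnj[OF T z]] by auto

lemma hilbert_adjoint_cinner:
  assumes V: "bounded_op V"
  shows "cinner (hilbert_adjoint V u) h = cinner u (V h)"
proof -
  have lin: "bounded_linear V" "\<And>c x. V (c *\<^sub>C x) = c *\<^sub>C V x"
    using V unfolding bounded_op_def by auto
  obtain K where K: "\<And>x. norm (V x) \<le> norm x * K"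
    using bounded_linear.bounded[OF lin(1)] by blast
  obtain w where w: "\<And>x. x \<in> UNIV \<Longrightarrow> cinner u (V x) = cinner w x"
  proof (rule Riesz[of UNIV "\<lambda>x. cinner u (V x)" "norm u * K"])
    fix x
    have "cmod (cinner u (V x)) \<le> norm u * norm (V x)" by (rule cinner_Cauchy_Schwarz)
    also have "\<dots> \<le> norm u * (norm x * K)" by (intro mult_left_mono K) simp
    finally show "cmod (cinner u (V x)) \<le> norm u * K * norm x" by (simp add: algebra_simps)
  qed (auto simp: lin linear_add[OF bounded_linear.linear[OF lin(1)]] cinner_simps)
  have "\<forall>h. cinner (hilbert_adjoint V u) h = cinner u (V h)"
    unfolding hilbert_adjoint_def
    by (rule theI[of _ w]) (use w in \<open>auto intro: cinner_ext\<close>)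
  then show ?thesis by blast
qed

text \<open>At real points both properties are obtained as limits along nonreal points.\<close>

lemma generalized_resolvent_pair:
  assumes R: "generalized_resolvent A V At D R" and z: "z \<in> D"
  shows "resolvent_pair A z (R z) (R (cnj z))"
proof -
  have V: "bounded_op V" and iso: "\<And>x y. cinner (V x) (V y) = cinner x y"
    and At: "selfadjoint_rel At" and ext: "\<And>f f'. (f, f') \<in> A \<Longrightarrow> (V f, V f') \<in> At"
    and D: "open D" "cnj ` D = D" "- \<real> \<subseteq> D"
    and hol: "\<And>f g. (\<lambda>z. cinner (R z f) g) holomorphic_on D"
    and eq: "\<And>z f. z \<in> D \<inter> resolvent_set At \<Longrightarrow> R z f = hilbert_adjoint V (resolvent_op At z (V f))"
    and bdd: "\<And>z. z \<in> D \<Longrightarrow> bounded_op (R z)"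
    using R unfolding generalized_resolvent_def by auto
  have V_lin: "V (x - y) = V x - V y" "V (c *\<^sub>C x) = c *\<^sub>C V x" for x y c
    using V unfolding bounded_op_def by (auto simp: linear_diff[OF bounded_linear.linear])
  have R_lin: "R z (x - y) = R z x - R z y" "R z (c *\<^sub>C x) = c *\<^sub>C R z x" if "z \<in> D" for x y c z
    using bdd[OF that] unfolding bounded_op_def by (auto simp: linear_diff[OF bounded_linear.linear])
  have nonreal: "w \<in> D \<inter> resolvent_set At" if "Im w \<noteq> 0" for w
    using that D(3) selfadjoint_rel_resolvent[OF At] by (auto simp: complex_is_Real_iff)
  have swap: "cinner (R w f) g = cinner f (R (cnj w) g)" if w: "Im w \<noteq> 0" for w f g
  proof -
    have "cinner (R w f) g = cinner (resolvent_op At w (V f)) (V g)"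
      using nonreal[OF w] by (simp add: eq hilbert_adjoint_cinner[OF V])
    also have "\<dots> = cinner (V f) (resolvent_op At (cnj w) (V g))"
      using nonreal[OF w] selfadjoint_resolvent_swap[OF At] by blast
    also have "\<dots> = cinner f (R (cnj w) g)"
      using nonreal[of "cnj w"] w hilbert_adjoint_cinner[OF V]
      by (subst (1 2) cinner_commute) (simp add: eq)
    finally show ?thesis .
  qed
  have inv: "cinner (R w (h' - w *\<^sub>C h)) g = cinner h g" if w: "Im w \<noteq> 0" and h: "(h, h') \<in> A" for w h h' g
  proof -
    have "resolvent_op At w (V (h' - w *\<^sub>C h)) = V h"
      using nonreal[OF w] ext[OF h] by (intro resolvent_op_unique) (auto simp: V_lin)
    then show ?thesis using nonreal[OF w] by (simp add: eq hilbert_adjoint_cinner[OF V] iso)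
  qed
  have zD': "cnj z \<in> D" using z D(2) by blast
  \<comment> \<open>Vertical approach: for real \<open>z\<close> all \<open>s n\<close> are nonreal,
    where \<open>R\<close> is the compressed resolvent of \<open>At\<close>. Weak continuity of
    \<open>R\<close> suffices, as every claim is tested with inner products.\<close>
  define s where "s n = z + \<i> * complex_of_real (inverse (real (Suc n)))" for n
  have s_lim: "s \<longlonglongrightarrow> z"
  proof -
    have "s \<longlonglongrightarrow> z + \<i> * complex_of_real 0"
      unfolding s_def by (intro tendsto_intros LIMSEQ_inverse_real_of_nat)
    then show ?thesis by simp
  qed
  have cont: "(\<lambda>n. cinner (R (t n) f) g) \<longlonglongrightarrow> cinner (R w f) g" if "t \<longlonglongrightarrow> w" "w \<in> D" for t w f g
  proof (rule isCont_tendsto_compose[OF _ that(1)])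
    show "isCont (\<lambda>z. cinner (R z f) g) w"
      using holomorphic_on_imp_continuous_on[OF hol] D(1) that(2) continuous_on_eq_continuous_at by blast
  qed
  have swap': "cinner (R z f) g = cinner f (R (cnj z) g)" for f g
  proof (cases "Im z = 0")
    case True
    then have Ims: "Im (s n) \<noteq> 0" for n by (simp add: s_def)
    have "(\<lambda>n. cnj (cinner (R (cnj (s n)) g) f)) \<longlonglongrightarrow> cnj (cinner (R (cnj z) g) f)"
      by (intro tendsto_cnj cont s_lim zD')
    then have "(\<lambda>n. cinner (R (s n) f) g) \<longlonglongrightarrow> cinner f (R (cnj z) g)"
      by (simp add: swap[OF Ims] flip: cinner_commute)
    with cont[OF s_lim z] show ?thesis using LIMSEQ_unique by blast
  qed (rule swap)
  have inv': "R w (h' - w *\<^sub>C h) = h" if w: "w = z \<or> w = cnj z" and h: "(h, h') \<in> A" for w h h'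
  proof (rule cinner_ext)
    fix g
    have wD: "w \<in> D" using w z zD' by blast
    show "cinner (R w (h' - w *\<^sub>C h)) g = cinner h g"
    proof (cases "Im w = 0")
      case True
      then have wz: "w = z" using w by (auto simp: complex_eq_iff)
      have Ims: "Im (s n) \<noteq> 0" for n using True wz by (simp add: s_def)
      have sD: "s n \<in> D" for n using nonreal[OF Ims] by blast
      have "(\<lambda>n. cinner (R (s n) h') g - s n * cinner (R (s n) h) g) \<longlonglongrightarrow>
          cinner (R z h') g - z * cinner (R z h) g"
        by (intro tendsto_intros cont s_lim z)
      moreover have "cinner (R (s n) h') g - s n * cinner (R (s n) h) g = cinner h g" for n
        using inv[OF Ims h, of n g] sD by (simp add: R_lin cinner_simps)
      ultimately have "cinner (R z h') g - z * cinner (R z h) g = cinner h g"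
        by (simp add: LIMSEQ_const_iff)
      then show ?thesis using z by (simp add: wz R_lin cinner_simps)
    qed (use inv h in blast)
  qed
  show ?thesis unfolding resolvent_pair_def using swap' inv' by blast
qed

section \<open>The rigging\<close>

lemma ortho_proj:
  fixes S :: "'a :: complex_hilbert set"
  assumes S: "complex_vs.subspace S" "closed S"
  shows "ortho_proj S x \<in> S" and "s \<in> S \<Longrightarrow> cinner (x - ortho_proj S x) s = 0"
    and "y \<in> S \<Longrightarrow> (\<And>s. s \<in> S \<Longrightarrow> cinner (x - y) s = 0) \<Longrightarrow> ortho_proj S x = y"
proof -
  let ?P = "\<lambda>y. y \<in> S \<and> (\<forall>s\<in>S. cinner (x - y) s = 0)"
  have uniq: "y = y'" if "?P y" "?P y'" for y y'
  proof -
    have "y - y' \<in> S" using that complex_vs.subspace_diff[OF S(1)] by blast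
    then have "cinner (x - y') (y - y') = 0" "cinner (x - y) (y - y') = 0" using that by blast+
    then have "cinner (y - y') (y - y') = 0" by (simp add: cinner_diff_left)
    then show ?thesis by simp
  qed
  obtain y0 where y0: "?P y0"
  proof (rule projection_exists[OF S, of x])
    fix u assume "u \<in> S" "\<And>m. m \<in> S \<Longrightarrow> cinner (x - u) m = 0"
    then show thesis by (intro that conjI ballI)
  qed
  have "\<exists>!y. ?P y" by (rule ex1I[of ?P, OF y0]) (rule uniq[OF _ y0])
  then have P: "?P (ortho_proj S x)" unfolding ortho_proj_def by (rule theI')
  then show "ortho_proj S x \<in> S" "s \<in> S \<Longrightarrow> cinner (x - ortho_proj S x) s = 0" by auto
  show "ortho_proj S x = y" if "y \<in> S" "\<And>s. s \<in> S \<Longrightarrow> cinner (x - y) s = 0"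
    using uniq[OF P] that by blast
qed

lemma norm_ortho_proj_le:
  fixes S :: "'a :: complex_hilbert set"
  assumes S: "complex_vs.subspace S" "closed S"
  shows "norm (ortho_proj S x) \<le> norm x"
proof -
  let ?y = "ortho_proj S x"
  have "(norm (x - ?y + ?y))\<^sup>2 = (norm (x - ?y))\<^sup>2 + (norm ?y)\<^sup>2"
    unfolding norm_add_sq using ortho_proj(2)[OF S ortho_proj(1)[OF S]] by simp
  then have "(norm ?y)\<^sup>2 \<le> (norm x)\<^sup>2" by simp
  then show ?thesis by (rule power2_le_imp_le) simp
qed

lemma subspace_Domain: "complex_vs.subspace T \<Longrightarrow> complex_vs.subspace (Domain T)"
proof (rule complex_vs.subspaceI)
  assume T: "complex_vs.subspace T"
  show "0 \<in> Domain T" using complex_vs.subspace_0[OF T] by (auto simp: zero_prod_def)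
  show "x + y \<in> Domain T" if "x \<in> Domain T" "y \<in> Domain T" for x y
    using subspace_PairD(1)[OF T] that by blast
  show "c *\<^sub>C x \<in> Domain T" if "x \<in> Domain T" for x c
    using subspace_PairD(3)[OF T] that by blast
qed

lemma mul_part_orthogonal: "(u, f) \<in> rel_adjoint A \<Longrightarrow> g \<in> mul_part A \<Longrightarrow> cinner u g = 0"
  using rel_adjointD[of u f A 0 g] by (simp add: mul_part_def)

text \<open>The value must not depend on the decomposition. Two choices of \<open>h0\<close> differ
  by a vector both in the domain of the adjoint and in \<open>mul_part A\<close>; these are
  orthogonal, so it is zero. Two choices of \<open>h0'\<close> then differ by a vector orthogonal to
  the domain of \<open>A\<close>, which the projection does not see.\<close>

lemma plus_norm_eq:
  assumes A: "complex_vs.subspace A"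
    and h: "(h0, h0') \<in> rel_adjoint A" "h1 \<in> mul_part A"
  shows "plus_norm A (h0 + h1) =
    sqrt ((norm h0)\<^sup>2 + (norm (ortho_proj (closure (Domain A)) h0'))\<^sup>2 + (norm h1)\<^sup>2)"
proof -
  let ?S = "closure (Domain A)"
  have S: "complex_vs.subspace ?S" "closed ?S"
    using closure_csubspace[OF subspace_Domain[OF A]] by auto
  have *: "k0 = h0 \<and> k1 = h1 \<and> ortho_proj ?S k0' = ortho_proj ?S h0'"
    if k: "(k0, k0') \<in> rel_adjoint A" "k1 \<in> mul_part A" and eq: "h0 + h1 = k0 + k1" for k0 k0' k1
  proof -
    have d: "(k0 - h0, k0' - h0') \<in> rel_adjoint A" by (rule rel_adjoint_diff[OF k(1) h(1)])
    have "k0 - h0 = h1 - k1" using eq by (simp add: algebra_simps)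
    moreover have "h1 - k1 \<in> mul_part A"
      using subspace_PairD(2)[OF A, of 0 h1 0 k1] h(2) k(2) by (simp add: mul_part_def)
    ultimately have "cinner (k0 - h0) (k0 - h0) = 0" using mul_part_orthogonal[OF d] by simp
    then have k0: "k0 = h0" by simp
    have "cinner (k0' - h0') s = 0" if "s \<in> Domain A" for s
      using d that by (auto simp: k0 in_rel_adjoint)
    then have orth: "cinner (k0' - h0') s = 0" if "s \<in> ?S" for s using orthogonal_closure that by blast
    have "ortho_proj ?S k0' = ortho_proj ?S h0'"
    proof (rule ortho_proj(3)[OF S])
      show "ortho_proj ?S h0' \<in> ?S" by (rule ortho_proj(1)[OF S])
      show "cinner (k0' - ortho_proj ?S h0') s = 0" if "s \<in> ?S" for s
        using orth[OF that] ortho_proj(2)[OF S that, of h0'] by (simp add: cinner_simps)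
    qed
    then show ?thesis using k0 eq by simp
  qed
  show ?thesis unfolding plus_norm_def
  proof (rule the_equality)
    show "\<exists>k0 k0' k1. (k0, k0') \<in> rel_adjoint A \<and> k1 \<in> mul_part A \<and> h0 + h1 = k0 + k1 \<and>
      sqrt ((norm h0)\<^sup>2 + (norm (ortho_proj ?S h0'))\<^sup>2 + (norm h1)\<^sup>2) =
      sqrt ((norm k0)\<^sup>2 + (norm (ortho_proj ?S k0'))\<^sup>2 + (norm k1)\<^sup>2)"
      using h by blast
  qed (use * in fastforce)
qed

lemma adj_H_plus_eqI:
  assumes "\<And>g. cinner u g = \<phi> (T g)"
  shows "adj_H_plus T \<phi> = u"
  unfolding adj_H_plus_def by (rule the_equality) (use assms in \<open>auto intro: cinner_ext\<close>)

lemma emb_add: "emb A (x + y) h = emb A x h + emb A y h"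
  and emb_diff: "emb A (x - y) h = emb A x h - emb A y h"
  and emb_scale: "emb A (c *\<^sub>C x) h = c * emb A x h"
  and emb_minus: "emb A (- x) h = - emb A x h"
  and emb_zero: "emb A 0 h = 0"
  by (simp_all add: emb_def cinner_simps)

lemmas emb_simps = emb_add emb_diff emb_scale emb_minus emb_zero

locale closed_symmetric =
  fixes A :: "('h :: complex_hilbert \<times> 'h) set"
  assumes closed_A: "closed A" and symmetric_A: "symmetric_rel A"
begin

lemma subspace_A: "complex_vs.subspace A"
  using symmetric_A by (simp add: symmetric_rel_def linear_relation_iff_subspace)

lemma A_sub_adjoint: "A \<subseteq> rel_adjoint A"
  using symmetric_A by (simp add: symmetric_rel_def)

lemma adjoint_adjoint_A: "rel_adjoint (rel_adjoint A) = A"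
  by (rule rel_adjoint_adjoint[OF closed_A subspace_A])

lemma dom_adjoint_plus: "(h, h') \<in> rel_adjoint A \<Longrightarrow> h \<in> plus_space A"
  unfolding plus_space_def mul_part_def using complex_vs.subspace_0[OF subspace_A]
  by (intro CollectI exI[of _ h] exI[of _ 0]) (auto simp: zero_prod_def)

lemma emb_dom_adjoint: "(h, h') \<in> rel_adjoint A \<Longrightarrow> emb A f h = cinner f h"
  by (simp add: emb_def dom_adjoint_plus)

lemma emb_dom: "(h, h') \<in> A \<Longrightarrow> emb A f h = cinner f h"
  using A_sub_adjoint emb_dom_adjoint by blast

lemma subspace_mul_part: "complex_vs.subspace (mul_part A)"
proof (rule complex_vs.subspaceI)
  show "0 \<in> mul_part A"
    using complex_vs.subspace_0[OF subspace_A] by (simp add: mul_part_def zero_prod_def)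
  show "x + y \<in> mul_part A" if "x \<in> mul_part A" "y \<in> mul_part A" for x y
    using subspace_PairD(1)[OF subspace_A, of 0 x 0 y] that by (simp add: mul_part_def)
  show "c *\<^sub>C x \<in> mul_part A" if "x \<in> mul_part A" for x c
    using subspace_PairD(3)[OF subspace_A, of 0 x 0 x c] that by (simp add: mul_part_def)
qed

lemma subspace_plus: "complex_vs.subspace (plus_space A)"
proof -
  have "plus_space A = {x + y |x y. x \<in> Domain (rel_adjoint A) \<and> y \<in> mul_part A}"
    by (simp add: plus_space_def)
  then show ?thesis
    using complex_vs.subspace_sums[OF subspace_Domain[OF subspace_rel_adjoint] subspace_mul_part] by simp
qed

text \<open>The summand from \<open>mul_part A\<close> is taken to be zero, and the projection
  contracts. Hence functionals bounded on the positive space are bounded in the graph norm of the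
  adjoint.\<close>

lemma plus_norm_le:
  assumes "(h, h') \<in> rel_adjoint A"
  shows "plus_norm A h \<le> norm (h, h')"
proof -
  have 0: "0 \<in> mul_part A" by (rule complex_vs.subspace_0[OF subspace_mul_part])
  have "norm (ortho_proj (closure (Domain A)) h') \<le> norm h'"
    by (intro norm_ortho_proj_le closure_csubspace subspace_Domain subspace_A closed_closure)
  then show ?thesis
    using plus_norm_eq[OF subspace_A assms 0] by (simp add: norm_prod_def)
qed

lemma norm_le_plus_norm:
  assumes "h \<in> plus_space A"
  shows "norm h \<le> plus_norm A h"
proof -
  obtain h0 h0' h1 where h: "h = h0 + h1" "(h0, h0') \<in> rel_adjoint A" "h1 \<in> mul_part A"
    using assms unfolding plus_space_def by blast
  have "(norm h)\<^sup>2 = (norm h0)\<^sup>2 + (norm h1)\<^sup>2"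
    unfolding h(1) norm_add_sq using mul_part_orthogonal[OF h(2,3)] by simp
  then show ?thesis unfolding h(1) plus_norm_eq[OF subspace_A h(2,3)]
    by (intro real_le_rsqrt) (simp add: h(1))
qed

section \<open>Functionals on the positive space\<close>

lemma minus_spaceI:
  assumes "\<And>x y. x \<in> plus_space A \<Longrightarrow> y \<in> plus_space A \<Longrightarrow> \<phi> (x + y) = \<phi> x + \<phi> y"
    and "\<And>c x. x \<in> plus_space A \<Longrightarrow> \<phi> (c *\<^sub>C x) = cnj c * \<phi> x"
    and "\<And>x. x \<in> plus_space A \<Longrightarrow> cmod (\<phi> x) \<le> C * plus_norm A x"
    and "\<And>x. x \<notin> plus_space A \<Longrightarrow> \<phi> x = 0"
  shows "\<phi> \<in> minus_space A"
  unfolding minus_space_def using assms by blast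

lemma minus_spaceD:
  assumes "\<phi> \<in> minus_space A"
  shows "x \<in> plus_space A \<Longrightarrow> y \<in> plus_space A \<Longrightarrow> \<phi> (x + y) = \<phi> x + \<phi> y"
    and "x \<in> plus_space A \<Longrightarrow> \<phi> (c *\<^sub>C x) = cnj c * \<phi> x"
    and "x \<notin> plus_space A \<Longrightarrow> \<phi> x = 0"
  using assms unfolding minus_space_def by auto

lemma minus_space_bounded:
  assumes "\<phi> \<in> minus_space A"
  obtains C where "\<And>x. x \<in> plus_space A \<Longrightarrow> cmod (\<phi> x) \<le> C * plus_norm A x"
  using assms unfolding minus_space_def by blast

lemma minus_space_addI:
  assumes a: "\<phi> \<in> minus_space A" and b: "\<psi> \<in> minus_space A"
  shows "(\<lambda>h. \<phi> h + \<psi> h) \<in> minus_space A"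
proof -
  obtain C where C: "\<And>x. x \<in> plus_space A \<Longrightarrow> cmod (\<phi> x) \<le> C * plus_norm A x"
    using minus_space_bounded[OF a] by blast
  obtain C' where C': "\<And>x. x \<in> plus_space A \<Longrightarrow> cmod (\<psi> x) \<le> C' * plus_norm A x"
    using minus_space_bounded[OF b] by blast
  have "cmod (\<phi> x + \<psi> x) \<le> (C + C') * plus_norm A x" if "x \<in> plus_space A" for x
    using norm_triangle_ineq[of "\<phi> x" "\<psi> x"] C[OF that] C'[OF that] by (simp add: distrib_right)
  then show ?thesis
    by (rule minus_spaceI[rotated 2])
      (simp_all add: minus_spaceD[OF a] minus_spaceD[OF b] distrib_left)
qed

lemma minus_space_scaleI:
  assumes a: "\<phi> \<in> minus_space A"
  shows "(\<lambda>h. c * \<phi> h) \<in> minus_space A"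
proof -
  obtain C where C: "\<And>x. x \<in> plus_space A \<Longrightarrow> cmod (\<phi> x) \<le> C * plus_norm A x"
    using minus_space_bounded[OF a] by blast
  have "cmod (c * \<phi> x) \<le> (cmod c * C) * plus_norm A x" if "x \<in> plus_space A" for x
    using mult_left_mono[OF C[OF that], of "cmod c"] by (simp add: norm_mult mult.assoc)
  then show ?thesis
    by (rule minus_spaceI[rotated 2]) (simp_all add: minus_spaceD[OF a] distrib_left)
qed

lemma emb_minus_space: "emb A f \<in> minus_space A"
proof -
  note P = subspace_plus
  have "cmod (emb A f x) \<le> norm f * plus_norm A x" if "x \<in> plus_space A" for x
  proof -
    have "cmod (emb A f x) \<le> norm f * norm x"
      using that cinner_Cauchy_Schwarz by (simp add: emb_def)
    also have "\<dots> \<le> norm f * plus_norm A x" by (intro mult_left_mono norm_le_plus_norm that) simp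
    finally show ?thesis .
  qed
  then show ?thesis
    by (rule minus_spaceI[rotated 2])
      (simp_all add: emb_def cinner_simps complex_vs.subspace_add[OF P] complex_vs.subspace_scale[OF P])
qed

lemma minus_space_diffI:
  assumes "\<phi> \<in> minus_space A" "\<psi> \<in> minus_space A"
  shows "(\<lambda>h. \<phi> h - \<psi> h) \<in> minus_space A"
  using minus_space_addI[OF assms(1) minus_space_scaleI[OF assms(2), of "-1"]] by simp

text \<open>Formally \<open>\<phi>\<close> is \<open>a\<close> plus the extension of
  \<open>A\<close> applied to \<open>b\<close>: the pair of \<open>b\<close> and
  \<open>\<phi>\<close> minus \<open>a\<close> satisfies the pairing condition of
  \<open>ext_rel A (rel_adjoint A)\<close>. The pair \<open>(a, b)\<close> is in general not unique.
  Only arguments in the domain of the adjoint are tested, where all the resolvents take their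
  values.\<close>

definition represents :: "('h \<Rightarrow> complex) \<Rightarrow> 'h \<Rightarrow> 'h \<Rightarrow> bool" where
  "represents \<phi> a b \<longleftrightarrow> (\<forall>h h'. (h, h') \<in> rel_adjoint A \<longrightarrow> \<phi> h = cinner a h + cinner b h')"

lemma representsD: "represents \<phi> a b \<Longrightarrow> (h, h') \<in> rel_adjoint A \<Longrightarrow> \<phi> h = cinner a h + cinner b h'"
  unfolding represents_def by blast

text \<open>Hence every functional is an element of the middle space plus one in the range of the
  extended relation.\<close>

lemma minus_space_represents:
  assumes \<phi>: "\<phi> \<in> minus_space A"
  obtains a b where "represents \<phi> a b"
proof -
  obtain C where C: "\<And>x. x \<in> plus_space A \<Longrightarrow> cmod (\<phi> x) \<le> C * plus_norm A x"
    using minus_space_bounded[OF \<phi>] by blast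
  \<comment> \<open>Composed with \<open>fst\<close>, the functional is bounded on the graph of the
    adjoint, a closed subspace of the product. The absolute value of \<open>C\<close> is taken
    because \<open>C\<close> may be negative.\<close>
  show thesis
  proof (rule Riesz[OF subspace_rel_adjoint closed_rel_adjoint, where F = "\<lambda>x. \<phi> (fst x)" and C = "\<bar>C\<bar>"])
    fix x y :: "'h \<times> 'h" and c assume x: "x \<in> rel_adjoint A"
    then have xp: "fst x \<in> plus_space A" using dom_adjoint_plus by (cases x) simp
    show "\<phi> (fst (c *\<^sub>C x)) = cnj c * \<phi> (fst x)"
      using \<phi> xp unfolding minus_space_def by (simp add: scaleC_prod_def)
    have "cmod (\<phi> (fst x)) \<le> C * plus_norm A (fst x)" by (rule C[OF xp])
    also have "\<dots> \<le> \<bar>C\<bar> * plus_norm A (fst x)"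
      using order_trans[OF norm_ge_zero norm_le_plus_norm[OF xp]] by (intro mult_right_mono) auto
    also have "\<dots> \<le> \<bar>C\<bar> * norm x"
      using plus_norm_le[of "fst x" "snd x"] x by (intro mult_left_mono) auto
    finally show "cmod (\<phi> (fst x)) \<le> \<bar>C\<bar> * norm x" .
    assume "y \<in> rel_adjoint A"
    then have "fst y \<in> plus_space A" using dom_adjoint_plus by (cases y) simp
    then show "\<phi> (fst (x + y)) = \<phi> (fst x) + \<phi> (fst y)"
      using \<phi> xp unfolding minus_space_def by simp
  next
    fix a assume "\<And>x. x \<in> rel_adjoint A \<Longrightarrow> \<phi> (fst x) = cinner a x"
    then have "represents \<phi> (fst a) (snd a)"
      unfolding represents_def by (auto simp: cinner_prod_def)
    then show thesis by (rule that)
  qed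
qed

section \<open>Extended relations and extended resolvents\<close>

lemma in_ext_rel: "(f, \<phi>) \<in> ext_rel A B \<longleftrightarrow> \<phi> \<in> minus_space A \<and> (\<forall>h h'. (h, h') \<in> B \<longrightarrow> \<phi> h = cinner f h')"
  unfolding ext_rel_def by auto

lemma ext_rel_add: "(f, \<phi>) \<in> ext_rel A B \<Longrightarrow> (g, \<psi>) \<in> ext_rel A B \<Longrightarrow> (f + g, \<lambda>h. \<phi> h + \<psi> h) \<in> ext_rel A B"
  by (auto simp: in_ext_rel minus_space_addI cinner_simps)

lemma ext_rel_scale: "(f, \<phi>) \<in> ext_rel A B \<Longrightarrow> (c *\<^sub>C f, \<lambda>h. c * \<phi> h) \<in> ext_rel A B"
  by (auto simp: in_ext_rel minus_space_scaleI cinner_simps)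

lemma ext_rel_emb_iff: "(f, emb A f') \<in> ext_rel A A \<longleftrightarrow> (f, f') \<in> rel_adjoint A"
  by (auto simp: in_ext_rel in_rel_adjoint[of f f'] emb_minus_space emb_dom)

text \<open>The graph element of the adjoint over \<open>S' g\<close> has second component
  \<open>g + cnj z *\<^sub>C S' g\<close>, so \<open>\<phi> (S' g)\<close> is explicit in
  \<open>a\<close> and \<open>b\<close>; moving \<open>S'\<close> to the other side gives the
  formula. The summand \<open>b\<close> depends neither on \<open>S\<close> nor on \<open>z\<close>,
  and the other summand lies in the domain of the adjoint.\<close>

lemma adj_H_plus_represents:
  assumes S: "resolvent_pair A z S S'" and r: "represents \<phi> a b"
  shows "adj_H_plus S' \<phi> = S (a + z *\<^sub>C b) + b"
  by (rule adj_H_plus_eqI)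
    (use representsD[OF r resolvent_pair_adjoint[OF resolvent_pair_sym[OF S]]] in
      \<open>simp add: cinner_simps resolvent_pair_swap[OF S]\<close>)

lemma adj_H_plus_apply:
  assumes S: "resolvent_pair A z S S'" and \<phi>: "\<phi> \<in> minus_space A"
  shows "cinner (adj_H_plus S' \<phi>) g = \<phi> (S' g)"
proof -
  obtain a b where r: "represents \<phi> a b" using minus_space_represents[OF \<phi>] .
  show ?thesis
    using representsD[OF r resolvent_pair_adjoint[OF resolvent_pair_sym[OF S], of g]]
    by (simp add: adj_H_plus_represents[OF S r] cinner_simps resolvent_pair_swap[OF S])
qed

text \<open>\<open>S'\<close> recovers \<open>h\<close> from \<open>h' - cnj z *\<^sub>C h\<close>,
  so \<open>\<phi> h\<close> is an inner product with \<open>adj_H_plus S' \<phi>\<close>. This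
  covers generalized resolvents as well as that of \<open>A0\<close>.\<close>

lemma adj_H_plus_ext_rel:
  assumes S: "resolvent_pair A z S S'" and \<phi>: "\<phi> \<in> minus_space A"
  shows "(adj_H_plus S' \<phi>, \<lambda>h. \<phi> h + emb A (z *\<^sub>C adj_H_plus S' \<phi>) h) \<in> ext_rel A A"
proof -
  have "\<phi> h + z * cinner (adj_H_plus S' \<phi>) h = cinner (adj_H_plus S' \<phi>) h'" if h: "(h, h') \<in> A" for h h'
  proof -
    have "\<phi> h = cinner (adj_H_plus S' \<phi>) (h' - cnj z *\<^sub>C h)"
      unfolding adj_H_plus_apply[OF S \<phi>] resolvent_pair_inverse[OF resolvent_pair_sym[OF S] h] ..
    then show ?thesis by (simp add: cinner_simps)
  qed
  then show ?thesis
    by (auto simp: in_ext_rel minus_space_addI emb_minus_space \<phi> cinner_simps emb_dom)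
qed

lemma adj_H_plus_add:
  assumes S: "resolvent_pair A z S S'" and \<phi>: "\<phi> \<in> minus_space A" and \<psi>: "\<psi> \<in> minus_space A"
  shows "adj_H_plus S' (\<lambda>h. \<phi> h + \<psi> h) = adj_H_plus S' \<phi> + adj_H_plus S' \<psi>"
  by (rule adj_H_plus_eqI) (simp add: cinner_simps adj_H_plus_apply[OF S] \<phi> \<psi>)

lemma adj_H_plus_scale:
  assumes S: "resolvent_pair A z S S'" and \<phi>: "\<phi> \<in> minus_space A"
  shows "adj_H_plus S' (\<lambda>h. c * \<phi> h) = c *\<^sub>C adj_H_plus S' \<phi>"
  by (rule adj_H_plus_eqI) (simp add: cinner_simps adj_H_plus_apply[OF S] \<phi>)

end

section \<open>Coordinate vectors and matrices\<close>

lemma cprod_sum: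
  fixes v w :: "complex vec"
  assumes "w \<in> carrier_vec n"
  shows "v \<bullet>c w = (\<Sum>j<n. v $ j * cnj (w $ j))"
  using assms by (simp add: scalar_prod_def conjugate_complex_def atLeast0LessThan)

lemma cprod_commute:
  fixes v w :: "complex vec"
  assumes "v \<in> carrier_vec n" "w \<in> carrier_vec n"
  shows "v \<bullet>c w = cnj (w \<bullet>c v)"
  by (simp add: cprod_sum[OF assms(1)] cprod_sum[OF assms(2)] mult.commute)

lemma cprod_add_left:
  fixes v w x :: "complex vec"
  assumes "v \<in> carrier_vec n" "w \<in> carrier_vec n" "x \<in> carrier_vec n"
  shows "(v + w) \<bullet>c x = v \<bullet>c x + w \<bullet>c x"
  using assms by (simp add: cprod_sum[OF assms(3)] distrib_right sum.distrib)

lemma cprod_scale_left: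
  fixes v x :: "complex vec"
  assumes "v \<in> carrier_vec n" "x \<in> carrier_vec n"
  shows "(c \<cdot>\<^sub>v v) \<bullet>c x = c * (v \<bullet>c x)"
  using assms by (simp add: cprod_sum[OF assms(2)] sum_distrib_left mult.assoc)

lemma cprod_add_right:
  fixes v w x :: "complex vec"
  assumes "v \<in> carrier_vec n" "w \<in> carrier_vec n" "x \<in> carrier_vec n"
  shows "x \<bullet>c (v + w) = x \<bullet>c v + x \<bullet>c w"
  using assms by (simp add: cprod_sum[of _ n] distrib_left sum.distrib)

lemma cprod_scale_right:
  fixes v x :: "complex vec"
  assumes "v \<in> carrier_vec n" "x \<in> carrier_vec n"
  shows "x \<bullet>c (c \<cdot>\<^sub>v v) = cnj c * (x \<bullet>c v)"
  using assms by (simp add: cprod_sum[of _ n] sum_distrib_left mult.left_commute)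

lemma cprod_unit_right:
  fixes v :: "complex vec"
  assumes "v \<in> carrier_vec n" "i < n"
  shows "v \<bullet>c unit_vec n i = v $ i"
proof -
  have "conjugate (unit_vec n i :: complex vec) = unit_vec n i"
    by (intro eq_vecI) (auto simp: conjugate_complex_def unit_vec_def)
  then show ?thesis using assms by simp
qed

lemma cprod_ext:
  fixes v w :: "complex vec"
  assumes "v \<in> carrier_vec n" "w \<in> carrier_vec n" and "\<And>x. x \<in> carrier_vec n \<Longrightarrow> v \<bullet>c x = w \<bullet>c x"
  shows "v = w"
proof (rule eq_vecI)
  show "v $ i = w $ i" if "i < dim_vec w" for i
    using that assms cprod_unit_right[of v n i] cprod_unit_right[of w n i] unit_vec_carrier[of n i] by auto
qed (use assms in auto)

lemma cprod_zero_left [simp]: "x \<in> carrier_vec n \<Longrightarrow> 0\<^sub>v n \<bullet>c (x :: complex vec) = 0"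
  by (simp add: cprod_sum)

lemma cprod_zero_right [simp]: "x \<in> carrier_vec n \<Longrightarrow> x \<bullet>c (0\<^sub>v n :: complex vec) = 0"
  by (simp add: cprod_sum[of _ n])

lemma cprod_append:
  fixes a b c d :: "complex vec"
  assumes "a \<in> carrier_vec n" "b \<in> carrier_vec m" "c \<in> carrier_vec n" "d \<in> carrier_vec m"
  shows "(a @\<^sub>v b) \<bullet>c (c @\<^sub>v d) = a \<bullet>c c + b \<bullet>c d"
proof -
  have "conjugate (c @\<^sub>v d) = conjugate c @\<^sub>v conjugate d"
    by (intro eq_vecI) (auto simp: append_vec_def Let_def)
  then show ?thesis using assms by (simp add: scalar_prod_append)
qed

lemma linear_functional_sum:
  fixes F :: "complex vec \<Rightarrow> complex"
  assumes add: "\<And>x y. x \<in> carrier_vec n \<Longrightarrow> y \<in> carrier_vec n \<Longrightarrow> F (x + y) = F x + F y"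
    and scale: "\<And>c x. x \<in> carrier_vec n \<Longrightarrow> F (c \<cdot>\<^sub>v x) = c * F x"
    and x: "x \<in> carrier_vec n"
  shows "F x = (\<Sum>j<n. x $ j * F (unit_vec n j))"
proof -
  \<comment> \<open>Induction on the number \<open>k\<close> of coordinates kept; the others are set
    to zero.\<close>
  have "F (vec n (\<lambda>i. if i < k then x $ i else 0)) = (\<Sum>j<k. x $ j * F (unit_vec n j))" if "k \<le> n" for k
    using that
  proof (induction k)
    case 0
    have "vec n (\<lambda>i. if i < 0 then x $ i else 0) = 0 \<cdot>\<^sub>v (0\<^sub>v n :: complex vec)" by (intro eq_vecI) auto
    then show ?case using scale[of "0\<^sub>v n" 0] by simp
  next
    case (Suc k)
    have "vec n (\<lambda>i. if i < Suc k then x $ i else 0) =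
        vec n (\<lambda>i. if i < k then x $ i else 0) + x $ k \<cdot>\<^sub>v unit_vec n k"
      using Suc.prems by (intro eq_vecI) (auto simp: unit_vec_def less_Suc_eq)
    then show ?case using Suc by (simp add: add scale)
  qed
  from this[of n] have "F (vec n (\<lambda>i. if i < n then x $ i else 0)) = (\<Sum>j<n. x $ j * F (unit_vec n j))"
    by simp
  moreover have "vec n (\<lambda>i. if i < n then x $ i else 0) = x" using x by (intro eq_vecI) auto
  ultimately show ?thesis by simp
qed

text \<open>Riesz representation on \<open>C^p\<close>; it supplies the vectors whose existence the
  adjoints into \<open>C^p\<close> presuppose.\<close>

lemma conj_linear_functional_cprod:
  fixes F :: "complex vec \<Rightarrow> complex"
  assumes add: "\<And>x y. x \<in> carrier_vec n \<Longrightarrow> y \<in> carrier_vec n \<Longrightarrow> F (x + y) = F x + F y"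
    and scale: "\<And>c x. x \<in> carrier_vec n \<Longrightarrow> F (c \<cdot>\<^sub>v x) = cnj c * F x"
    and x: "x \<in> carrier_vec n"
  shows "vec n (\<lambda>j. F (unit_vec n j)) \<bullet>c x = F x"
proof -
  have "cnj (F x) = (\<Sum>j<n. x $ j * cnj (F (unit_vec n j)))"
    using linear_functional_sum[of n "\<lambda>x. cnj (F x)" x] add scale x by simp
  then have "F x = cnj (\<Sum>j<n. x $ j * cnj (F (unit_vec n j)))" by (metis complex_cnj_cnj)
  then show ?thesis by (simp add: cprod_sum[OF x] mult.commute)
qed

lemma op_mat_carrier [simp]: "op_mat p T \<in> carrier_mat p p"
  by (simp add: op_mat_def)

lemma op_mat_mult:
  assumes T: "\<And>x. x \<in> carrier_vec p \<Longrightarrow> T x \<in> carrier_vec p"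
    and add: "\<And>x y. x \<in> carrier_vec p \<Longrightarrow> y \<in> carrier_vec p \<Longrightarrow> T (x + y) = T x + T y"
    and scale: "\<And>c x. x \<in> carrier_vec p \<Longrightarrow> T (c \<cdot>\<^sub>v x) = c \<cdot>\<^sub>v T x"
    and x: "x \<in> carrier_vec p"
  shows "op_mat p T *\<^sub>v x = T x"
proof (rule eq_vecI)
  fix i assume "i < dim_vec (T x)"
  then have i: "i < p" using T[OF x] by simp
  have "T x $ i = (\<Sum>j<p. x $ j * T (unit_vec p j) $ i)"
  proof (rule linear_functional_sum[OF _ _ x])
    fix y z :: "complex vec" assume y: "y \<in> carrier_vec p" and z: "z \<in> carrier_vec p"
    show "T (y + z) $ i = T y $ i + T z $ i" using T[OF y] T[OF z] i by (simp add: add y z)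
  next
    fix y :: "complex vec" and c assume y: "y \<in> carrier_vec p"
    show "T (c \<cdot>\<^sub>v y) $ i = c * T y $ i" using T[OF y] i by (simp add: scale y)
  qed
  moreover have "(op_mat p T *\<^sub>v x) $ i = (\<Sum>j<p. T (unit_vec p j) $ i * x $ j)"
    using x i by (simp add: op_mat_def scalar_prod_def atLeast0LessThan)
  ultimately show "(op_mat p T *\<^sub>v x) $ i = T x $ i" by (simp only: mult.commute)
qed (use T[OF x] in \<open>simp add: op_mat_def\<close>)

lemma mat_adjoint_carrier [simp]: "M \<in> carrier_mat n m \<Longrightarrow> mat_adjoint M \<in> carrier_mat m n"
  unfolding mat_adjoint_def by (intro carrier_matI) auto

lemma mat_adjoint_index [simp]:
  "i < dim_col M \<Longrightarrow> j < dim_row M \<Longrightarrow> mat_adjoint M $$ (i, j) = conjugate (M $$ (j, i))"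
  by (simp add: mat_adjoint_def mat_of_rows_def)

lemma mat_adjoint_dim [simp]:
  "dim_row (mat_adjoint M) = dim_col M" "dim_col (mat_adjoint M) = dim_row M"
  by (simp_all add: mat_adjoint_def)

lemma mat_adjoint_adjoint [simp]: "mat_adjoint (mat_adjoint M) = M"
  by (rule eq_matI) auto

lemma mat_adjoint_cprod:
  fixes M :: "complex mat"
  assumes M: "M \<in> carrier_mat n m" and v: "v \<in> carrier_vec m" and w: "w \<in> carrier_vec n"
  shows "(M *\<^sub>v v) \<bullet>c w = v \<bullet>c (mat_adjoint M *\<^sub>v w)"
proof -
  have "(M *\<^sub>v v) \<bullet>c w = (\<Sum>i<n. \<Sum>j<m. M $$ (i, j) * v $ j * cnj (w $ i))"
    unfolding cprod_sum[OF w] using M v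
    by (intro sum.cong refl) (auto simp: scalar_prod_def atLeast0LessThan sum_distrib_right)
  also have "\<dots> = (\<Sum>j<m. \<Sum>i<n. v $ j * cnj (cnj (M $$ (i, j)) * w $ i))"
    by (subst sum.swap) (simp add: mult_ac)
  also have "\<dots> = v \<bullet>c (mat_adjoint M *\<^sub>v w)"
    using M w by (subst cprod_sum[of _ m])
      (auto simp: scalar_prod_def atLeast0LessThan sum_distrib_left conjugate_complex_def mult_mat_vec_def)
  finally show ?thesis .
qed

lemma eq_mat_mult_vecI:
  fixes M N :: "complex mat"
  assumes M: "M \<in> carrier_mat n m" and N: "N \<in> carrier_mat n m"
    and eq: "\<And>v. v \<in> carrier_vec m \<Longrightarrow> M *\<^sub>v v = N *\<^sub>v v"
  shows "M = N"
proof (rule eq_matI)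
  fix i j assume "i < dim_row N" "j < dim_col N"
  with N have ij: "i < n" "j < m" by auto
  have "(M *\<^sub>v unit_vec m j) $ i = (N *\<^sub>v unit_vec m j) $ i" by (simp add: eq)
  then show "M $$ (i, j) = N $$ (i, j)" using M N ij by simp
qed (use M N in auto)

lemma injective_mat_inverse:
  fixes M :: "complex mat"
  assumes M: "M \<in> carrier_mat n n"
    and inj: "\<And>v. v \<in> carrier_vec n \<Longrightarrow> M *\<^sub>v v = 0\<^sub>v n \<Longrightarrow> v = 0\<^sub>v n"
  obtains N where "mat_inverse M = Some N" "N \<in> carrier_mat n n" "M * N = 1\<^sub>m n" "N * M = 1\<^sub>m n"
proof -
  have "det M \<noteq> 0" using inj det_0_iff_vec_prod_zero_field[OF M] by blast
  then have "M \<in> Units (ring_mat TYPE(complex) n n)" by (rule det_non_zero_imp_unit[OF M])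
  then obtain N where "mat_inverse M = Some N" using mat_inverse(1)[OF M] by fastforce
  then show ?thesis using that mat_inverse(2)[OF M] by blast
qed

section \<open>Boundary triples and the gamma field\<close>

lemma adj_C_plus_eqI:
  assumes "v \<in> carrier_vec p" "\<And>\<xi>. \<xi> \<in> carrier_vec p \<Longrightarrow> v \<bullet>c \<xi> = \<phi> (T \<xi>)"
  shows "adj_C_plus p T \<phi> = v"
  unfolding adj_C_plus_def
  by (rule the_equality) (use assms in \<open>auto intro!: cprod_ext[of _ p]\<close>)

lemma (in closed_symmetric) adj_C_plus:
  assumes T: "\<And>\<xi>. \<xi> \<in> carrier_vec p \<Longrightarrow> T \<xi> \<in> plus_space A"
    and add: "\<And>x y. x \<in> carrier_vec p \<Longrightarrow> y \<in> carrier_vec p \<Longrightarrow> T (x + y) = T x + T y"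
    and scale: "\<And>c x. x \<in> carrier_vec p \<Longrightarrow> T (c \<cdot>\<^sub>v x) = c *\<^sub>C T x"
    and \<phi>: "\<phi> \<in> minus_space A"
  shows "adj_C_plus p T \<phi> \<in> carrier_vec p"
    and "\<And>\<xi>. \<xi> \<in> carrier_vec p \<Longrightarrow> adj_C_plus p T \<phi> \<bullet>c \<xi> = \<phi> (T \<xi>)"
proof -
  let ?v = "vec p (\<lambda>j. \<phi> (T (unit_vec p j)))"
  have v: "?v \<bullet>c \<xi> = \<phi> (T \<xi>)" if "\<xi> \<in> carrier_vec p" for \<xi>
    by (rule conj_linear_functional_cprod[OF _ _ that])
      (simp_all add: add scale T minus_spaceD[OF \<phi>])
  then have "adj_C_plus p T \<phi> = ?v" by (intro adj_C_plus_eqI) auto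
  with v show "adj_C_plus p T \<phi> \<in> carrier_vec p"
    "\<And>\<xi>. \<xi> \<in> carrier_vec p \<Longrightarrow> adj_C_plus p T \<phi> \<bullet>c \<xi> = \<phi> (T \<xi>)" by simp_all
qed

lemma linear_on_relD:
  assumes G: "linear_on_rel p T G" and f: "(f, f') \<in> T"
  shows "(g, g') \<in> T \<Longrightarrow> G (f + g, f' + g') = G (f, f') + G (g, g')"
    and "G (c *\<^sub>C f, c *\<^sub>C f') = c \<cdot>\<^sub>v G (f, f')"
proof -
  have "\<forall>(f, f')\<in>T. \<forall>(g, g')\<in>T. G (f + g, f' + g') = G (f, f') + G (g, g')"
    using G unfolding linear_on_rel_def by (elim conjE)
  from bspec[OF bspec[OF this f, unfolded prod.case], of "(g, g')"]
  show "(g, g') \<in> T \<Longrightarrow> G (f + g, f' + g') = G (f, f') + G (g, g')" by simp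
  have "\<forall>(f, f')\<in>T. \<forall>c. G (c *\<^sub>C f, c *\<^sub>C f') = c \<cdot>\<^sub>v G (f, f')"
    using G unfolding linear_on_rel_def by (elim conjE)
  from bspec[OF this f] show "G (c *\<^sub>C f, c *\<^sub>C f') = c \<cdot>\<^sub>v G (f, f')" by simp
qed

lemma vec_add_self_zero:
  fixes v w :: "complex vec"
  assumes "v = w + v" "v \<in> carrier_vec n" "w \<in> carrier_vec n"
  shows "w = 0\<^sub>v n"
proof (rule eq_vecI)
  show "w $ i = 0\<^sub>v n $ i" if "i < dim_vec (0\<^sub>v n)" for i
    using arg_cong[OF assms(1), of "\<lambda>v. v $ i"] that assms(2,3) by simp
qed (use assms in simp)

locale boundary = closed_symmetric A for A :: "('h :: complex_hilbert \<times> 'h) set" +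
  fixes p :: nat and \<Gamma>0 \<Gamma>1 :: "'h \<times> 'h \<Rightarrow> complex vec"
  assumes triple: "boundary_triple p A \<Gamma>0 \<Gamma>1"
begin

abbreviation "A0 \<equiv> ker_rel p A \<Gamma>0"
abbreviation "R0 \<equiv> resolvent_op A0"

lemma Gamma_carrier:
  "x \<in> rel_adjoint A \<Longrightarrow> \<Gamma>0 x \<in> carrier_vec p" "x \<in> rel_adjoint A \<Longrightarrow> \<Gamma>1 x \<in> carrier_vec p"
  using triple unfolding boundary_triple_def linear_on_rel_def by auto

lemma Gamma_linear: "linear_on_rel p (rel_adjoint A) \<Gamma>0" "linear_on_rel p (rel_adjoint A) \<Gamma>1"
  by (rule conjunct1[OF triple[unfolded boundary_triple_def]])
    (rule conjunct1[OF conjunct2[OF triple[unfolded boundary_triple_def]]])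

lemmas Gamma_add = linear_on_relD(1)[OF Gamma_linear(1)] linear_on_relD(1)[OF Gamma_linear(2)]

lemmas Gamma_scale = linear_on_relD(2)[OF Gamma_linear(1)] linear_on_relD(2)[OF Gamma_linear(2)]

lemma Green:
  assumes f: "(f, f') \<in> rel_adjoint A" and g: "(g, g') \<in> rel_adjoint A"
  shows "cinner f' g - cinner f g' = \<Gamma>1 (f, f') \<bullet>c \<Gamma>0 (g, g') - \<Gamma>0 (f, f') \<bullet>c \<Gamma>1 (g, g')"
proof -
  have "\<forall>(f, f')\<in>rel_adjoint A. \<forall>(g, g')\<in>rel_adjoint A.
        cinner f' g - cinner f g' =
          \<Gamma>1 (f, f') \<bullet>c \<Gamma>0 (g, g') - \<Gamma>0 (f, f') \<bullet>c \<Gamma>1 (g, g')"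
    using triple unfolding boundary_triple_def by (elim conjE)
  from bspec[OF bspec[OF this f, unfolded prod.case] g] show ?thesis by simp
qed

lemma Gamma_onto:
  assumes "a \<in> carrier_vec p" "b \<in> carrier_vec p"
  obtains f f' where "(f, f') \<in> rel_adjoint A" "\<Gamma>0 (f, f') = a" "\<Gamma>1 (f, f') = b"
proof -
  have "\<forall>a\<in>carrier_vec p. \<forall>b\<in>carrier_vec p. \<exists>x\<in>rel_adjoint A. \<Gamma>0 x = a \<and> \<Gamma>1 x = b"
    using triple unfolding boundary_triple_def by (elim conjE)
  then obtain x where "x \<in> rel_adjoint A" "\<Gamma>0 x = a" "\<Gamma>1 x = b" using assms by blast
  then show thesis using that by (cases x) simp
qed

lemma subspace_A0: "complex_vs.subspace A0"
proof (rule complex_vs.subspaceI)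
  have "\<Gamma>0 (0, 0) = 0 \<cdot>\<^sub>v \<Gamma>0 (0, 0)" using Gamma_scale(1)[OF rel_adjoint_zero, of 0] by simp
  moreover have "0 \<cdot>\<^sub>v \<Gamma>0 (0, 0) = 0\<^sub>v p"
    using Gamma_carrier(1)[OF rel_adjoint_zero] by (intro eq_vecI) auto
  ultimately have "\<Gamma>0 (0, 0) = 0\<^sub>v p" by simp
  then show "0 \<in> A0" by (simp add: ker_rel_def zero_prod_def rel_adjoint_zero)
  show "x + y \<in> A0" if "x \<in> A0" "y \<in> A0" for x y
    using that Gamma_add(1) by (cases x; cases y) (auto simp: ker_rel_def rel_adjoint_add)
  show "c *\<^sub>C x \<in> A0" if "x \<in> A0" for x c
    using that Gamma_scale(1) by (cases x) (auto simp: ker_rel_def rel_adjoint_scale)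
qed

lemma A0_sub_adjoint: "A0 \<subseteq> rel_adjoint A"
  by (auto simp: ker_rel_def)

lemma A0_iff: "x \<in> A0 \<longleftrightarrow> x \<in> rel_adjoint A \<and> \<Gamma>0 x = 0\<^sub>v p"
  by (auto simp: ker_rel_def)

text \<open>The boundary map is onto, so there are test elements with \<open>\<Gamma>0\<close> zero
  and \<open>\<Gamma>1\<close> arbitrary. Against elements of \<open>A\<close> the left side of
  Green's identity vanishes, and what remains is \<open>\<Gamma>0 x\<close> paired with an arbitrary
  vector.\<close>

lemma A_sub_A0: "A \<subseteq> A0"
proof
  fix x assume x: "x \<in> A"
  obtain f f' where ff: "x = (f, f')" by (cases x)
  have xA: "(f, f') \<in> rel_adjoint A" using x ff A_sub_adjoint by blast
  have "\<Gamma>0 x \<bullet>c b = 0\<^sub>v p \<bullet>c b" if b: "b \<in> carrier_vec p" for b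
  proof -
    obtain g g' where g: "(g, g') \<in> rel_adjoint A" "\<Gamma>0 (g, g') = 0\<^sub>v p" "\<Gamma>1 (g, g') = b"
      using Gamma_onto[of "0\<^sub>v p" b] b by auto
    have "cinner f' g = cinner f g'"
      using rel_adjointD[OF g(1), of f f'] x ff by (metis cinner_commute)
    with Green[OF xA g(1)] g(2,3) show ?thesis using Gamma_carrier[OF xA] b by (simp add: ff)
  qed
  then have "\<Gamma>0 x = 0\<^sub>v p" using Gamma_carrier[OF xA] by (intro cprod_ext[of _ p]) (auto simp: ff)
  then show "x \<in> A0" using xA ff by (simp add: A0_iff)
qed

text \<open>Symmetry is Green's identity with both \<open>\<Gamma>0\<close> values zero. For the
  converse, the test elements of \<open>A_sub_A0\<close> belong to \<open>A0\<close> themselves, and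
  that inclusion places \<open>x\<close> in the adjoint of \<open>A\<close>.\<close>

lemma A0_selfadjoint: "selfadjoint_rel A0"
  unfolding selfadjoint_rel_def
proof
  show "linear_relation A0" by (simp add: linear_relation_iff_subspace subspace_A0)
  show "A0 = rel_adjoint A0"
  proof (intro equalityI subsetI)
    fix x assume x: "x \<in> A0"
    obtain f f' where ff: "x = (f, f')" by (cases x)
    have "cinner f' g = cinner f g'" if "(g, g') \<in> A0" for g g'
      using Green[of f f' g g'] x that Gamma_carrier by (auto simp: A0_iff ff)
    then show "x \<in> rel_adjoint A0" by (simp add: ff in_rel_adjoint)
  next
    fix x assume x: "x \<in> rel_adjoint A0"
    obtain f f' where ff: "x = (f, f')" by (cases x)
    have xA: "(f, f') \<in> rel_adjoint A" using x A_sub_A0 by (auto simp: ff in_rel_adjoint)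
    have "\<Gamma>0 x \<bullet>c b = 0\<^sub>v p \<bullet>c b" if b: "b \<in> carrier_vec p" for b
    proof -
      obtain g g' where g: "(g, g') \<in> rel_adjoint A" "\<Gamma>0 (g, g') = 0\<^sub>v p" "\<Gamma>1 (g, g') = b"
        using Gamma_onto[of "0\<^sub>v p" b] b by auto
      have "cinner f' g = cinner f g'"
        using x g by (auto simp: ff A0_iff intro: rel_adjointD)
      with Green[OF xA g(1)] g(2,3) show ?thesis using Gamma_carrier[OF xA] b by (simp add: ff)
    qed
    then have "\<Gamma>0 x = 0\<^sub>v p" using Gamma_carrier[OF xA] by (intro cprod_ext[of _ p]) (auto simp: ff)
    then show "x \<in> A0" using xA ff by (simp add: A0_iff)
  qed
qed

lemma R0_pair: "z \<in> resolvent_set A0 \<Longrightarrow> resolvent_pair A z (R0 z) (R0 (cnj z))"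
  by (rule selfadjoint_resolvent_pair[OF A0_selfadjoint _ A_sub_A0])

lemma i_resolvent: "\<i> \<in> resolvent_set A0" "- \<i> \<in> resolvent_set A0"
  by (rule selfadjoint_rel_resolvent[OF A0_selfadjoint]; simp)+

lemma R0_pair_i: "resolvent_pair A \<i> (R0 \<i>) (R0 (- \<i>))" "resolvent_pair A (- \<i>) (R0 (- \<i>)) (R0 \<i>)"
  using R0_pair[OF i_resolvent(1)] R0_pair[OF i_resolvent(2)] by simp_all

section \<open>The gamma field at resolvent points of \<open>A0\<close>\<close>

lemma defect_in_A0_zero:
  assumes "z \<in> resolvent_set A0" "(f, z *\<^sub>C f) \<in> A0"
  shows "f = 0"
proof -
  have "R0 z 0 = f" using assms by (intro resolvent_op_unique) auto
  moreover have "R0 z 0 = 0"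
    using assms(1) complex_vs.subspace_0[OF subspace_A0]
    by (intro resolvent_op_unique) (auto simp: zero_prod_def)
  ultimately show ?thesis by simp
qed

lemma gamma_hat:
  assumes z: "z \<in> resolvent_set A0" and \<xi>: "\<xi> \<in> carrier_vec p"
  shows "(gamma_field A \<Gamma>0 z \<xi>, z *\<^sub>C gamma_field A \<Gamma>0 z \<xi>) \<in> rel_adjoint A"
    and "\<Gamma>0 (gamma_field A \<Gamma>0 z \<xi>, z *\<^sub>C gamma_field A \<Gamma>0 z \<xi>) = \<xi>"
    and "gamma_hat A \<Gamma>0 z \<xi> = (gamma_field A \<Gamma>0 z \<xi>, z *\<^sub>C gamma_field A \<Gamma>0 z \<xi>)"
proof -
  obtain g g' where g: "(g, g') \<in> rel_adjoint A" "\<Gamma>0 (g, g') = \<xi>"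
    using Gamma_onto[OF \<xi> \<xi>] .
  \<comment> \<open>The element of \<open>A0\<close> over \<open>u\<close> has second component
    \<open>g' - z *\<^sub>C g + z *\<^sub>C u\<close>; subtracting it from \<open>(g, g')\<close>
    keeps the \<open>\<Gamma>0\<close> value and leaves an element of the defect space at
    \<open>z\<close>.\<close>
  define u where "u = R0 z (g' - z *\<^sub>C g)"
  have u: "(u, g' - z *\<^sub>C g + z *\<^sub>C u) \<in> A0" unfolding u_def by (rule resolvent_op_in[OF z])
  have gu: "(g - u, z *\<^sub>C (g - u)) \<in> rel_adjoint A"
    using rel_adjoint_diff[OF g(1), of u "g' - z *\<^sub>C g + z *\<^sub>C u"] u A0_sub_adjoint
    by (auto simp: complex_vs.scale_right_diff_distrib algebra_simps)
  have "(g, g') = ((g - u) + u, z *\<^sub>C (g - u) + (g' - z *\<^sub>C g + z *\<^sub>C u))"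
    by (simp add: complex_vs.scale_right_diff_distrib)
  then have "\<Gamma>0 (g, g') = \<Gamma>0 (g - u, z *\<^sub>C (g - u)) + \<Gamma>0 (u, g' - z *\<^sub>C g + z *\<^sub>C u)"
    using Gamma_add(1)[OF gu] u A0_sub_adjoint by (metis subsetD)
  then have "\<Gamma>0 (g - u, z *\<^sub>C (g - u)) = \<xi>" using u Gamma_carrier[OF gu] by (simp add: A0_iff g(2))
  then have ex: "\<xi> \<in> \<Gamma>0 ` defect_space_hat A z"
    using gu unfolding defect_space_hat_def eigen_ker_def by (intro image_eqI[of _ _ "(g - u, z *\<^sub>C (g - u))"]) auto
  have "gamma_hat A \<Gamma>0 z \<xi> \<in> defect_space_hat A z"
    unfolding gamma_hat_def by (rule inv_into_into[OF ex])
  then show eq: "gamma_hat A \<Gamma>0 z \<xi> = (gamma_field A \<Gamma>0 z \<xi>, z *\<^sub>C gamma_field A \<Gamma>0 z \<xi>)"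
    and "(gamma_field A \<Gamma>0 z \<xi>, z *\<^sub>C gamma_field A \<Gamma>0 z \<xi>) \<in> rel_adjoint A"
    unfolding gamma_field_def defect_space_hat_def eigen_ker_def by auto
  show "\<Gamma>0 (gamma_field A \<Gamma>0 z \<xi>, z *\<^sub>C gamma_field A \<Gamma>0 z \<xi>) = \<xi>"
    unfolding eq[symmetric] unfolding gamma_hat_def by (rule f_inv_into_f[OF ex])
qed

text \<open>Injectivity of \<open>\<Gamma>0\<close> on the defect space: a difference with
  \<open>\<Gamma>0\<close> zero would be an eigenvector of \<open>A0\<close> at a resolvent point.
  Linearity of the gamma field is read off from this.\<close>

lemma gamma_unique:
  assumes z: "z \<in> resolvent_set A0" and f: "(f, z *\<^sub>C f) \<in> rel_adjoint A"
  shows "gamma_field A \<Gamma>0 z (\<Gamma>0 (f, z *\<^sub>C f)) = f"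
proof -
  let ?\<xi> = "\<Gamma>0 (f, z *\<^sub>C f)"
  let ?g = "gamma_field A \<Gamma>0 z ?\<xi>"
  note \<xi> = Gamma_carrier(1)[OF f]
  note g = gamma_hat[OF z \<xi>]
  have "(f, z *\<^sub>C f) = ((f - ?g) + ?g, z *\<^sub>C (f - ?g) + z *\<^sub>C ?g)"
    by (simp add: complex_vs.scale_right_diff_distrib)
  moreover have d: "(f - ?g, z *\<^sub>C (f - ?g)) \<in> rel_adjoint A"
    using rel_adjoint_diff[OF f g(1)] by (simp add: complex_vs.scale_right_diff_distrib)
  ultimately have "?\<xi> = \<Gamma>0 (f - ?g, z *\<^sub>C (f - ?g)) + ?\<xi>"
    using Gamma_add(1)[OF d g(1)] g(2) by simp
  then have "\<Gamma>0 (f - ?g, z *\<^sub>C (f - ?g)) = 0\<^sub>v p"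
    using \<xi> Gamma_carrier(1)[OF d] by (intro vec_add_self_zero)
  then have "f - ?g = 0" using d by (intro defect_in_A0_zero[OF z]) (simp add: A0_iff)
  then show ?thesis by simp
qed

lemma gamma_add:
  assumes z: "z \<in> resolvent_set A0" and x: "x \<in> carrier_vec p" and y: "y \<in> carrier_vec p"
  shows "gamma_field A \<Gamma>0 z (x + y) = gamma_field A \<Gamma>0 z x + gamma_field A \<Gamma>0 z y"
  using gamma_unique[OF z, of "gamma_field A \<Gamma>0 z x + gamma_field A \<Gamma>0 z y"]
    rel_adjoint_add[OF gamma_hat(1)[OF z x] gamma_hat(1)[OF z y]]
    Gamma_add(1)[OF gamma_hat(1)[OF z x] gamma_hat(1)[OF z y]]
  by (simp add: gamma_hat(2)[OF z] x y scaleC_add_right)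

lemma gamma_scale:
  assumes z: "z \<in> resolvent_set A0" and x: "x \<in> carrier_vec p"
  shows "gamma_field A \<Gamma>0 z (c \<cdot>\<^sub>v x) = c *\<^sub>C gamma_field A \<Gamma>0 z x"
  using gamma_unique[OF z, of "c *\<^sub>C gamma_field A \<Gamma>0 z x"]
    rel_adjoint_scale[OF gamma_hat(1)[OF z x], of c]
    Gamma_scale(1)[OF gamma_hat(1)[OF z x], of c]
  by (simp add: gamma_hat(2)[OF z] x scaleC_scaleC mult.commute)

lemma gamma_plus: "z \<in> resolvent_set A0 \<Longrightarrow> x \<in> carrier_vec p \<Longrightarrow> gamma_field A \<Gamma>0 z x \<in> plus_space A"
  using gamma_hat(1) dom_adjoint_plus by blast

lemma gamma_adjoint:
  assumes "z \<in> resolvent_set A0" "\<phi> \<in> minus_space A"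
  shows "adj_C_plus p (gamma_field A \<Gamma>0 z) \<phi> \<in> carrier_vec p"
    and "\<And>\<xi>. \<xi> \<in> carrier_vec p \<Longrightarrow>
      adj_C_plus p (gamma_field A \<Gamma>0 z) \<phi> \<bullet>c \<xi> = \<phi> (gamma_field A \<Gamma>0 z \<xi>)"
  by (rule adj_C_plus; use assms gamma_add gamma_scale gamma_plus in simp)+

text \<open>Formally both sides are the Green form of \<open>\<phi>\<close>'s element of the extension of \<open>A0\<close> and \<open>(b, b')\<close>.\<close>

lemma gamma_adjoint_Gamma0:
  assumes z: "z \<in> resolvent_set A0" and \<phi>: "\<phi> \<in> minus_space A" and b: "(b, b') \<in> rel_adjoint A"
  shows "adj_C_plus p (gamma_field A \<Gamma>0 (cnj z)) \<phi> \<bullet>c \<Gamma>0 (b, b') =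
    \<phi> b + z * cinner (R_tilde R0 z \<phi>) b - cinner (R_tilde R0 z \<phi>) b'"
proof -
  have z': "cnj z \<in> resolvent_set A0" by (rule resolvent_set_cnj[OF A0_selfadjoint z])
  \<comment> \<open>The defect vector at \<open>cnj z\<close> with the same \<open>\<Gamma>0\<close>
    value as \<open>(b, b')\<close>. The difference lies in \<open>A0\<close>, so
    \<open>b - ?g\<close> is a value of \<open>R0 (cnj z)\<close>, on which
    \<open>adj_H_plus_apply\<close> evaluates \<open>\<phi>\<close>.\<close>
  let ?g = "gamma_field A \<Gamma>0 (cnj z) (\<Gamma>0 (b, b'))"
  have g: "(?g, cnj z *\<^sub>C ?g) \<in> rel_adjoint A" "\<Gamma>0 (?g, cnj z *\<^sub>C ?g) = \<Gamma>0 (b, b')"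
    using gamma_hat(1,2)[OF z' Gamma_carrier(1)[OF b]] by auto
  have d: "(b - ?g, b' - cnj z *\<^sub>C ?g) \<in> rel_adjoint A" by (rule rel_adjoint_diff[OF b g(1)])
  have "\<Gamma>0 (b, b') = \<Gamma>0 (b - ?g, b' - cnj z *\<^sub>C ?g) + \<Gamma>0 (b, b')"
    using Gamma_add(1)[OF d g(1)] by (simp add: g(2))
  then have "\<Gamma>0 (b - ?g, b' - cnj z *\<^sub>C ?g) = 0\<^sub>v p"
    using Gamma_carrier(1)[OF b] Gamma_carrier(1)[OF d]
    by (intro vec_add_self_zero)
  then have "(b - ?g, (b' - cnj z *\<^sub>C b) + cnj z *\<^sub>C (b - ?g)) \<in> A0"
    using d by (simp add: A0_iff complex_vs.scale_right_diff_distrib)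
  then have eq: "R0 (cnj z) (b' - cnj z *\<^sub>C b) = b - ?g" by (rule resolvent_op_unique[OF z'])
  have "cinner (R_tilde R0 z \<phi>) (b' - cnj z *\<^sub>C b) = \<phi> (b - ?g)"
    unfolding R_tilde_def adj_H_plus_apply[OF R0_pair[OF z] \<phi>] eq ..
  also have "\<dots> = \<phi> b - \<phi> ?g"
    using minus_spaceD(1)[OF \<phi>, of "b - ?g" ?g] dom_adjoint_plus[OF d] dom_adjoint_plus[OF g(1)] by simp
  finally show ?thesis
    unfolding gamma_adjoint(2)[OF z' \<phi> Gamma_carrier(1)[OF b]] by (simp add: cinner_simps algebra_simps)
qed

section \<open>The symmetric mean of the resolvents at \<open>\<i>\<close> and
  \<open>- \<i>\<close>\<close>

abbreviation "Rb \<equiv> R_bold p A \<Gamma>0"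

text \<open>\<open>(Rb \<phi>, \<phi> + Yb \<phi>)\<close> is the mean of the elements of the extension of \<open>A0\<close> given by the
  resolvents at \<open>\<i>\<close> and \<open>- \<i>\<close>.\<close>

definition Yb :: "('h \<Rightarrow> complex) \<Rightarrow> 'h" where
  "Yb \<phi> = (1 / 2) *\<^sub>C (\<i> *\<^sub>C R_tilde R0 \<i> \<phi> - \<i> *\<^sub>C R_tilde R0 (- \<i>) \<phi>)"

lemma R_bold_eq:
  assumes \<phi>: "\<phi> \<in> minus_space A"
  shows "Rb \<phi> = (1 / 2) *\<^sub>C (R_tilde R0 \<i> \<phi> + R_tilde R0 (- \<i>) \<phi>)"
  unfolding R_bold_def
proof (rule adj_H_plus_eqI)
  fix g
  note a = resolvent_pair_adjoint[OF R0_pair_i(1), of g] resolvent_pair_adjoint[OF R0_pair_i(2), of g]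
  have pl: "R0 \<i> g \<in> plus_space A" "R0 (- \<i>) g \<in> plus_space A"
    using a dom_adjoint_plus by blast+
  then have "R0 \<i> g + R0 (- \<i>) g \<in> plus_space A" by (rule complex_vs.subspace_add[OF subspace_plus])
  then show "cinner ((1 / 2) *\<^sub>C (R_tilde R0 \<i> \<phi> + R_tilde R0 (- \<i>) \<phi>)) g =
      \<phi> ((1 / 2) *\<^sub>C (R0 \<i> g + R0 (- \<i>) g))"
    using pl unfolding R_tilde_def
    by (simp add: cinner_simps adj_H_plus_apply[OF R0_pair_i(1) \<phi>] adj_H_plus_apply[OF R0_pair_i(2) \<phi>]
        minus_spaceD[OF \<phi>])
qed

text \<open>In the difference of the extended elements at \<open>\<i>\<close> and
  \<open>- \<i>\<close> the functional cancels, which leaves an element of \<open>A0\<close> with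
  components proportional to \<open>Yb\<close> and \<open>Rb\<close>. The claim is the symmetry of
  \<open>A0\<close> for two such elements.\<close>

lemma Yb_R_bold:
  assumes \<phi>: "\<phi> \<in> minus_space A" and \<chi>: "\<chi> \<in> minus_space A"
  shows "cinner (Yb \<phi>) (Rb \<chi>) = cinner (Rb \<phi>) (Yb \<chi>)"
proof -
  have A0: "(R_tilde R0 \<i> \<psi> - R_tilde R0 (- \<i>) \<psi>, \<i> *\<^sub>C (R_tilde R0 \<i> \<psi> + R_tilde R0 (- \<i>) \<psi>)) \<in> A0"
    if \<psi>: "\<psi> \<in> minus_space A" for \<psi>
  proof -
    have *: "cinner (R_tilde R0 w \<psi>) h' = \<psi> h + w * cinner (R_tilde R0 w \<psi>) h"
      if w: "w \<in> resolvent_set A0" and h: "(h, h') \<in> A0" for w h h'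
    proof -
      have "R0 (cnj w) (h' - cnj w *\<^sub>C h) = h"
        using h by (intro resolvent_op_unique resolvent_set_cnj[OF A0_selfadjoint w]) simp
      then have "cinner (R_tilde R0 w \<psi>) (h' - cnj w *\<^sub>C h) = \<psi> h"
        unfolding R_tilde_def adj_H_plus_apply[OF R0_pair[OF w] \<psi>] by simp
      then show ?thesis by (simp add: cinner_simps algebra_simps)
    qed
    have "(R_tilde R0 \<i> \<psi> - R_tilde R0 (- \<i>) \<psi>, \<i> *\<^sub>C (R_tilde R0 \<i> \<psi> + R_tilde R0 (- \<i>) \<psi>)) \<in> rel_adjoint A0"
      using *[OF i_resolvent(1)] *[OF i_resolvent(2)]
      by (simp add: in_rel_adjoint cinner_simps algebra_simps)
    then show ?thesis using A0_selfadjoint unfolding selfadjoint_rel_def by simp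
  qed
  from selfadjoint_rel_swap[OF A0_selfadjoint A0[OF \<phi>] A0[OF \<chi>]]
  show ?thesis
    unfolding R_bold_eq[OF \<phi>] R_bold_eq[OF \<chi>] Yb_def by (simp add: cinner_simps field_simps)
qed

text \<open>Neither of the two terms of the difference lies in the positive space.\<close>

lemma R_hat_dom:
  assumes S: "resolvent_pair A z S S'" and \<phi>: "\<phi> \<in> minus_space A" and r: "represents \<phi> a b"
  defines "X \<equiv> S (a + z *\<^sub>C b)" and "Y \<equiv> R0 \<i> (a + \<i> *\<^sub>C b)" and "Z \<equiv> R0 (- \<i>) (a - \<i> *\<^sub>C b)"
  shows "(adj_H_plus S' \<phi> - Rb \<phi>, a + z *\<^sub>C b + z *\<^sub>C X -
      (1 / 2) *\<^sub>C ((a + \<i> *\<^sub>C b + \<i> *\<^sub>C Y) + (a - \<i> *\<^sub>C b - \<i> *\<^sub>C Z))) \<in> rel_adjoint A"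
    and "adj_H_plus S' \<phi> - Rb \<phi> = X - (1 / 2) *\<^sub>C (Y + Z)"
proof -
  have half: "b = (1 / 2) *\<^sub>C (b + b)"
    by (simp add: scaleC_add_left[symmetric] scaleC_add_right scaleC_one)
  \<comment> \<open>Each of the two resolvents contributes one \<open>b\<close>, so the mean
    contains exactly the \<open>b\<close> that \<open>adj_H_plus S' \<phi>\<close> contains, and the
    two cancel.\<close>
  have "Rb \<phi> = (1 / 2) *\<^sub>C ((Y + Z) + (b + b))"
    unfolding R_bold_eq[OF \<phi>] R_tilde_def Y_def Z_def
    using adj_H_plus_represents[OF R0_pair_i(1) r] adj_H_plus_represents[OF R0_pair_i(2) r]
    by (simp add: algebra_simps)
  also have "\<dots> = (1 / 2) *\<^sub>C (Y + Z) + b" using half by (simp add: scaleC_add_right[of _ "Y + Z"])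
  finally show u: "adj_H_plus S' \<phi> - Rb \<phi> = X - (1 / 2) *\<^sub>C (Y + Z)"
    by (simp add: adj_H_plus_represents[OF S r] X_def)
  have X: "(X, a + z *\<^sub>C b + z *\<^sub>C X) \<in> rel_adjoint A"
    unfolding X_def by (rule resolvent_pair_adjoint[OF S])
  have Y: "(Y, a + \<i> *\<^sub>C b + \<i> *\<^sub>C Y) \<in> rel_adjoint A"
    unfolding Y_def by (rule resolvent_pair_adjoint[OF R0_pair_i(1)])
  have Z: "(Z, a - \<i> *\<^sub>C b - \<i> *\<^sub>C Z) \<in> rel_adjoint A"
    using resolvent_pair_adjoint[OF R0_pair_i(2), of "a - \<i> *\<^sub>C b"] unfolding Z_def by simp
  show "(adj_H_plus S' \<phi> - Rb \<phi>, a + z *\<^sub>C b + z *\<^sub>C X -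
      (1 / 2) *\<^sub>C ((a + \<i> *\<^sub>C b + \<i> *\<^sub>C Y) + (a - \<i> *\<^sub>C b - \<i> *\<^sub>C Z))) \<in> rel_adjoint A"
    unfolding u by (intro rel_adjoint_diff X rel_adjoint_scale rel_adjoint_add Y Z)
qed

text \<open>\<open>\<chi>\<close> is evaluated through its pair on the graph element of
  \<open>R_hat_dom\<close>. There \<open>a\<close> has total weight zero, so no term
  \<open>cinner d a\<close> appears; each remaining term has a counterpart when the two functionals
  and \<open>S\<close>, \<open>S'\<close> are exchanged.\<close>

lemma R_hat_pairing:
  assumes S: "resolvent_pair A z S S'" and \<phi>: "\<phi> \<in> minus_space A"
    and r: "represents \<phi> a b" "represents \<chi> c d"
  shows "\<chi> (adj_H_plus S' \<phi> - Rb \<phi>) =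
      cinner (c + cnj z *\<^sub>C d) (S (a + z *\<^sub>C b)) + cnj z * cinner d b
      - cinner (c - \<i> *\<^sub>C d) (R0 \<i> (a + \<i> *\<^sub>C b)) / 2 - cinner (c + \<i> *\<^sub>C d) (R0 (- \<i>) (a - \<i> *\<^sub>C b)) / 2"
  unfolding representsD[OF r(2) R_hat_dom(1)[OF S \<phi> r(1)]]
  unfolding R_hat_dom(2)[OF S \<phi> r(1)]
  by (simp add: cinner_simps field_simps)

text \<open>Term by term in \<open>R_hat_pairing\<close>. The term at \<open>\<i>\<close> on one
  side matches the term at \<open>- \<i>\<close> on the other, which is why the mean has to contain
  both points.\<close>

lemma R_hat_symmetric:
  assumes S: "resolvent_pair A z S S'" and \<phi>: "\<phi> \<in> minus_space A" and \<chi>: "\<chi> \<in> minus_space A"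
  shows "\<chi> (adj_H_plus S' \<phi> - Rb \<phi>) = cnj (\<phi> (adj_H_plus S \<chi> - Rb \<chi>))"
proof -
  obtain a b where r: "represents \<phi> a b" using minus_space_represents[OF \<phi>] .
  obtain c d where r': "represents \<chi> c d" using minus_space_represents[OF \<chi>] .
  have 1: "cinner (c + cnj z *\<^sub>C d) (S (a + z *\<^sub>C b)) = cnj (cinner (a + z *\<^sub>C b) (S' (c + cnj z *\<^sub>C d)))"
    by (subst cinner_commute) (simp add: resolvent_pair_swap[OF S])
  have 2: "cinner (c - \<i> *\<^sub>C d) (R0 \<i> (a + \<i> *\<^sub>C b)) = cnj (cinner (a + \<i> *\<^sub>C b) (R0 (- \<i>) (c - \<i> *\<^sub>C d)))"
    by (subst cinner_commute) (simp add: resolvent_pair_swap[OF R0_pair_i(1)])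
  have 3: "cinner (c + \<i> *\<^sub>C d) (R0 (- \<i>) (a - \<i> *\<^sub>C b)) = cnj (cinner (a - \<i> *\<^sub>C b) (R0 \<i> (c + \<i> *\<^sub>C d)))"
    by (subst cinner_commute) (simp add: resolvent_pair_swap[OF R0_pair_i(2)])
  have 4: "cinner d b = cnj (cinner b d)" by (rule cinner_commute)
  show ?thesis
    unfolding R_hat_pairing[OF S \<phi> r r'] R_hat_pairing[OF resolvent_pair_sym[OF S] \<chi> r' r] 1 2 3 4
    by simp
qed

end

section \<open>Green's identity for the extended boundary triple\<close>

lemma linear_bounded_on_extD:
  assumes G: "linear_bounded_on_ext p A G" and f: "(f, \<phi>) \<in> ext_rel A A"
  shows "G (f, \<phi>) \<in> carrier_vec p"
    and "(g, \<psi>) \<in> ext_rel A A \<Longrightarrow> G (f + g, \<lambda>h. \<phi> h + \<psi> h) = G (f, \<phi>) + G (g, \<psi>)"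
    and "G (c *\<^sub>C f, \<lambda>h. c * \<phi> h) = c \<cdot>\<^sub>v G (f, \<phi>)"
proof -
  have "\<forall>x\<in>ext_rel A A. G x \<in> carrier_vec p"
    using G unfolding linear_bounded_on_ext_def by (elim conjE)
  then show "G (f, \<phi>) \<in> carrier_vec p" using f by blast
  have "\<forall>(f, \<phi>)\<in>ext_rel A A. \<forall>(g, \<psi>)\<in>ext_rel A A.
        G (f + g, \<lambda>h. \<phi> h + \<psi> h) = G (f, \<phi>) + G (g, \<psi>)"
    using G unfolding linear_bounded_on_ext_def by (elim conjE)
  from bspec[OF bspec[OF this f, unfolded prod.case], of "(g, \<psi>)"]
  show "(g, \<psi>) \<in> ext_rel A A \<Longrightarrow> G (f + g, \<lambda>h. \<phi> h + \<psi> h) = G (f, \<phi>) + G (g, \<psi>)" by simp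
  have "\<forall>(f, \<phi>)\<in>ext_rel A A. \<forall>c. G (c *\<^sub>C f, \<lambda>h. c * \<phi> h) = c \<cdot>\<^sub>v G (f, \<phi>)"
    using G unfolding linear_bounded_on_ext_def by (elim conjE)
  from bspec[OF this f] show "G (c *\<^sub>C f, \<lambda>h. c * \<phi> h) = c \<cdot>\<^sub>v G (f, \<phi>)" by simp
qed

locale extended_boundary = boundary A p \<Gamma>0 \<Gamma>1
  for A :: "('h :: complex_hilbert \<times> 'h) set" and p \<Gamma>0 \<Gamma>1 +
  fixes E0 E1 :: "'h \<times> ('h \<Rightarrow> complex) \<Rightarrow> complex vec"
  assumes extended: "extended_boundary_triple p A \<Gamma>0 \<Gamma>1 E0 E1"
begin

lemma E_linear: "linear_bounded_on_ext p A E0" "linear_bounded_on_ext p A E1"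
  by (rule conjunct1[OF extended[unfolded extended_boundary_triple_def]])
    (rule conjunct1[OF conjunct2[OF extended[unfolded extended_boundary_triple_def]]])

lemmas E_carrier = linear_bounded_on_extD(1)[OF E_linear(1)] linear_bounded_on_extD(1)[OF E_linear(2)]
lemmas E_add = linear_bounded_on_extD(2)[OF E_linear(1)] linear_bounded_on_extD(2)[OF E_linear(2)]
lemmas E_scale = linear_bounded_on_extD(3)[OF E_linear(1)] linear_bounded_on_extD(3)[OF E_linear(2)]

lemma E_Gamma:
  assumes f: "(f, f') \<in> rel_adjoint A"
  shows "E0 (f, emb A f') = \<Gamma>0 (f, f')" "E1 (f, emb A f') = \<Gamma>1 (f, f')"
proof -
  have "\<forall>(f, f')\<in>rel_adjoint A. E0 (f, emb A f') = \<Gamma>0 (f, f') \<and> E1 (f, emb A f') = \<Gamma>1 (f, f')"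
    using extended unfolding extended_boundary_triple_def by (elim conjE)
  from bspec[OF this f] show "E0 (f, emb A f') = \<Gamma>0 (f, f')" "E1 (f, emb A f') = \<Gamma>1 (f, f')" by auto
qed

lemma E_R0:
  assumes z: "z \<in> resolvent_set A0" and \<phi>: "\<phi> \<in> minus_space A"
  shows "E0 (R_tilde R0 z \<phi>, \<lambda>h. \<phi> h + emb A (z *\<^sub>C R_tilde R0 z \<phi>) h) = 0\<^sub>v p"
    and "E1 (R_tilde R0 z \<phi>, \<lambda>h. \<phi> h + emb A (z *\<^sub>C R_tilde R0 z \<phi>) h) =
      adj_C_plus p (gamma_field A \<Gamma>0 (cnj z)) \<phi>"
    and "(R_tilde R0 z \<phi>, \<lambda>h. \<phi> h + emb A (z *\<^sub>C R_tilde R0 z \<phi>) h) \<in> ext_rel A A"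
proof -
  have "\<forall>z\<in>resolvent_set A0. \<forall>\<phi>\<in>minus_space A.
        let u = R_tilde R0 z \<phi>;
            x = (u, \<lambda>h. \<phi> h + emb A (z *\<^sub>C u) h)
        in E0 x = 0\<^sub>v p \<and> E1 x = adj_C_plus p (gamma_field A \<Gamma>0 (cnj z)) \<phi>"
    using extended unfolding extended_boundary_triple_def by (elim conjE)
  from bspec[OF bspec[OF this z] \<phi>]
  show "E0 (R_tilde R0 z \<phi>, \<lambda>h. \<phi> h + emb A (z *\<^sub>C R_tilde R0 z \<phi>) h) = 0\<^sub>v p"
    and "E1 (R_tilde R0 z \<phi>, \<lambda>h. \<phi> h + emb A (z *\<^sub>C R_tilde R0 z \<phi>) h) =
      adj_C_plus p (gamma_field A \<Gamma>0 (cnj z)) \<phi>"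
    by (simp_all add: Let_def)
  show "(R_tilde R0 z \<phi>, \<lambda>h. \<phi> h + emb A (z *\<^sub>C R_tilde R0 z \<phi>) h) \<in> ext_rel A A"
    unfolding R_tilde_def by (rule adj_H_plus_ext_rel[OF R0_pair[OF z] \<phi>])
qed

text \<open>The value of \<open>E1\<close> at the mean element over \<open>Rb \<phi>\<close>; the
  extended resolvent at \<open>\<i>\<close> contributes the gamma field at \<open>- \<i>\<close>,
  and conversely.\<close>

definition gamma_mean :: "('h \<Rightarrow> complex) \<Rightarrow> complex vec" where
  "gamma_mean \<phi> = (1 / 2) \<cdot>\<^sub>v (adj_C_plus p (gamma_field A \<Gamma>0 (- \<i>)) \<phi> + adj_C_plus p (gamma_field A \<Gamma>0 \<i>) \<phi>)"

lemma gamma_mean_carrier: "\<phi> \<in> minus_space A \<Longrightarrow> gamma_mean \<phi> \<in> carrier_vec p"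
  unfolding gamma_mean_def using gamma_adjoint(1)[OF i_resolvent(1)] gamma_adjoint(1)[OF i_resolvent(2)] by simp

lemma mean_element:
  assumes \<phi>: "\<phi> \<in> minus_space A"
  shows "(Rb \<phi>, \<lambda>h. \<phi> h + emb A (Yb \<phi>) h) \<in> ext_rel A A"
    and "E0 (Rb \<phi>, \<lambda>h. \<phi> h + emb A (Yb \<phi>) h) = 0\<^sub>v p"
    and "E1 (Rb \<phi>, \<lambda>h. \<phi> h + emb A (Yb \<phi>) h) = gamma_mean \<phi>"
proof -
  let ?u = "\<lambda>w. R_tilde R0 w \<phi>"
  let ?x = "\<lambda>w h. \<phi> h + emb A (w *\<^sub>C ?u w) h"
  note e1 = E_R0[OF i_resolvent(1) \<phi>] and e2 = E_R0[OF i_resolvent(2) \<phi>]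
  have eq: "(Rb \<phi>, \<lambda>h. \<phi> h + emb A (Yb \<phi>) h) =
      ((1 / 2) *\<^sub>C (?u \<i> + ?u (- \<i>)), \<lambda>h. 1 / 2 * (?x \<i> h + ?x (- \<i>) h))"
    unfolding R_bold_eq[OF \<phi>] Yb_def by (simp add: emb_simps fun_eq_iff field_simps)
  note sum = ext_rel_add[OF e1(3) e2(3)]
  show "(Rb \<phi>, \<lambda>h. \<phi> h + emb A (Yb \<phi>) h) \<in> ext_rel A A"
    unfolding eq by (rule ext_rel_scale[OF sum])
  show "E0 (Rb \<phi>, \<lambda>h. \<phi> h + emb A (Yb \<phi>) h) = 0\<^sub>v p"
    unfolding eq E_scale(1)[OF sum] E_add(1)[OF e1(3) e2(3)] e1(1) e2(1) by (intro eq_vecI) auto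
  show "E1 (Rb \<phi>, \<lambda>h. \<phi> h + emb A (Yb \<phi>) h) = gamma_mean \<phi>"
    unfolding eq E_scale(2)[OF sum] E_add(2)[OF e1(3) e2(3)] e1(2) e2(2) gamma_mean_def by simp
qed

text \<open>Green's identity between the mean element and the graph of the adjoint, meaningful since
  \<open>b\<close> is in the positive space: \<open>gamma_adjoint_Gamma0\<close> averaged over the
  two points.\<close>

lemma gamma_mean_Gamma0:
  assumes \<phi>: "\<phi> \<in> minus_space A" and b: "(b, b') \<in> rel_adjoint A"
  shows "gamma_mean \<phi> \<bullet>c \<Gamma>0 (b, b') = \<phi> b + cinner (Yb \<phi>) b - cinner (Rb \<phi>) b'"
proof -
  note g1 = gamma_adjoint(1)[OF i_resolvent(1) \<phi>] and g2 = gamma_adjoint(1)[OF i_resolvent(2) \<phi>]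
  have "gamma_mean \<phi> \<bullet>c \<Gamma>0 (b, b') =
      1 / 2 * (adj_C_plus p (gamma_field A \<Gamma>0 (- \<i>)) \<phi> \<bullet>c \<Gamma>0 (b, b') +
        adj_C_plus p (gamma_field A \<Gamma>0 \<i>) \<phi> \<bullet>c \<Gamma>0 (b, b'))"
    unfolding gamma_mean_def using g1 g2 Gamma_carrier(1)[OF b]
    by (simp add: cprod_add_left[of _ p] cprod_scale_left[of _ p])
  moreover have "adj_C_plus p (gamma_field A \<Gamma>0 (- \<i>)) \<phi> \<bullet>c \<Gamma>0 (b, b') =
      \<phi> b + \<i> * cinner (R_tilde R0 \<i> \<phi>) b - cinner (R_tilde R0 \<i> \<phi>) b'"
    using gamma_adjoint_Gamma0[OF i_resolvent(1) \<phi> b] by simp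
  moreover have "adj_C_plus p (gamma_field A \<Gamma>0 \<i>) \<phi> \<bullet>c \<Gamma>0 (b, b') =
      \<phi> b - \<i> * cinner (R_tilde R0 (- \<i>) \<phi>) b - cinner (R_tilde R0 (- \<i>) \<phi>) b'"
    using gamma_adjoint_Gamma0[OF i_resolvent(2) \<phi> b] by simp
  ultimately show ?thesis
    by (simp only:) (simp add: R_bold_eq[OF \<phi>] Yb_def cinner_simps field_simps)
qed

text \<open>Subtracting the mean element with the same \<open>\<phi>\<close> leaves only a vector of
  the middle space in the second component, hence an element of the adjoint of \<open>A\<close>,
  where the original boundary maps apply.\<close>

lemma ext_rel_decomposition:
  assumes \<phi>: "\<phi> \<in> minus_space A" and f: "(f, \<lambda>h. \<phi> h + emb A k h) \<in> ext_rel A A"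
  shows "(f - Rb \<phi>, k - Yb \<phi>) \<in> rel_adjoint A"
    and "E0 (f, \<lambda>h. \<phi> h + emb A k h) = \<Gamma>0 (f - Rb \<phi>, k - Yb \<phi>)"
    and "E1 (f, \<lambda>h. \<phi> h + emb A k h) = gamma_mean \<phi> + \<Gamma>1 (f - Rb \<phi>, k - Yb \<phi>)"
proof -
  note m = mean_element[OF \<phi>]
  have "(f - Rb \<phi>, emb A (k - Yb \<phi>)) = (f + (- 1) *\<^sub>C Rb \<phi>,
      \<lambda>h. (\<phi> h + emb A k h) + (- 1) * (\<phi> h + emb A (Yb \<phi>) h))"
    by (simp add: emb_simps fun_eq_iff)
  also have "\<dots> \<in> ext_rel A A" by (rule ext_rel_add[OF f ext_rel_scale[OF m(1)]])
  finally have d: "(f - Rb \<phi>, emb A (k - Yb \<phi>)) \<in> ext_rel A A" .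
  then show a: "(f - Rb \<phi>, k - Yb \<phi>) \<in> rel_adjoint A" by (simp add: ext_rel_emb_iff)
  have eq: "(f, \<lambda>h. \<phi> h + emb A k h) = (Rb \<phi> + (f - Rb \<phi>),
      \<lambda>h. (\<phi> h + emb A (Yb \<phi>) h) + emb A (k - Yb \<phi>) h)"
    by (simp add: emb_simps fun_eq_iff)
  show "E0 (f, \<lambda>h. \<phi> h + emb A k h) = \<Gamma>0 (f - Rb \<phi>, k - Yb \<phi>)"
    unfolding eq E_add(1)[OF m(1) d] m(2) E_Gamma[OF a] using Gamma_carrier[OF a] by simp
  show "E1 (f, \<lambda>h. \<phi> h + emb A k h) = gamma_mean \<phi> + \<Gamma>1 (f - Rb \<phi>, k - Yb \<phi>)"
    unfolding eq E_add(2)[OF m(1) d] m(3) E_Gamma[OF a] ..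
qed

text \<open>Formally \<open>(\<phi> + k, g) - (f, \<chi> + l)\<close>; the pairings with the functionals only make sense
  after subtracting the means.\<close>

lemma extended_Green:
  assumes \<phi>: "\<phi> \<in> minus_space A" and f: "(f, \<lambda>h. \<phi> h + emb A k h) \<in> ext_rel A A"
    and \<chi>: "\<chi> \<in> minus_space A" and g: "(g, \<lambda>h. \<chi> h + emb A l h) \<in> ext_rel A A"
  shows "E1 (f, \<lambda>h. \<phi> h + emb A k h) \<bullet>c E0 (g, \<lambda>h. \<chi> h + emb A l h)
      - E0 (f, \<lambda>h. \<phi> h + emb A k h) \<bullet>c E1 (g, \<lambda>h. \<chi> h + emb A l h) =
    \<phi> (g - Rb \<chi>) - cnj (\<chi> (f - Rb \<phi>)) + cinner k g - cinner f l"
proof -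
  define a a' b b' where ab: "a = f - Rb \<phi>" "a' = k - Yb \<phi>" "b = g - Rb \<chi>" "b' = l - Yb \<chi>"
  note df = ext_rel_decomposition[OF \<phi> f, folded ab] and dg = ext_rel_decomposition[OF \<chi> g, folded ab]
  note c = Gamma_carrier[OF df(1)] Gamma_carrier[OF dg(1)] gamma_mean_carrier[OF \<phi>] gamma_mean_carrier[OF \<chi>]
  have "\<Gamma>0 (a, a') \<bullet>c gamma_mean \<chi> = cnj (gamma_mean \<chi> \<bullet>c \<Gamma>0 (a, a'))"
    by (rule cprod_commute) (use c in auto)
  moreover have "cnj (cinner (Yb \<chi>) a) = cinner a (Yb \<chi>)" "cnj (cinner (Rb \<chi>) a') = cinner a' (Rb \<chi>)"
    by (metis cinner_commute)+
  ultimately have 1: "\<Gamma>0 (a, a') \<bullet>c gamma_mean \<chi> = cnj (\<chi> a) + cinner a (Yb \<chi>) - cinner a' (Rb \<chi>)"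
    by (simp add: gamma_mean_Gamma0[OF \<chi> df(1)])
  \<comment> \<open>\<open>E0\<close> vanishes on means, so no product joins two means: what remains
    is mean against adjoint, in either order, and adjoint against adjoint.\<close>
  have "(gamma_mean \<phi> + \<Gamma>1 (a, a')) \<bullet>c \<Gamma>0 (b, b') - \<Gamma>0 (a, a') \<bullet>c (gamma_mean \<chi> + \<Gamma>1 (b, b')) =
      gamma_mean \<phi> \<bullet>c \<Gamma>0 (b, b') - \<Gamma>0 (a, a') \<bullet>c gamma_mean \<chi> +
      (\<Gamma>1 (a, a') \<bullet>c \<Gamma>0 (b, b') - \<Gamma>0 (a, a') \<bullet>c \<Gamma>1 (b, b'))"
    using c by (simp add: cprod_add_left[of _ p] cprod_add_right[of _ p])
  also have "\<dots> = \<phi> b + cinner (Yb \<phi>) b - cinner (Rb \<phi>) b'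
      - (cnj (\<chi> a) + cinner a (Yb \<chi>) - cinner a' (Rb \<chi>)) + (cinner a' b - cinner a b')"
    unfolding 1 gamma_mean_Gamma0[OF \<phi> dg(1)] Green[OF df(1) dg(1)] ..
  \<comment> \<open>After expanding \<open>k\<close>, \<open>l\<close>, \<open>f\<close>,
    \<open>g\<close> into mean and remainder, the two sides differ only by the inner products
    between means, and these cancel by \<open>Yb_R_bold\<close>.\<close>
  also have "\<dots> = \<phi> b - cnj (\<chi> a) + cinner k g - cinner f l"
    using Yb_R_bold[OF \<phi> \<chi>] by (simp add: ab cinner_simps)
  finally show ?thesis unfolding df(2,3) dg(2,3) by (simp add: ab)
qed

end

section \<open>The gauge and the adjoint of \<open>P\<close>\<close>

lemma smult_zero_vec: "c \<cdot>\<^sub>v 0\<^sub>v n = (0\<^sub>v n :: complex vec)"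
  by (intro eq_vecI) auto

lemma linear_functional_csum:
  fixes t :: "'a :: complex_hilbert \<Rightarrow> complex" and n :: nat
  assumes "\<And>x y. t (x + y) = t x + t y" and "\<And>c x. t (c *\<^sub>C x) = c * t x"
  shows "t (\<Sum>j<n. c j *\<^sub>C e j) = (\<Sum>j<n. c j * t (e j))"
proof (induction n)
  case 0
  have "t (0 *\<^sub>C 0) = 0" by (simp only: assms(2)) simp
  then show ?case by simp
qed (simp add: assms)

lemma cinner_csum_left: "cinner (\<Sum>j<(n::nat). c j *\<^sub>C e j) x = (\<Sum>j<n. c j * cinner (e j) x)"
  by (rule linear_functional_csum) (simp_all add: cinner_simps)

text \<open>A linear map onto \<open>C^p\<close> with closed kernel has an adjoint: solve the Gram system of a basis
  of the orthogonal complement of the kernel.\<close>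

lemma finite_rank_adjoint:
  fixes T :: "'a :: complex_hilbert \<Rightarrow> complex vec"
  assumes T: "\<And>f. T f \<in> carrier_vec p" and add: "\<And>f g. T (f + g) = T f + T g"
    and scale: "\<And>c f. T (c *\<^sub>C f) = c \<cdot>\<^sub>v T f"
    and onto: "\<And>\<xi>. \<xi> \<in> carrier_vec p \<Longrightarrow> \<exists>f. T f = \<xi>"
    and K: "closed {f. T f = 0\<^sub>v p}" and \<xi>: "\<xi> \<in> carrier_vec p"
  obtains h where "\<And>f. cinner f h = T f \<bullet>c \<xi>"
proof -
  define K where "K = {f. T f = 0\<^sub>v p}"
  have "0 \<cdot>\<^sub>v T 0 = 0\<^sub>v p" using T[of 0] by (intro eq_vecI) auto
  then have "T 0 = 0\<^sub>v p" using scale[of 0 0] by simp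
  then have subK: "complex_vs.subspace K"
    unfolding K_def by (intro complex_vs.subspaceI) (auto simp: add scale)
  have "\<exists>f. T f = \<eta> \<and> (\<forall>k\<in>K. cinner f k = 0)" if \<eta>: "\<eta> \<in> carrier_vec p" for \<eta>
  proof -
    obtain f where f: "T f = \<eta>" using onto[OF \<eta>] by blast
    obtain k where k: "k \<in> K" "\<And>m. m \<in> K \<Longrightarrow> cinner (f - k) m = 0"
      using projection_exists[OF subK K[folded K_def], of f] by blast
    have "\<eta> = T (f - k) + T k" using add[of "f - k" k] f by simp
    then have "T (f - k) = \<eta>" using k(1) T[of "f - k"] by (simp add: K_def)
    then show ?thesis using k(2) by blast
  qed
  then have "\<forall>j. \<exists>f. T f = unit_vec p j \<and> (\<forall>k\<in>K. cinner f k = 0)" by simp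
  then obtain e where e: "\<And>j. T (e j) = unit_vec p j" "\<And>j k. k \<in> K \<Longrightarrow> cinner (e j) k = 0"
    by metis
  define X where "X c = (\<Sum>j<p. c $ j *\<^sub>C e j)" for c :: "complex vec"
  have TX: "T (X c) = c" if c: "c \<in> carrier_vec p" for c
  proof (rule eq_vecI)
    fix i assume "i < dim_vec c"
    then have i: "i < p" using c by simp
    have dimT: "dim_vec (T f) = p" for f using T[of f] by simp
    have "T (X c) $ i = (\<Sum>j<p. c $ j * T (e j) $ i)"
      unfolding X_def by (rule linear_functional_csum) (use i dimT in \<open>simp_all add: add scale\<close>)
    also have "\<dots> = (\<Sum>j<p. if j = i then c $ j else 0)"
      using i by (intro sum.cong) (auto simp: e(1))
    finally show "T (X c) $ i = c $ i" using i by simp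
  qed (use T[of "X c"] c in simp)
  have X_orth: "cinner (X c) k = 0" if "k \<in> K" for c k
    unfolding X_def cinner_csum_left using e(2)[OF that] by simp
  define G where "G = mat p p (\<lambda>(i, j). cinner (e j) (e i))"
  have G: "G \<in> carrier_mat p p" by (simp add: G_def)
  have Gi: "(G *\<^sub>v c) $ i = cinner (X c) (e i)" if "i < p" "c \<in> carrier_vec p" for i c
    using that unfolding X_def cinner_csum_left G_def
    by (simp add: scalar_prod_def atLeast0LessThan mult.commute)
  obtain N where N: "N \<in> carrier_mat p p" "G * N = 1\<^sub>m p"
  proof (rule injective_mat_inverse[OF G])
    fix c assume c: "c \<in> carrier_vec p" "G *\<^sub>v c = 0\<^sub>v p"
    have 0: "cinner (X c) (e j) = 0" if "j < p" for j using Gi[OF that c(1)] c(2) that by simp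
    have "cinner (e j) (X c) = 0" if "j < p" for j using 0[OF that] by (subst cinner_commute) simp
    then have "cinner (X c) (X c) = 0"
      by (subst X_def) (simp add: cinner_csum_left)
    then have "X c = 0" by simp
    then have "T 0 = c" using TX[OF c(1)] by simp
    then show "c = 0\<^sub>v p" using \<open>T 0 = 0\<^sub>v p\<close> by simp
  qed (rule that)
  define h where "h = X (N *\<^sub>v \<xi>)"
  have Nc: "N *\<^sub>v \<xi> \<in> carrier_vec p" using N(1) \<xi> by simp
  have he: "cinner h (e i) = \<xi> $ i" if i: "i < p" for i
  proof -
    have "G *\<^sub>v (N *\<^sub>v \<xi>) = \<xi>" using G N \<xi> by (simp flip: assoc_mult_mat_vec)
    then show ?thesis using Gi[OF i Nc] by (simp add: h_def)
  qed
  have "cinner f h = T f \<bullet>c \<xi>" for f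
  proof -
    \<comment> \<open>\<open>f\<close> and \<open>X (T f)\<close> have the same image, so they
      differ by a kernel vector, which is orthogonal to \<open>h\<close>; the rest is a finite sum
      of the prescribed values \<open>cinner (e j) h\<close>.\<close>
    have "T f = T (f - X (T f)) + T f"
      using add[of "f - X (T f)" "X (T f)"] TX[OF T[of f]] by simp
    then have "f - X (T f) \<in> K" unfolding K_def using vec_add_self_zero T by blast
    then have "cinner h (f - X (T f)) = 0" unfolding h_def by (rule X_orth)
    then have "cinner h f = cinner h (X (T f))" by (simp add: cinner_diff_right)
    then have "cinner f h = cinner (X (T f)) h" by (subst (1 2) cinner_commute) simp
    also have "\<dots> = (\<Sum>j<p. T f $ j * cinner (e j) h)" unfolding X_def by (rule cinner_csum_left)
    also have "\<dots> = (\<Sum>j<p. T f $ j * cnj (\<xi> $ j))"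
      by (intro sum.cong refl arg_cong2[of _ _ _ _ "(*)"]) (subst cinner_commute, simp add: he)
    finally show ?thesis by (simp add: cprod_sum[OF \<xi>])
  qed
  then show thesis by (rule that)
qed

lemma adj_C_minus:
  assumes "\<And>x y. x \<in> carrier_vec p \<Longrightarrow> y \<in> carrier_vec p \<Longrightarrow> L (x + y) h = L x h + L y h"
    and "\<And>c x. x \<in> carrier_vec p \<Longrightarrow> L (c \<cdot>\<^sub>v x) h = c * L x h"
  shows "adj_C_minus p L h \<in> carrier_vec p"
    and "\<xi> \<in> carrier_vec p \<Longrightarrow> adj_C_minus p L h \<bullet>c \<xi> = cnj (L \<xi> h)"
proof -
  let ?v = "vec p (\<lambda>j. cnj (L (unit_vec p j) h))"
  have v: "?v \<bullet>c \<xi> = cnj (L \<xi> h)" if "\<xi> \<in> carrier_vec p" for \<xi>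
    by (rule conj_linear_functional_cprod[OF _ _ that]) (simp_all add: assms)
  have "adj_C_minus p L h = ?v"
    unfolding adj_C_minus_def
    by (rule the_equality) (use v in \<open>auto intro!: cprod_ext[of _ p]\<close>)
  then show "adj_C_minus p L h \<in> carrier_vec p"
    and "\<xi> \<in> carrier_vec p \<Longrightarrow> adj_C_minus p L h \<bullet>c \<xi> = cnj (L \<xi> h)" using v by auto
qed

locale gauge = closed_symmetric A for A :: "('h :: complex_hilbert \<times> 'h) set" +
  fixes p :: nat and \<LL> :: "('h \<Rightarrow> complex) set" and L :: "complex vec \<Rightarrow> 'h \<Rightarrow> complex"
  assumes minus_sub: "minus_subspace A \<LL>" and L_bij: "linear_bij_minus p L \<LL>"
begin

abbreviation "P \<equiv> P_op p A \<LL> L"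

lemma L_in: "\<xi> \<in> carrier_vec p \<Longrightarrow> L \<xi> \<in> \<LL>"
  using L_bij unfolding linear_bij_minus_def bij_betw_def by blast

lemma L_minus: "\<xi> \<in> carrier_vec p \<Longrightarrow> L \<xi> \<in> minus_space A"
  using L_in minus_sub unfolding minus_subspace_def by blast

lemma L_onto: "\<phi> \<in> \<LL> \<Longrightarrow> \<exists>\<xi>\<in>carrier_vec p. \<phi> = L \<xi>"
  using L_bij unfolding linear_bij_minus_def bij_betw_def by blast

lemma L_add: "\<xi> \<in> carrier_vec p \<Longrightarrow> \<eta> \<in> carrier_vec p \<Longrightarrow> L (\<xi> + \<eta>) = (\<lambda>h. L \<xi> h + L \<eta> h)"
  and L_scale: "\<xi> \<in> carrier_vec p \<Longrightarrow> L (c \<cdot>\<^sub>v \<xi>) = (\<lambda>h. c * L \<xi> h)"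
  using L_bij unfolding linear_bij_minus_def by blast+

lemma L_adj: "adj_C_minus p L h \<in> carrier_vec p"
  "\<xi> \<in> carrier_vec p \<Longrightarrow> adj_C_minus p L h \<bullet>c \<xi> = cnj (L \<xi> h)"
  by (rule adj_C_minus; simp add: L_add L_scale)+

section \<open>The range of the extended relation and the skew projection\<close>

lemma ran_ext_add:
  assumes "x \<in> ran_ext A z" "y \<in> ran_ext A z"
  shows "(\<lambda>h. x h + y h) \<in> ran_ext A z"
proof -
  obtain f \<phi> g \<psi> where
    "x = (\<lambda>h. \<phi> h - emb A (z *\<^sub>C f) h)" "(f, \<phi>) \<in> ext_rel A (rel_adjoint A)"
    "y = (\<lambda>h. \<psi> h - emb A (z *\<^sub>C g) h)" "(g, \<psi>) \<in> ext_rel A (rel_adjoint A)"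
    using assms unfolding ran_ext_def by blast
  then show ?thesis unfolding ran_ext_def
    by (intro CollectI exI[of _ "f + g"] exI[of _ "\<lambda>h. \<phi> h + \<psi> h"])
      (auto simp: emb_simps scaleC_add_right ext_rel_add)
qed

lemma ran_ext_scale:
  assumes "x \<in> ran_ext A z"
  shows "(\<lambda>h. c * x h) \<in> ran_ext A z"
proof -
  obtain f \<phi> where
    "x = (\<lambda>h. \<phi> h - emb A (z *\<^sub>C f) h)" "(f, \<phi>) \<in> ext_rel A (rel_adjoint A)"
    using assms unfolding ran_ext_def by blast
  then show ?thesis unfolding ran_ext_def
    by (intro CollectI exI[of _ "c *\<^sub>C f"] exI[of _ "\<lambda>h. c * \<phi> h"])
      (auto simp: emb_simps scaleC_scaleC right_diff_distrib ext_rel_scale)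
qed

lemma ran_ext_zero: "(\<lambda>h. 0) \<in> ran_ext A z"
proof -
  have "(0, \<lambda>h. 0) \<in> ext_rel A (rel_adjoint A)"
    using minus_space_scaleI[OF emb_minus_space, of 0 0] by (simp add: in_ext_rel)
  then show ?thesis unfolding ran_ext_def
    by (intro CollectI exI[of _ 0] exI[of _ "\<lambda>h. 0"]) (simp add: emb_simps)
qed

text \<open>The extended relation gives \<open>\<phi> n = cinner f (cnj z *\<^sub>C n)\<close>,
  exactly the subtracted term. So a defect vector at \<open>cnj z\<close> sees only the
  \<open>\<LL>\<close> part of a gauge decomposition.\<close>

lemma ran_ext_defect:
  assumes "x \<in> ran_ext A z" "(n, cnj z *\<^sub>C n) \<in> rel_adjoint A"
  shows "x n = 0"
proof -
  obtain f \<phi> where "x = (\<lambda>h. \<phi> h - emb A (z *\<^sub>C f) h)" "(f, \<phi>) \<in> ext_rel A (rel_adjoint A)"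
    using assms(1) unfolding ran_ext_def by blast
  then show ?thesis
    using assms(2) emb_dom_adjoint[OF assms(2)] by (auto simp: in_ext_rel cinner_simps)
qed

lemma gauge_decomposition:
  assumes z: "z \<in> gauge_set A \<LL>" and \<phi>: "\<phi> \<in> minus_space A"
  shows "\<exists>!xy. fst xy \<in> ran_ext A z \<and> snd xy \<in> \<LL> \<and> \<phi> = (\<lambda>h. fst xy h + snd xy h)"
  using z \<phi> unfolding gauge_set_def by blast

lemma skew_proj_eq:
  assumes z: "z \<in> gauge_set A \<LL>" and x: "x \<in> ran_ext A z" and \<xi>: "\<xi> \<in> carrier_vec p"
  shows "skew_proj A \<LL> z (\<lambda>h. x h + L \<xi> h) = L \<xi>"
  unfolding skew_proj_def
proof (rule the_equality)
  show "L \<xi> \<in> \<LL> \<and> (\<exists>x'\<in>ran_ext A z. (\<lambda>h. x h + L \<xi> h) = (\<lambda>h. x' h + L \<xi> h))"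
    using x L_in[OF \<xi>] by blast
  have "x \<in> minus_space A" using z x unfolding gauge_set_def by blast
  then have "(\<lambda>h. x h + L \<xi> h) \<in> minus_space A" using minus_space_addI L_minus[OF \<xi>] by blast
  from gauge_decomposition[OF z this] obtain w where
    w: "\<And>v. fst v \<in> ran_ext A z \<and> snd v \<in> \<LL> \<and> (\<lambda>h. x h + L \<xi> h) = (\<lambda>h. fst v h + snd v h) \<Longrightarrow> v = w"
    by (elim ex1E) blast
  fix y assume "y \<in> \<LL> \<and> (\<exists>x'\<in>ran_ext A z. (\<lambda>h. x h + L \<xi> h) = (\<lambda>h. x' h + y h))"
  then obtain x' where "y \<in> \<LL>" "x' \<in> ran_ext A z" "(\<lambda>h. x h + L \<xi> h) = (\<lambda>h. x' h + y h)" by blast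
  then have "(x', y) = w" by (intro w) simp
  moreover have "(x, L \<xi>) = w" using x L_in[OF \<xi>] by (intro w) simp
  ultimately show "y = L \<xi>" by auto
qed

lemma P_eqI:
  assumes z: "z \<in> gauge_set A \<LL>" and x: "x \<in> ran_ext A z" and \<xi>: "\<xi> \<in> carrier_vec p"
    and eq: "\<phi> = (\<lambda>h. x h + L \<xi> h)"
  shows "P z \<phi> = \<xi>"
proof -
  have "inj_on L (carrier_vec p)" using L_bij unfolding linear_bij_minus_def bij_betw_def by blast
  then show ?thesis unfolding P_op_def eq skew_proj_eq[OF z x \<xi>] by (rule inv_into_f_f[OF _ \<xi>])
qed

lemma P_decomposition:
  assumes z: "z \<in> gauge_set A \<LL>" and \<phi>: "\<phi> \<in> minus_space A"
  obtains x where "x \<in> ran_ext A z" "\<phi> = (\<lambda>h. x h + L (P z \<phi>) h)" "P z \<phi> \<in> carrier_vec p"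
    "skew_proj A \<LL> z \<phi> = L (P z \<phi>)"
proof -
  obtain x y where xy: "x \<in> ran_ext A z" "y \<in> \<LL>" "\<phi> = (\<lambda>h. x h + y h)"
    using gauge_decomposition[OF z \<phi>] by (elim ex1E) blast
  obtain \<xi> where \<xi>: "\<xi> \<in> carrier_vec p" "y = L \<xi>" using L_onto[OF xy(2)] by blast
  have "P z \<phi> = \<xi>" by (rule P_eqI[OF z xy(1) \<xi>(1)]) (simp add: xy \<xi>)
  then show thesis using that[OF xy(1)] xy(3) \<xi> skew_proj_eq[OF z xy(1) \<xi>(1)] by simp
qed

lemma P_carrier: "z \<in> gauge_set A \<LL> \<Longrightarrow> \<phi> \<in> minus_space A \<Longrightarrow> P z \<phi> \<in> carrier_vec p"
  by (erule P_decomposition)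

lemma skew_proj_P: "z \<in> gauge_set A \<LL> \<Longrightarrow> \<phi> \<in> minus_space A \<Longrightarrow> skew_proj A \<LL> z \<phi> = L (P z \<phi>)"
  by (erule P_decomposition)

lemma P_add:
  assumes z: "z \<in> gauge_set A \<LL>" and \<phi>: "\<phi> \<in> minus_space A" and \<psi>: "\<psi> \<in> minus_space A"
  shows "P z (\<lambda>h. \<phi> h + \<psi> h) = P z \<phi> + P z \<psi>"
proof -
  obtain x where x: "x \<in> ran_ext A z" "\<phi> = (\<lambda>h. x h + L (P z \<phi>) h)" "P z \<phi> \<in> carrier_vec p"
    by (rule P_decomposition[OF z \<phi>])
  obtain y where y: "y \<in> ran_ext A z" "\<psi> = (\<lambda>h. y h + L (P z \<psi>) h)" "P z \<psi> \<in> carrier_vec p"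
    by (rule P_decomposition[OF z \<psi>])
  have "\<phi> h + \<psi> h = (x h + y h) + L (P z \<phi> + P z \<psi>) h" for h
    using fun_cong[OF x(2), of h] fun_cong[OF y(2), of h] by (simp add: L_add x(3) y(3))
  then show ?thesis by (intro P_eqI[OF z ran_ext_add[OF x(1) y(1)]]) (use x y in auto)
qed

lemma P_scale:
  assumes z: "z \<in> gauge_set A \<LL>" and \<phi>: "\<phi> \<in> minus_space A"
  shows "P z (\<lambda>h. c * \<phi> h) = c \<cdot>\<^sub>v P z \<phi>"
proof -
  obtain x where x: "x \<in> ran_ext A z" "\<phi> = (\<lambda>h. x h + L (P z \<phi>) h)" "P z \<phi> \<in> carrier_vec p"
    by (rule P_decomposition[OF z \<phi>])
  have "c * \<phi> h = c * x h + L (c \<cdot>\<^sub>v P z \<phi>) h" for h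
    using fun_cong[OF x(2), of h] by (simp add: L_scale x(3) distrib_left)
  then show ?thesis by (intro P_eqI[OF z ran_ext_scale[OF x(1)]]) (use x in auto)
qed

lemma P_L: "z \<in> gauge_set A \<LL> \<Longrightarrow> \<xi> \<in> carrier_vec p \<Longrightarrow> P z (L \<xi>) = \<xi>"
  by (rule P_eqI[OF _ ran_ext_zero]) auto

lemma P_ran_ext:
  assumes z: "z \<in> gauge_set A \<LL>" and x: "x \<in> ran_ext A z"
  shows "P z x = 0\<^sub>v p"
proof (rule P_eqI[OF z x])
  have "L (0\<^sub>v p) h = 0" for h
    using fun_cong[OF L_scale[of "0\<^sub>v p" 0], of h] by (simp add: smult_zero_vec)
  then show "x = (\<lambda>h. x h + L (0\<^sub>v p) h)" by simp
qed simp

text \<open>If an embedded vector lies in the extended range, the functional of the witness is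
  itself an embedded vector, so the witness belongs to the double adjoint of \<open>A\<close>, which
  is \<open>A\<close>. Hence the kernel of \<open>P z\<close> on the middle space is closed at
  regular points.\<close>

lemma P_emb_zero_iff:
  assumes z: "z \<in> gauge_set A \<LL>"
  shows "P z (emb A f) = 0\<^sub>v p \<longleftrightarrow> f \<in> ran_shift A z"
proof
  assume "P z (emb A f) = 0\<^sub>v p"
  moreover have "L (0\<^sub>v p) h = 0" for h
    using fun_cong[OF L_scale[of "0\<^sub>v p" 0], of h] by (simp add: smult_zero_vec)
  ultimately have "emb A f \<in> ran_ext A z"
    using P_decomposition[OF z emb_minus_space, of f] by (metis (no_types, lifting) add.right_neutral ext)
  then obtain g \<phi> where g: "emb A f = (\<lambda>h. \<phi> h - emb A (z *\<^sub>C g) h)" "(g, \<phi>) \<in> ext_rel A (rel_adjoint A)"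
    unfolding ran_ext_def by blast
  have "cinner (f + z *\<^sub>C g) h = cinner g h'" if h: "(h, h') \<in> rel_adjoint A" for h h'
    using fun_cong[OF g(1), of h] g(2) h by (simp add: emb_dom_adjoint[OF h] in_ext_rel cinner_add_left)
  then have "(g, f + z *\<^sub>C g) \<in> rel_adjoint (rel_adjoint A)" by (simp add: in_rel_adjoint)
  then have "(g, f + z *\<^sub>C g) \<in> A" by (simp add: adjoint_adjoint_A)
  then show "f \<in> ran_shift A z" by (rule ran_shiftI) simp
next
  assume "f \<in> ran_shift A z"
  then obtain g g' where g: "(g, g') \<in> A" "f = g' - z *\<^sub>C g" unfolding ran_shift_def by blast
  have "cinner g' h = cinner g h'" if "(h, h') \<in> rel_adjoint A" for h h'
    using rel_adjointD[OF _ that, of g g'] g(1) by (simp add: adjoint_adjoint_A)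
  then have "(g, emb A g') \<in> ext_rel A (rel_adjoint A)"
    by (simp add: in_ext_rel emb_minus_space emb_dom_adjoint)
  then have "emb A f \<in> ran_ext A z"
    unfolding ran_ext_def by (intro CollectI exI[of _ g] exI[of _ "emb A g'"]) (simp add: g(2) emb_simps fun_eq_iff)
  then show "P z (emb A f) = 0\<^sub>v p" by (rule P_ran_ext[OF z])
qed

text \<open>\<open>\<phi>\<close> minus \<open>a\<close> is a second component over \<open>b\<close>
  in the extended relation; subtracting \<open>z *\<^sub>C b\<close> puts it into the range, which
  \<open>P z\<close> annihilates. So \<open>P z\<close> is determined by its restriction to the
  middle space.\<close>

lemma P_represents:
  assumes z: "z \<in> gauge_set A \<LL>" and \<phi>: "\<phi> \<in> minus_space A" and r: "represents \<phi> a b"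
  shows "P z \<phi> = P z (emb A (a + z *\<^sub>C b))"
proof -
  let ?x = "\<lambda>h. (\<phi> h - emb A a h) - emb A (z *\<^sub>C b) h"
  have "(b, \<lambda>h. \<phi> h - emb A a h) \<in> ext_rel A (rel_adjoint A)"
    using r by (auto simp: in_ext_rel minus_space_diffI \<phi> emb_minus_space emb_dom_adjoint represents_def)
  then have x: "?x \<in> ran_ext A z" unfolding ran_ext_def
    by (intro CollectI exI[of _ b] exI[of _ "\<lambda>h. \<phi> h - emb A a h"]) simp
  then have xm: "?x \<in> minus_space A" using z unfolding gauge_set_def by blast
  have "\<phi> = (\<lambda>h. ?x h + emb A (a + z *\<^sub>C b) h)" by (simp add: emb_simps fun_eq_iff)
  then have "P z \<phi> = P z (\<lambda>h. ?x h + emb A (a + z *\<^sub>C b) h)" by (rule arg_cong)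
  then have "P z \<phi> = P z ?x + P z (emb A (a + z *\<^sub>C b))"
    unfolding P_add[OF z xm emb_minus_space] .
  then show ?thesis using P_ran_ext[OF z x] P_carrier[OF z emb_minus_space] by simp
qed

text \<open>The kernel of \<open>P z\<close> on the middle space is closed, so
  \<open>finite_rank_adjoint\<close> yields \<open>h\<close> for embedded vectors.
  \<open>P_represents\<close> gives surjectivity there and carries the identity over to all
  functionals.\<close>

lemma P_adjoint_exists:
  assumes z: "z \<in> gauge_set A \<LL>" and \<xi>: "\<xi> \<in> carrier_vec p"
  shows "\<exists>h. (h, cnj z *\<^sub>C h) \<in> rel_adjoint A \<and> (\<forall>\<phi>\<in>minus_space A. \<phi> h = P z \<phi> \<bullet>c \<xi>)"
proof -
  have "\<exists>h. \<forall>f. cinner f h = P z (emb A f) \<bullet>c \<xi>"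
  proof (rule finite_rank_adjoint[OF _ _ _ _ _ \<xi>, of "\<lambda>f. P z (emb A f)"])
    show "P z (emb A f) \<in> carrier_vec p" for f by (rule P_carrier[OF z emb_minus_space])
    show "P z (emb A (f + g)) = P z (emb A f) + P z (emb A g)" for f g
      using P_add[OF z emb_minus_space[of f] emb_minus_space[of g]] by (simp flip: emb_add)
    show "P z (emb A (c *\<^sub>C f)) = c \<cdot>\<^sub>v P z (emb A f)" for c f
      using P_scale[OF z emb_minus_space[of f], of c] by (simp flip: emb_scale)
    show "\<exists>f. P z (emb A f) = \<eta>" if \<eta>: "\<eta> \<in> carrier_vec p" for \<eta>
    proof -
      obtain a b where "represents (L \<eta>) a b" using minus_space_represents[OF L_minus[OF \<eta>]] .
      from P_represents[OF z L_minus[OF \<eta>] this] show ?thesis unfolding P_L[OF z \<eta>] by metis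
    qed
    show "closed {f. P z (emb A f) = 0\<^sub>v p}"
      using z unfolding P_emb_zero_iff[OF z] by (simp add: gauge_set_def regular_points_def)
  qed blast
  then obtain h where h: "\<And>f. cinner f h = P z (emb A f) \<bullet>c \<xi>" by blast
  \<comment> \<open>\<open>h\<close> is orthogonal to the kernel, that is to the range of
    \<open>A\<close> shifted by \<open>z\<close>, hence it is a defect vector at
    \<open>cnj z\<close>.\<close>
  have "cinner (cnj z *\<^sub>C h) v = cinner h g" if "(v, g) \<in> A" for v g
  proof -
    have "g - z *\<^sub>C v \<in> ran_shift A z" using that by (rule ran_shiftI) simp
    then have "P z (emb A (g - z *\<^sub>C v)) = 0\<^sub>v p" using P_emb_zero_iff[OF z] by blast
    then have "cinner (g - z *\<^sub>C v) h = 0" unfolding h using \<xi> by simp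
    then have "cinner h (g - z *\<^sub>C v) = 0" by (subst cinner_commute) simp
    then show ?thesis by (simp add: cinner_simps)
  qed
  then have d: "(h, cnj z *\<^sub>C h) \<in> rel_adjoint A" by (simp add: in_rel_adjoint)
  have "\<phi> h = P z \<phi> \<bullet>c \<xi>" if \<phi>: "\<phi> \<in> minus_space A" for \<phi>
  proof -
    obtain a b where r: "represents \<phi> a b" using minus_space_represents[OF \<phi>] .
    show ?thesis
      using representsD[OF r d] h[of "a + z *\<^sub>C b"] P_represents[OF z \<phi> r] by (simp add: cinner_simps)
  qed
  then show ?thesis using d by blast
qed

abbreviation "Pa z \<equiv> adj_minus_C A (P z)"

lemma P_adj:
  assumes z: "z \<in> gauge_set A \<LL>" and \<xi>: "\<xi> \<in> carrier_vec p"
  shows "(Pa z \<xi>, cnj z *\<^sub>C Pa z \<xi>) \<in> rel_adjoint A"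
    and "\<And>\<phi>. \<phi> \<in> minus_space A \<Longrightarrow> \<phi> (Pa z \<xi>) = P z \<phi> \<bullet>c \<xi>"
    and "Pa z \<xi> \<in> plus_space A"
proof -
  obtain h where h: "(h, cnj z *\<^sub>C h) \<in> rel_adjoint A" "\<And>\<phi>. \<phi> \<in> minus_space A \<Longrightarrow> \<phi> h = P z \<phi> \<bullet>c \<xi>"
    using P_adjoint_exists[OF z \<xi>] by blast
  have "Pa z \<xi> = h" unfolding adj_minus_C_def
  proof (rule the_equality)
    show "h \<in> plus_space A \<and> (\<forall>\<phi>\<in>minus_space A. \<phi> h = P z \<phi> \<bullet>c \<xi>)"
      using h dom_adjoint_plus by blast
    fix k assume k: "k \<in> plus_space A \<and> (\<forall>\<phi>\<in>minus_space A. \<phi> k = P z \<phi> \<bullet>c \<xi>)"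
    have "emb A f k = emb A f h" for f using k h(2) emb_minus_space by metis
    then show "k = h" using k dom_adjoint_plus[OF h(1)]
      by (intro cinner_ext_right) (simp add: emb_def)
  qed
  with h dom_adjoint_plus[OF h(1)] show "(Pa z \<xi>, cnj z *\<^sub>C Pa z \<xi>) \<in> rel_adjoint A"
    "\<And>\<phi>. \<phi> \<in> minus_space A \<Longrightarrow> \<phi> (Pa z \<xi>) = P z \<phi> \<bullet>c \<xi>" "Pa z \<xi> \<in> plus_space A" by auto
qed

lemma P_adj_cinner:
  "z \<in> gauge_set A \<LL> \<Longrightarrow> \<xi> \<in> carrier_vec p \<Longrightarrow> cinner f (Pa z \<xi>) = P z (emb A f) \<bullet>c \<xi>"
  using P_adj(2)[OF _ _ emb_minus_space, of z \<xi> f] P_adj(3)[of z \<xi>] by (simp add: emb_def)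

lemma L_P_adj:
  "z \<in> gauge_set A \<LL> \<Longrightarrow> \<xi> \<in> carrier_vec p \<Longrightarrow> \<mu> \<in> carrier_vec p \<Longrightarrow> L \<mu> (Pa z \<xi>) = \<mu> \<bullet>c \<xi>"
  by (simp add: P_adj(2) L_minus P_L)

lemma P_adj_add:
  "z \<in> gauge_set A \<LL> \<Longrightarrow> x \<in> carrier_vec p \<Longrightarrow> y \<in> carrier_vec p \<Longrightarrow> Pa z (x + y) = Pa z x + Pa z y"
  by (rule cinner_ext_right)
    (simp add: P_adj_cinner cinner_add_right cprod_add_right[of _ p] P_carrier emb_minus_space)

lemma P_adj_scale:
  "z \<in> gauge_set A \<LL> \<Longrightarrow> x \<in> carrier_vec p \<Longrightarrow> Pa z (c \<cdot>\<^sub>v x) = c *\<^sub>C Pa z x"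
  by (rule cinner_ext_right)
    (simp add: P_adj_cinner cinner_scaleC_right cprod_scale_right[of _ p] P_carrier emb_minus_space)

text \<open>In the gauge decomposition of the embedding of \<open>n\<close>, the range part
  annihilates \<open>n\<close>, and the \<open>L\<close> part does so by hypothesis; thus the
  squared norm of \<open>n\<close> is zero.\<close>

lemma defect_determined:
  assumes z: "z \<in> gauge_set A \<LL>" and n: "(n, cnj z *\<^sub>C n) \<in> rel_adjoint A"
    and L0: "\<And>\<xi>. \<xi> \<in> carrier_vec p \<Longrightarrow> L \<xi> n = 0"
  shows "n = 0"
proof -
  obtain x where x: "x \<in> ran_ext A z" "emb A n = (\<lambda>h. x h + L (P z (emb A n)) h)"
    "P z (emb A n) \<in> carrier_vec p"
    by (rule P_decomposition[OF z emb_minus_space])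
  have "emb A n n = 0"
    using fun_cong[OF x(2), of n] ran_ext_defect[OF x(1) n] L0[OF x(3)] by simp
  then show ?thesis by (simp add: emb_dom_adjoint[OF n])
qed

end

section \<open>The adjoint of \<open>Q\<close> and the kernel identity\<close>

lemma append_vec_inject:
  fixes a b c d :: "complex vec"
  assumes "a \<in> carrier_vec n" "c \<in> carrier_vec n" "a @\<^sub>v b = c @\<^sub>v d"
  shows "a = c" "b = d"
  using append_vec_eq[OF assms(1,2), of b d] assms(3) by auto

lemma smult_mat_mult_vec:
  fixes M :: "complex mat"
  assumes "M \<in> carrier_mat n m" "v \<in> carrier_vec m"
  shows "(c \<cdot>\<^sub>m M) *\<^sub>v v = c \<cdot>\<^sub>v (M *\<^sub>v v)"
  using assms by (intro eq_vecI) (auto simp: scalar_prod_def sum_distrib_left mult.assoc)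

lemma J_tilde_carrier [simp]: "J_tilde p \<in> carrier_mat (p + p) (p + p)"
  by (simp add: J_tilde_def)

lemma J_tilde_mult:
  assumes "a \<in> carrier_vec p" "b \<in> carrier_vec p"
  shows "J_tilde p *\<^sub>v (a @\<^sub>v b) = \<i> \<cdot>\<^sub>v ((- b) @\<^sub>v a)"
proof -
  have "four_block_mat (0\<^sub>m p p) (- 1\<^sub>m p) (1\<^sub>m p) (0\<^sub>m p p) *\<^sub>v (a @\<^sub>v b) = (- b) @\<^sub>v (a :: complex vec)"
    using assms by (subst four_block_mat_mult_vec[of _ p p _ p _ p]) auto
  then show ?thesis unfolding J_tilde_def using assms by (subst smult_mat_mult_vec[of _ "p + p" "p + p"]) auto
qed

lemma J_tilde_square: "J_tilde p * J_tilde p = 1\<^sub>m (p + p)"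
proof (rule eq_mat_mult_vecI[of _ "p + p" "p + p"])
  fix v :: "complex vec" assume v: "v \<in> carrier_vec (p + p)"
  define a b where "a = vec_first v p" and "b = vec_last v p"
  have ab: "v = a @\<^sub>v b" "a \<in> carrier_vec p" "b \<in> carrier_vec p" using v by (simp_all add: a_def b_def)
  have "J_tilde p *\<^sub>v (J_tilde p *\<^sub>v v) = \<i> \<cdot>\<^sub>v (\<i> \<cdot>\<^sub>v ((- a) @\<^sub>v (- b)))"
    unfolding ab(1) J_tilde_mult[OF ab(2,3)]
    using ab by (subst mult_mat_vec[OF J_tilde_carrier]) (auto simp: J_tilde_mult)
  also have "\<dots> = v" using ab by (intro eq_vecI) auto
  finally show "(J_tilde p * J_tilde p) *\<^sub>v v = 1\<^sub>m (p + p) *\<^sub>v v"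
    unfolding assoc_mult_mat_vec[OF J_tilde_carrier J_tilde_carrier v] using v by simp
qed (auto simp: J_tilde_carrier[THEN mult_carrier_mat])

lemma (in boundary) R_hat_plus:
  assumes "resolvent_pair A z S S'" and \<phi>: "\<phi> \<in> minus_space A"
  shows "adj_H_plus S' \<phi> - Rb \<phi> \<in> plus_space A"
proof -
  obtain a b where "represents \<phi> a b" using minus_space_represents[OF \<phi>] .
  from R_hat_dom(1)[OF assms this] show ?thesis by (rule dom_adjoint_plus)
qed

lemma (in boundary) R_bold_add:
  "\<phi> \<in> minus_space A \<Longrightarrow> \<psi> \<in> minus_space A \<Longrightarrow> Rb (\<lambda>h. \<phi> h + \<psi> h) = Rb \<phi> + Rb \<psi>"
  by (simp add: R_bold_eq minus_space_addI R_tilde_def adj_H_plus_add[OF R0_pair_i(1)]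
      adj_H_plus_add[OF R0_pair_i(2)] scaleC_add_right)

lemma (in boundary) R_bold_scale:
  "\<phi> \<in> minus_space A \<Longrightarrow> Rb (\<lambda>h. c * \<phi> h) = c *\<^sub>C Rb \<phi>"
  by (simp add: R_bold_eq minus_space_scaleI R_tilde_def adj_H_plus_scale[OF R0_pair_i(1)]
      adj_H_plus_scale[OF R0_pair_i(2)] scaleC_add_right scaleC_scaleC mult.commute)

text \<open>The family \<open>R\<close> is quantified inside, so \<open>Q z\<close> and
  \<open>Q (cnj z)\<close> may come from different generalized resolvents.\<close>

locale resolvent_gauge = extended_boundary A p \<Gamma>0 \<Gamma>1 E0 E1 + gauge A p \<LL> L
  for A :: "('h :: complex_hilbert \<times> 'h) set" and p \<Gamma>0 \<Gamma>1 E0 E1 \<LL> L +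
  fixes Q :: "complex \<Rightarrow> 'h \<Rightarrow> complex vec"
  assumes Q_pair: "\<And>z. z \<in> gauge_set A \<LL> \<Longrightarrow>
    \<exists>R. resolvent_pair A z (R z) (R (cnj z)) \<and> Q z = Q_op p A \<Gamma>0 \<LL> L R z"
begin

abbreviation "\<rho> \<equiv> gauge_set A \<LL>"
abbreviation "Qa z \<equiv> adj_H_C (Q z)"

lemma minus_diff: "\<phi> \<in> minus_space A \<Longrightarrow> x \<in> plus_space A \<Longrightarrow> y \<in> plus_space A \<Longrightarrow> \<phi> (x - y) = \<phi> x - \<phi> y"
  using minus_spaceD(1)[of \<phi> "x - y" y] complex_vs.subspace_diff[OF subspace_plus, of x y] by simp

text \<open>\<open>q\<close> is the formula of \<open>Q_op\<close> transposed: \<open>S\<close>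
  becomes \<open>adj_H_plus S\<close> on \<open>L \<xi>\<close>, and the correction becomes the
  adjoint of \<open>P z\<close> on \<open>K\<close>. The listed properties no longer mention
  \<open>R\<close>; they are all that later steps know about the adjoint of
  \<open>Q\<close>.\<close>

lemma Q_adjoint_exists:
  assumes z: "z \<in> \<rho>" and \<xi>: "\<xi> \<in> carrier_vec p"
  shows "\<exists>q. (\<forall>f. Q z f \<in> carrier_vec p \<and> cinner f q = Q z f \<bullet>c \<xi>) \<and>
     (q, \<lambda>h. L \<xi> h + emb A (cnj z *\<^sub>C q) h) \<in> ext_rel A A \<and>
     q - Rb (L \<xi>) \<in> plus_space A \<and> (\<forall>\<mu>\<in>carrier_vec p. L \<mu> (q - Rb (L \<xi>)) = 0)"
proof -
  obtain R where pair: "resolvent_pair A z (R z) (R (cnj z))" and Q: "Q z = Q_op p A \<Gamma>0 \<LL> L R z"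
    using Q_pair[OF z] by blast
  define S S' where "S = R z" and "S' = R (cnj z)"
  have S: "resolvent_pair A z S S'" and S': "resolvent_pair A (cnj z) S' S"
    using pair resolvent_pair_sym unfolding S_def S'_def by auto
  let ?H = "\<lambda>\<eta>. adj_H_plus S' (L \<eta>) - Rb (L \<eta>)"
  have H_plus: "?H \<eta> \<in> plus_space A" if "\<eta> \<in> carrier_vec p" for \<eta>
    by (rule R_hat_plus[OF S L_minus[OF that]])
  note L\<xi> = L_minus[OF \<xi>]
  \<comment> \<open>As a function of \<open>\<xi>\<close>, this is the adjoint of the map that
    follows \<open>P z\<close> in \<open>Q_op\<close>, namely \<open>?H\<close> followed by the
    adjoint of \<open>L\<close>.\<close>
  define K where "K = vec p (\<lambda>j. L \<xi> (?H (unit_vec p j)))"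
  have Kc: "K \<in> carrier_vec p" by (simp add: K_def)
  have K: "K \<bullet>c \<eta> = L \<xi> (?H \<eta>)" if \<eta>: "\<eta> \<in> carrier_vec p" for \<eta>
    unfolding K_def
  proof (rule conj_linear_functional_cprod[OF _ _ \<eta>])
    fix x y :: "complex vec" assume x: "x \<in> carrier_vec p" and y: "y \<in> carrier_vec p"
    have "?H (x + y) = ?H x + ?H y"
      by (simp add: L_add x y adj_H_plus_add[OF S] R_bold_add L_minus)
    then show "L \<xi> (?H (x + y)) = L \<xi> (?H x) + L \<xi> (?H y)"
      by (simp add: minus_spaceD(1)[OF L\<xi>] H_plus x y)
  next
    fix x :: "complex vec" and c assume x: "x \<in> carrier_vec p"
    have "?H (c \<cdot>\<^sub>v x) = c *\<^sub>C ?H x"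
      by (simp add: L_scale x adj_H_plus_scale[OF S] R_bold_scale L_minus complex_vs.scale_right_diff_distrib)
    then show "L \<xi> (?H (c \<cdot>\<^sub>v x)) = cnj c * L \<xi> (?H x)"
      by (simp add: minus_spaceD(2)[OF L\<xi>] H_plus x)
  qed
  define q where "q = adj_H_plus S (L \<xi>) - Pa z K"
  have Qf: "Q z f = adj_C_minus p L (S f - ?H (P z (emb A f)))" for f
    unfolding Q Q_op_def R_hat_def R_tilde_def S_def S'_def skew_proj_P[OF z emb_minus_space] ..
  have 1: "Q z f \<in> carrier_vec p \<and> cinner f q = Q z f \<bullet>c \<xi>" for f
  proof
    note Pf = P_carrier[OF z emb_minus_space[of f]]
    have Sf: "S f \<in> plus_space A" by (rule dom_adjoint_plus[OF resolvent_pair_adjoint[OF S]])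
    show "Q z f \<in> carrier_vec p" unfolding Qf by (rule L_adj)
    have "Q z f \<bullet>c \<xi> = cnj (L \<xi> (S f)) - cnj (K \<bullet>c P z (emb A f))"
      unfolding Qf L_adj(2)[OF \<xi>] K[OF Pf] by (simp add: minus_diff[OF L\<xi> Sf H_plus[OF Pf]])
    also have "cnj (L \<xi> (S f)) = cinner f (adj_H_plus S (L \<xi>))"
      by (subst cinner_commute) (simp add: adj_H_plus_apply[OF S' L\<xi>])
    also have "cnj (K \<bullet>c P z (emb A f)) = P z (emb A f) \<bullet>c K"
      by (rule cprod_commute[OF Pf Kc, symmetric])
    finally show "cinner f q = Q z f \<bullet>c \<xi>"
      unfolding q_def cinner_diff_right P_adj_cinner[OF z Kc] by simp
  qed
  have "(q, \<lambda>h. L \<xi> h + emb A (cnj z *\<^sub>C q) h) =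
      (adj_H_plus S (L \<xi>) + (- 1) *\<^sub>C Pa z K,
       \<lambda>h. (L \<xi> h + emb A (cnj z *\<^sub>C adj_H_plus S (L \<xi>)) h) + (- 1) * emb A (cnj z *\<^sub>C Pa z K) h)"
    by (simp add: q_def emb_simps fun_eq_iff algebra_simps)
  also have "\<dots> \<in> ext_rel A A"
    by (rule ext_rel_add[OF adj_H_plus_ext_rel[OF S' L\<xi>] ext_rel_scale])
      (simp add: ext_rel_emb_iff P_adj(1)[OF z Kc])
  finally have 2: "(q, \<lambda>h. L \<xi> h + emb A (cnj z *\<^sub>C q) h) \<in> ext_rel A A" .
  have q: "q - Rb (L \<xi>) = (adj_H_plus S (L \<xi>) - Rb (L \<xi>)) - Pa z K" by (simp add: q_def)
  note pl = R_hat_plus[OF S' L\<xi>] P_adj(3)[OF z Kc]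
  have 3: "q - Rb (L \<xi>) \<in> plus_space A" unfolding q by (rule complex_vs.subspace_diff[OF subspace_plus pl])
  \<comment> \<open>Pairing \<open>L \<mu>\<close> with the adjoint of \<open>P z\<close> reproduces
    \<open>K\<close>. By \<open>R_hat_symmetric\<close> the regularized vector of
    \<open>L \<xi>\<close> has the same pairing, although it is built with \<open>S\<close> and
    \<open>K\<close> with \<open>S'\<close>.\<close>
  have 4: "L \<mu> (q - Rb (L \<xi>)) = 0" if \<mu>: "\<mu> \<in> carrier_vec p" for \<mu>
  proof -
    have "L \<mu> (Pa z K) = cnj (K \<bullet>c \<mu>)"
      unfolding L_P_adj[OF z Kc \<mu>] by (rule cprod_commute[OF \<mu> Kc])
    then show ?thesis
      unfolding q minus_diff[OF L_minus[OF \<mu>] pl] K[OF \<mu>]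
      by (simp add: R_hat_symmetric[OF S L_minus[OF \<mu>] L\<xi>])
  qed
  from 1 2 3 4 show ?thesis by blast
qed

lemma Q_carrier: "z \<in> \<rho> \<Longrightarrow> Q z f \<in> carrier_vec p"
  using Q_adjoint_exists[of z "0\<^sub>v p"] by auto

lemma Q_adj:
  assumes z: "z \<in> \<rho>" and \<xi>: "\<xi> \<in> carrier_vec p"
  shows "cinner f (Qa z \<xi>) = Q z f \<bullet>c \<xi>"
    and "(Qa z \<xi>, \<lambda>h. L \<xi> h + emb A (cnj z *\<^sub>C Qa z \<xi>) h) \<in> ext_rel A A"
    and "Qa z \<xi> - Rb (L \<xi>) \<in> plus_space A"
    and "\<mu> \<in> carrier_vec p \<Longrightarrow> L \<mu> (Qa z \<xi> - Rb (L \<xi>)) = 0"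
proof -
  obtain q where q: "\<And>f. cinner f q = Q z f \<bullet>c \<xi>"
     "(q, \<lambda>h. L \<xi> h + emb A (cnj z *\<^sub>C q) h) \<in> ext_rel A A"
     "q - Rb (L \<xi>) \<in> plus_space A" "\<forall>\<mu>\<in>carrier_vec p. L \<mu> (q - Rb (L \<xi>)) = 0"
    using Q_adjoint_exists[OF assms] by auto
  have "Qa z \<xi> = q"
    unfolding adj_H_C_def by (rule the_equality) (use q(1) in \<open>auto intro: cinner_ext_right\<close>)
  with q show "cinner f (Qa z \<xi>) = Q z f \<bullet>c \<xi>"
    "(Qa z \<xi>, \<lambda>h. L \<xi> h + emb A (cnj z *\<^sub>C Qa z \<xi>) h) \<in> ext_rel A A"
    "Qa z \<xi> - Rb (L \<xi>) \<in> plus_space A"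
    "\<mu> \<in> carrier_vec p \<Longrightarrow> L \<mu> (Qa z \<xi> - Rb (L \<xi>)) = 0" by auto
qed

lemma Q_adj_add:
  "z \<in> \<rho> \<Longrightarrow> x \<in> carrier_vec p \<Longrightarrow> y \<in> carrier_vec p \<Longrightarrow> Qa z (x + y) = Qa z x + Qa z y"
  by (rule cinner_ext_right) (simp add: Q_adj(1) cinner_add_right cprod_add_right[of _ p] Q_carrier)

lemma Q_adj_scale: "z \<in> \<rho> \<Longrightarrow> x \<in> carrier_vec p \<Longrightarrow> Qa z (c \<cdot>\<^sub>v x) = c *\<^sub>C Qa z x"
  by (rule cinner_ext_right) (simp add: Q_adj(1) cinner_scaleC_right cprod_scale_right[of _ p] Q_carrier)

lemma Q_hat_in: "z \<in> \<rho> \<Longrightarrow> \<xi> \<in> carrier_vec p \<Longrightarrow> Q_hat_adj A L Q z \<xi> \<in> ext_rel A A"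
  using Q_adj(2) unfolding Q_hat_adj_def by (simp add: add.commute)

lemma P_hat_in: "z \<in> \<rho> \<Longrightarrow> \<xi> \<in> carrier_vec p \<Longrightarrow> P_hat_adj A P z \<xi> \<in> ext_rel A A"
  using P_adj(1) unfolding P_hat_adj_def by (simp add: ext_rel_emb_iff)

section \<open>The matrix of boundary values\<close>

lemma op_mat_ext_mult:
  assumes E: "linear_bounded_on_ext p A E"
    and inn: "\<And>\<xi>. \<xi> \<in> carrier_vec p \<Longrightarrow> (F \<xi>, \<Phi> \<xi>) \<in> ext_rel A A"
    and add: "\<And>x y. x \<in> carrier_vec p \<Longrightarrow> y \<in> carrier_vec p \<Longrightarrow>
      (F (x + y), \<Phi> (x + y)) = (F x + F y, \<lambda>h. \<Phi> x h + \<Phi> y h)"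
    and scale: "\<And>c x. x \<in> carrier_vec p \<Longrightarrow> (F (c \<cdot>\<^sub>v x), \<Phi> (c \<cdot>\<^sub>v x)) = (c *\<^sub>C F x, \<lambda>h. c * \<Phi> x h)"
    and \<xi>: "\<xi> \<in> carrier_vec p"
  shows "op_mat p (\<lambda>\<xi>. E (F \<xi>, \<Phi> \<xi>)) *\<^sub>v \<xi> = E (F \<xi>, \<Phi> \<xi>)"
  by (rule op_mat_mult[OF _ _ _ \<xi>])
    (simp_all only: add scale linear_bounded_on_extD[OF E inn] linear_bounded_on_extD(2)[OF E inn inn])

lemma op_mat_Q_hat:
  assumes E: "linear_bounded_on_ext p A E" and z: "z \<in> \<rho>" and \<xi>: "\<xi> \<in> carrier_vec p"
  shows "op_mat p (\<lambda>\<xi>. E (Q_hat_adj A L Q z \<xi>)) *\<^sub>v \<xi> = E (Q_hat_adj A L Q z \<xi>)"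
  unfolding Q_hat_adj_def
  by (rule op_mat_ext_mult[OF E _ _ _ \<xi>])
    (use Q_hat_in[OF z] in \<open>simp_all add: Q_hat_adj_def Q_adj_add[OF z] Q_adj_scale[OF z] L_add L_scale
      fun_eq_iff emb_simps scaleC_add_right algebra_simps\<close>)

lemma op_mat_P_hat:
  assumes E: "linear_bounded_on_ext p A E" and z: "z \<in> \<rho>" and \<xi>: "\<xi> \<in> carrier_vec p"
  shows "op_mat p (\<lambda>\<xi>. E (P_hat_adj A P z \<xi>)) *\<^sub>v \<xi> = E (P_hat_adj A P z \<xi>)"
  unfolding P_hat_adj_def
  by (rule op_mat_ext_mult[OF E _ _ _ \<xi>])
    (use P_hat_in[OF z] in \<open>simp_all add: P_hat_adj_def P_adj_add[OF z] P_adj_scale[OF z]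
      fun_eq_iff emb_simps scaleC_add_right algebra_simps\<close>)

definition Gv :: "complex \<Rightarrow> complex vec \<Rightarrow> complex vec \<Rightarrow> 'h" where
  "Gv z x y = - Qa z x + Pa z y"

text \<open>The combination of \<open>Q_hat_adj\<close> at \<open>- x\<close> and
  \<open>P_hat_adj\<close> at \<open>y\<close>, with the second component split into a functional in
  the range of \<open>L\<close> and an embedded vector, the form required by
  \<open>extended_Green\<close>.\<close>

definition Gh :: "complex \<Rightarrow> complex vec \<Rightarrow> complex vec \<Rightarrow> 'h \<times> ('h \<Rightarrow> complex)" where
  "Gh z x y = (Gv z x y, \<lambda>h. (- 1) * L x h + emb A (cnj z *\<^sub>C Gv z x y) h)"

abbreviation "W \<equiv> W_hat p A E0 E1 L P Q"

lemma Gh_eq: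
  "Gh z x y = ((- 1) *\<^sub>C fst (Q_hat_adj A L Q z x) + fst (P_hat_adj A P z y),
    \<lambda>h. (- 1) * snd (Q_hat_adj A L Q z x) h + snd (P_hat_adj A P z y) h)"
  unfolding Gh_def Gv_def Q_hat_adj_def P_hat_adj_def
  by (simp add: emb_simps fun_eq_iff scaleC_add_right algebra_simps)

lemma Gh_in:
  assumes "z \<in> \<rho>" "x \<in> carrier_vec p" "y \<in> carrier_vec p"
  shows "Gh z x y \<in> ext_rel A A"
  unfolding Gh_eq using Q_hat_in[OF assms(1,2)] P_hat_in[OF assms(1,3)]
  by (intro ext_rel_add ext_rel_scale) simp_all

lemma E_Gh:
  assumes E: "linear_bounded_on_ext p A E" and z: "z \<in> \<rho>" and x: "x \<in> carrier_vec p" and y: "y \<in> carrier_vec p"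
  shows "E (Gh z x y) = - E (Q_hat_adj A L Q z x) + E (P_hat_adj A P z y)"
proof -
  obtain a b where q: "Q_hat_adj A L Q z x = (a, b)" by fastforce
  obtain c d where pp: "P_hat_adj A P z y = (c, d)" by fastforce
  have q': "(a, b) \<in> ext_rel A A" and p': "(c, d) \<in> ext_rel A A"
    using Q_hat_in[OF z x] P_hat_in[OF z y] q pp by auto
  have "E (Gh z x y) = (- 1) \<cdot>\<^sub>v E (a, b) + E (c, d)"
    unfolding Gh_eq q pp fst_conv snd_conv
    by (subst linear_bounded_on_extD(2)[OF E ext_rel_scale[OF q'] p'])
      (simp only: linear_bounded_on_extD(3)[OF E q'])
  then show ?thesis
    unfolding q pp using linear_bounded_on_extD(1)[OF E q'] linear_bounded_on_extD(1)[OF E p']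
    by (intro eq_vecI) auto
qed

lemma W_carrier: "W z \<in> carrier_mat (p + p) (p + p)"
  unfolding W_hat_def by (intro mat_adjoint_carrier four_block_carrier_mat) simp_all

lemma W_adjoint_mult:
  assumes z: "z \<in> \<rho>" and x: "x \<in> carrier_vec p" and y: "y \<in> carrier_vec p"
  shows "mat_adjoint (W z) *\<^sub>v (x @\<^sub>v y) = E0 (Gh z x y) @\<^sub>v E1 (Gh z x y)"
  unfolding W_hat_def mat_adjoint_adjoint
  using op_mat_Q_hat[OF E_linear(1) z x] op_mat_Q_hat[OF E_linear(2) z x]
    op_mat_P_hat[OF E_linear(1) z y] op_mat_P_hat[OF E_linear(2) z y] x y
  by (subst four_block_mat_mult_vec[of _ p p _ p _ p])
    (simp_all add: E_Gh[OF E_linear(1) z x y] E_Gh[OF E_linear(2) z x y] op_mat_def)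

lemma Gh_carrier:
  assumes "z \<in> \<rho>" "x \<in> carrier_vec p" "y \<in> carrier_vec p"
  shows "E0 (Gh z x y) \<in> carrier_vec p" "E1 (Gh z x y) \<in> carrier_vec p"
  using Gh_in[OF assms] E_carrier by (metis Gh_def)+

text \<open>The functional part of \<open>Gh z x y\<close> is minus \<open>L x\<close>, so removing
  its mean appears as adding \<open>Rb (L x)\<close>.\<close>

lemma L_Gv:
  assumes z: "z \<in> \<rho>" and x: "x \<in> carrier_vec p" and y: "y \<in> carrier_vec p" and \<mu>: "\<mu> \<in> carrier_vec p"
  shows "Gv z x y + Rb (L x) \<in> plus_space A" and "L \<mu> (Gv z x y + Rb (L x)) = \<mu> \<bullet>c y"
proof -
  have eq: "Gv z x y + Rb (L x) = Pa z y - (Qa z x - Rb (L x))" by (simp add: Gv_def)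
  show "Gv z x y + Rb (L x) \<in> plus_space A"
    unfolding eq by (rule complex_vs.subspace_diff[OF subspace_plus P_adj(3)[OF z y] Q_adj(3)[OF z x]])
  show "L \<mu> (Gv z x y + Rb (L x)) = \<mu> \<bullet>c y"
    unfolding eq minus_diff[OF L_minus[OF \<mu>] P_adj(3)[OF z y] Q_adj(3)[OF z x]]
      L_P_adj[OF z y \<mu>] Q_adj(4)[OF z x \<mu>] by simp
qed

text \<open>The factor \<open>z - cnj \<zeta>\<close> arises because the embedded parts of the two
  elements are \<open>cnj \<zeta>\<close> and \<open>cnj z\<close> times their first
  components.\<close>

lemma Green_Gh:
  assumes z: "z \<in> \<rho>" and \<zeta>: "\<zeta> \<in> \<rho>"
    and x: "x \<in> carrier_vec p" and y: "y \<in> carrier_vec p"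
    and x': "x' \<in> carrier_vec p" and y': "y' \<in> carrier_vec p"
  shows "E1 (Gh \<zeta> x y) \<bullet>c E0 (Gh z x' y') - E0 (Gh \<zeta> x y) \<bullet>c E1 (Gh z x' y') =
    y \<bullet>c x' - x \<bullet>c y' - (z - cnj \<zeta>) * cinner (Gv \<zeta> x y) (Gv z x' y')"
proof -
  note m = minus_space_scaleI[OF L_minus[OF x], of "- 1"] and m' = minus_space_scaleI[OF L_minus[OF x'], of "- 1"]
  have a: "L x (Gv z x' y' - (- 1) *\<^sub>C Rb (L x')) = x \<bullet>c y'"
    "L x' (Gv \<zeta> x y - (- 1) *\<^sub>C Rb (L x)) = x' \<bullet>c y"
    using L_Gv(2)[OF z x' y' x] L_Gv(2)[OF \<zeta> x y x'] by simp_all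
  have b: "cnj (- 1 * (x' \<bullet>c y)) = - (y \<bullet>c x')" using cprod_commute[OF y x'] by simp
  show ?thesis
    using extended_Green[OF m Gh_in[OF \<zeta> x y, unfolded Gh_def] m' Gh_in[OF z x' y', unfolded Gh_def]]
    unfolding R_bold_scale[OF L_minus[OF x]] R_bold_scale[OF L_minus[OF x']] a b
    by (simp add: Gh_def cinner_simps algebra_simps)
qed

text \<open>Without division, so that \<open>z = cnj \<zeta>\<close> is included. Paired with
  \<open>w\<close>, the matrix \<open>W z\<close> moves over as its adjoint, whose values are the
  boundary values of \<open>Gh z\<close>; the left side becomes a Green form.\<close>

lemma kernel_identity:
  assumes z: "z \<in> \<rho>" and \<zeta>: "\<zeta> \<in> \<rho>" and v: "v \<in> carrier_vec (p + p)"
  shows "(J_tilde p - W z * J_tilde p * mat_adjoint (W \<zeta>)) *\<^sub>v v =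
    (- \<i> * (z - cnj \<zeta>)) \<cdot>\<^sub>v G_op A P Q z (G_adj p A P Q \<zeta> v)"
proof -
  define x y where "x = vec_first v p" and "y = vec_last v p"
  have xy: "x \<in> carrier_vec p" "y \<in> carrier_vec p" and vxy: "v = x @\<^sub>v y"
    using v by (simp_all add: x_def y_def)
  have Gv: "G_adj p A P Q \<zeta> v = Gv \<zeta> x y" by (simp add: G_adj_def Gv_def x_def y_def)
  let ?f = "Gv \<zeta> x y"
  let ?F = "E0 (Gh \<zeta> x y)" and ?F' = "E1 (Gh \<zeta> x y)"
  note F = Gh_carrier[OF \<zeta> xy]
  note Wc = W_carrier[of z] mat_adjoint_carrier[OF W_carrier[of z]]
  have Gc: "G_op A P Q z ?f \<in> carrier_vec (p + p)"
    unfolding G_op_def using Q_carrier[OF z] P_carrier[OF z emb_minus_space] by auto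
  have lhs: "(J_tilde p - W z * J_tilde p * mat_adjoint (W \<zeta>)) *\<^sub>v v =
      \<i> \<cdot>\<^sub>v ((- y) @\<^sub>v x) - W z *\<^sub>v (\<i> \<cdot>\<^sub>v ((- ?F') @\<^sub>v ?F))"
  proof -
    note c = W_carrier[of z] J_tilde_carrier[of p] mat_adjoint_carrier[OF W_carrier[of \<zeta>]]
    have "(J_tilde p - W z * J_tilde p * mat_adjoint (W \<zeta>)) *\<^sub>v v =
        J_tilde p *\<^sub>v v - W z *\<^sub>v (J_tilde p *\<^sub>v (mat_adjoint (W \<zeta>) *\<^sub>v v))"
      using c v by (simp add: minus_mult_distrib_mat_vec[of _ "p + p" "p + p"]
          assoc_mult_mat_vec[of _ "p + p" "p + p" _ "p + p"] mult_carrier_mat[of _ "p + p" "p + p" _ "p + p"])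
    then show ?thesis
      unfolding vxy W_adjoint_mult[OF \<zeta> xy] J_tilde_mult[OF xy] J_tilde_mult[OF F] .
  qed
  show ?thesis unfolding lhs Gv
  proof (rule cprod_ext[of _ "p + p"])
    show "\<i> \<cdot>\<^sub>v ((- y) @\<^sub>v x) - W z *\<^sub>v (\<i> \<cdot>\<^sub>v ((- ?F') @\<^sub>v ?F)) \<in> carrier_vec (p + p)"
      using W_carrier[of z] xy F by auto
    show "(- \<i> * (z - cnj \<zeta>)) \<cdot>\<^sub>v G_op A P Q z ?f \<in> carrier_vec (p + p)" using Gc by simp
    fix w :: "complex vec" assume w: "w \<in> carrier_vec (p + p)"
    define x' y' where "x' = vec_first w p" and "y' = vec_last w p"
    have xy': "x' \<in> carrier_vec p" "y' \<in> carrier_vec p" and wxy: "w = x' @\<^sub>v y'"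
      using w by (simp_all add: x'_def y'_def)
    let ?g = "Gv z x' y'" and ?G = "E0 (Gh z x' y')" and ?G' = "E1 (Gh z x' y')"
    note G = Gh_carrier[OF z xy']
    have neg: "(- a) \<bullet>c b = - (a \<bullet>c b)" if "a \<in> carrier_vec p" "b \<in> carrier_vec p" for a b :: "complex vec"
      using that by simp
    have "(W z *\<^sub>v (\<i> \<cdot>\<^sub>v ((- ?F') @\<^sub>v ?F))) \<bullet>c w = (\<i> \<cdot>\<^sub>v ((- ?F') @\<^sub>v ?F)) \<bullet>c (mat_adjoint (W z) *\<^sub>v w)"
      by (rule mat_adjoint_cprod[OF W_carrier _ w]) (use F in auto)
    also have "\<dots> = \<i> * (((- ?F') @\<^sub>v ?F) \<bullet>c (?G @\<^sub>v ?G'))"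
      unfolding wxy W_adjoint_mult[OF z xy'] by (rule cprod_scale_left[of _ "p + p"]) (use F G in auto)
    also have "\<dots> = \<i> * (- (?F' \<bullet>c ?G) + ?F \<bullet>c ?G')"
      using F G by (simp add: cprod_append[of _ p _ p] neg)
    finally have 1: "(W z *\<^sub>v (\<i> \<cdot>\<^sub>v ((- ?F') @\<^sub>v ?F))) \<bullet>c w = \<i> * (- (?F' \<bullet>c ?G) + ?F \<bullet>c ?G')" .
    have "(\<i> \<cdot>\<^sub>v ((- y) @\<^sub>v x)) \<bullet>c w = \<i> * (((- y) @\<^sub>v x) \<bullet>c w)"
      by (rule cprod_scale_left[of _ "p + p"]) (use xy w in auto)
    also have "\<dots> = \<i> * (- (y \<bullet>c x') + x \<bullet>c y')"
      unfolding wxy using xy xy' by (simp add: cprod_append[of _ p _ p] neg)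
    finally have 2: "(\<i> \<cdot>\<^sub>v ((- y) @\<^sub>v x)) \<bullet>c w = \<i> * (- (y \<bullet>c x') + x \<bullet>c y')" .
    have "(\<i> \<cdot>\<^sub>v ((- y) @\<^sub>v x) - W z *\<^sub>v (\<i> \<cdot>\<^sub>v ((- ?F') @\<^sub>v ?F))) \<bullet>c w =
        (\<i> \<cdot>\<^sub>v ((- y) @\<^sub>v x)) \<bullet>c w - (W z *\<^sub>v (\<i> \<cdot>\<^sub>v ((- ?F') @\<^sub>v ?F))) \<bullet>c w"
      by (rule minus_scalar_prod_distrib[of _ "p + p"]) (use W_carrier[of z] xy F w in auto)
    also have "\<dots> = \<i> * ((?F' \<bullet>c ?G - ?F \<bullet>c ?G') - (y \<bullet>c x' - x \<bullet>c y'))"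
      unfolding 1 2 by (simp add: algebra_simps)
    also have "\<dots> = - \<i> * (z - cnj \<zeta>) * cinner ?f ?g"
      unfolding Green_Gh[OF z \<zeta> xy xy'] by (simp add: algebra_simps)
    also have "cinner ?f ?g = - (Q z ?f \<bullet>c x') + P z (emb A ?f) \<bullet>c y'"
      unfolding Gv_def[of z] using Q_adj(1)[OF z xy'(1), of ?f] P_adj_cinner[OF z xy'(2), of ?f]
      by (simp add: cinner_simps)
    also have "\<dots> = G_op A P Q z ?f \<bullet>c w"
      unfolding G_op_def wxy using Q_carrier[OF z, of ?f] P_carrier[OF z emb_minus_space, of ?f] xy'
      by (simp add: cprod_append[of _ p _ p] neg)
    also have "- \<i> * (z - cnj \<zeta>) * (G_op A P Q z ?f \<bullet>c w) = ((- \<i> * (z - cnj \<zeta>)) \<cdot>\<^sub>v G_op A P Q z ?f) \<bullet>c w"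
      by (rule cprod_scale_left[OF Gc w, symmetric])
    finally show "(\<i> \<cdot>\<^sub>v ((- y) @\<^sub>v x) - W z *\<^sub>v (\<i> \<cdot>\<^sub>v ((- ?F') @\<^sub>v ?F))) \<bullet>c w =
        ((- \<i> * (z - cnj \<zeta>)) \<cdot>\<^sub>v G_op A P Q z ?f) \<bullet>c w" .
  qed
qed

end

section \<open>Comparison with the resolvent matrix\<close>

lemma vec_diff_add_cancel:
  fixes a b :: "complex vec"
  assumes "a \<in> carrier_vec n" "b \<in> carrier_vec n"
  shows "a - b + b = a"
  using assms by (intro eq_vecI) auto

lemma vec_minus_smult_add:
  fixes a b :: "complex vec"
  assumes "a \<in> carrier_vec n" "b \<in> carrier_vec n"
  shows "- 1 \<cdot>\<^sub>v a + b = b - a"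
  using assms by (intro eq_vecI) auto

lemma vec_uminus_diff:
  fixes a b :: "complex vec"
  assumes "a \<in> carrier_vec n" "b \<in> carrier_vec n"
  shows "- (a - b) = b - a"
  using assms by (intro eq_vecI) auto

lemma vec_add_diff_cancel:
  fixes a b :: "complex vec"
  assumes "a \<in> carrier_vec n" "b \<in> carrier_vec n"
  shows "a + b - b = a"
  using assms by (intro eq_vecI) auto

lemma vec_add_diff_assoc:
  fixes a b c :: "complex vec"
  assumes "a \<in> carrier_vec n" "b \<in> carrier_vec n" "c \<in> carrier_vec n"
  shows "a + (b - c) = a + b - c"
  using assms by (intro eq_vecI) auto

lemma vec_diff_eq_zeroD:
  fixes a b :: "complex vec"
  assumes "a - b = 0\<^sub>v n" "a \<in> carrier_vec n" "b \<in> carrier_vec n"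
  shows "a = b"
  using vec_diff_add_cancel[OF assms(2,3)] assms(1,3) by simp

context resolvent_gauge
begin

lemma W_J_W:
  assumes z: "z \<in> \<rho>" "cnj z \<in> \<rho>"
  shows "W z * J_tilde p * mat_adjoint (W (cnj z)) = J_tilde p"
proof -
  let ?M = "W z * J_tilde p * mat_adjoint (W (cnj z))"
  have M: "?M \<in> carrier_mat (p + p) (p + p)"
    using W_carrier J_tilde_carrier mat_adjoint_carrier by (meson mult_carrier_mat)
  show ?thesis
  proof (rule eq_mat_mult_vecI[OF M J_tilde_carrier])
    fix v :: "complex vec" assume v: "v \<in> carrier_vec (p + p)"
    have "G_op A P Q z (G_adj p A P Q (cnj z) v) \<in> carrier_vec (p + p)"
      unfolding G_op_def using Q_carrier[OF z(1)] P_carrier[OF z(1) emb_minus_space] by auto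
    then have "J_tilde p *\<^sub>v v - ?M *\<^sub>v v = 0\<^sub>v (p + p)"
      using kernel_identity[OF z v] minus_mult_distrib_mat_vec[OF J_tilde_carrier M v]
      by (intro eq_vecI) auto
    moreover have "J_tilde p *\<^sub>v v \<in> carrier_vec (p + p)" "?M *\<^sub>v v \<in> carrier_vec (p + p)"
      using M v J_tilde_carrier by (meson mult_mat_vec_carrier)+
    ultimately show "?M *\<^sub>v v = J_tilde p *\<^sub>v v" by (rule vec_diff_eq_zeroD[symmetric])
  qed
qed

text \<open>\<open>J_tilde\<close> is its own inverse, so \<open>W_J_W\<close> displays a right
  inverse, two-sided because the matrices are square.\<close>

lemma W_invertible:
  assumes z: "z \<in> \<rho>" "cnj z \<in> \<rho>"
  shows "invertible_mat (W z)"
proof -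
  let ?n = "p + p"
  let ?N = "J_tilde p * mat_adjoint (W (cnj z)) * J_tilde p"
  note c = W_carrier[of z] J_tilde_carrier[of p] mat_adjoint_carrier[OF W_carrier[of "cnj z"]]
  have JW: "J_tilde p * mat_adjoint (W (cnj z)) \<in> carrier_mat ?n ?n" by (rule mult_carrier_mat[OF c(2,3)])
  have N: "?N \<in> carrier_mat ?n ?n" by (rule mult_carrier_mat[OF JW c(2)])
  have "W z * ?N = (W z * (J_tilde p * mat_adjoint (W (cnj z)))) * J_tilde p"
    by (rule assoc_mult_mat[OF c(1) JW c(2), symmetric])
  also have "W z * (J_tilde p * mat_adjoint (W (cnj z))) = J_tilde p"
    using assoc_mult_mat[OF c(1,2,3)] W_J_W[OF z] by simp
  finally have WN: "W z * ?N = 1\<^sub>m ?n" by (simp add: J_tilde_square)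
  have NW: "?N * W z = 1\<^sub>m ?n" by (rule mat_mult_left_right_inverse[OF c(1) N WN])
  show ?thesis unfolding invertible_mat_def inverts_mat_def
    using WN NW c(1) N by (intro conjI exI[of _ ?N]) (auto simp: square_mat.simps)
qed

context
  fixes z assumes z\<rho>: "z \<in> \<rho>" "cnj z \<in> \<rho>" and zA0: "z \<in> resolvent_set A0"
begin

abbreviation "a11 \<equiv> op_mat p (weyl_fun A \<Gamma>0 \<Gamma>1 z)"
abbreviation "a12 \<equiv> op_mat p (\<lambda>\<xi>. adj_C_plus p (gamma_field A \<Gamma>0 (cnj z)) (L \<xi>))"
abbreviation "a21 \<equiv> op_mat p (\<lambda>\<xi>. adj_C_minus p L (gamma_field A \<Gamma>0 z \<xi>))"
abbreviation "a22 \<equiv> op_mat p (\<lambda>\<xi>. adj_C_minus p L (R_hat p A \<Gamma>0 R0 z (L \<xi>)))"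

lemma cnj_zA0: "cnj z \<in> resolvent_set A0"
  by (rule resolvent_set_cnj[OF A0_selfadjoint zA0])

lemma a11:
  assumes \<xi>: "\<xi> \<in> carrier_vec p"
  shows "a11 *\<^sub>v \<xi> = \<Gamma>1 (gamma_field A \<Gamma>0 z \<xi>, z *\<^sub>C gamma_field A \<Gamma>0 z \<xi>)"
proof -
  have eq: "weyl_fun A \<Gamma>0 \<Gamma>1 z \<eta> = \<Gamma>1 (gamma_field A \<Gamma>0 z \<eta>, z *\<^sub>C gamma_field A \<Gamma>0 z \<eta>)"
    if "\<eta> \<in> carrier_vec p" for \<eta>
    by (simp add: weyl_fun_def gamma_hat(3)[OF zA0 that])
  have "a11 *\<^sub>v \<xi> = weyl_fun A \<Gamma>0 \<Gamma>1 z \<xi>"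
  proof (rule op_mat_mult[OF _ _ _ \<xi>])
    fix x y :: "complex vec" and c assume x: "x \<in> carrier_vec p"
    note gx = gamma_hat(1)[OF zA0 x]
    show "weyl_fun A \<Gamma>0 \<Gamma>1 z x \<in> carrier_vec p" by (simp add: eq x Gamma_carrier gx)
    show "weyl_fun A \<Gamma>0 \<Gamma>1 z (c \<cdot>\<^sub>v x) = c \<cdot>\<^sub>v weyl_fun A \<Gamma>0 \<Gamma>1 z x"
      using Gamma_scale(2)[OF gx, of c]
      by (simp add: eq x gamma_scale[OF zA0 x] scaleC_scaleC mult.commute)
    assume y: "y \<in> carrier_vec p"
    show "weyl_fun A \<Gamma>0 \<Gamma>1 z (x + y) = weyl_fun A \<Gamma>0 \<Gamma>1 z x + weyl_fun A \<Gamma>0 \<Gamma>1 z y"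
      using Gamma_add(2)[OF gx gamma_hat(1)[OF zA0 y]]
      by (simp add: eq x y gamma_add[OF zA0 x y] scaleC_add_right)
  qed
  then show ?thesis by (simp add: eq[OF \<xi>])
qed

lemma a12:
  assumes \<xi>: "\<xi> \<in> carrier_vec p"
  shows "a12 *\<^sub>v \<xi> = adj_C_plus p (gamma_field A \<Gamma>0 (cnj z)) (L \<xi>)"
proof (rule op_mat_mult[OF _ _ _ \<xi>])
  note g = gamma_adjoint[OF cnj_zA0]
  fix x y :: "complex vec" and c assume x: "x \<in> carrier_vec p"
  let ?T = "\<lambda>\<xi>. adj_C_plus p (gamma_field A \<Gamma>0 (cnj z)) (L \<xi>)"
  show "?T x \<in> carrier_vec p" by (rule g(1)[OF L_minus[OF x]])
  show "?T (c \<cdot>\<^sub>v x) = c \<cdot>\<^sub>v ?T x"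
    by (rule cprod_ext[of _ p])
      (simp_all add: g L_minus x L_scale[OF x] minus_space_scaleI cprod_scale_left[of _ p])
  assume y: "y \<in> carrier_vec p"
  show "?T (x + y) = ?T x + ?T y"
    by (rule cprod_ext[of _ p])
      (simp_all add: g L_minus x y L_add[OF x y] minus_space_addI cprod_add_left[of _ p])
qed

lemma a21:
  assumes \<xi>: "\<xi> \<in> carrier_vec p"
  shows "a21 *\<^sub>v \<xi> = adj_C_minus p L (gamma_field A \<Gamma>0 z \<xi>)"
proof (rule op_mat_mult[OF _ _ _ \<xi>])
  fix x y :: "complex vec" and c assume x: "x \<in> carrier_vec p"
  let ?T = "\<lambda>\<xi>. adj_C_minus p L (gamma_field A \<Gamma>0 z \<xi>)"
  show "?T x \<in> carrier_vec p" by (rule L_adj)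
  show "?T (c \<cdot>\<^sub>v x) = c \<cdot>\<^sub>v ?T x"
    by (rule cprod_ext[of _ p])
      (simp_all add: L_adj gamma_scale[OF zA0 x] minus_spaceD(2)[OF L_minus] gamma_plus zA0 x
        cprod_scale_left[of _ p])
  assume y: "y \<in> carrier_vec p"
  show "?T (x + y) = ?T x + ?T y"
    by (rule cprod_ext[of _ p])
      (simp_all add: L_adj gamma_add[OF zA0 x y] minus_spaceD(1)[OF L_minus] gamma_plus zA0 x y
        cprod_add_left[of _ p])
qed

lemma R_hat_L_plus:
  "x \<in> carrier_vec p \<Longrightarrow> R_hat p A \<Gamma>0 R0 z (L x) \<in> plus_space A"
  unfolding R_hat_def R_tilde_def by (rule R_hat_plus[OF R0_pair[OF zA0] L_minus])

lemma a22:
  assumes \<xi>: "\<xi> \<in> carrier_vec p"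
  shows "a22 *\<^sub>v \<xi> = adj_C_minus p L (R_hat p A \<Gamma>0 R0 z (L \<xi>))"
proof (rule op_mat_mult[OF _ _ _ \<xi>])
  note pair = R0_pair[OF zA0]
  fix x y :: "complex vec" and c assume x: "x \<in> carrier_vec p"
  let ?R = "\<lambda>\<xi>. R_hat p A \<Gamma>0 R0 z (L \<xi>)"
  let ?T = "\<lambda>\<xi>. adj_C_minus p L (?R \<xi>)"
  show "?T x \<in> carrier_vec p" by (rule L_adj)
  have "?R (c \<cdot>\<^sub>v x) = c *\<^sub>C ?R x"
    unfolding R_hat_def R_tilde_def L_scale[OF x]
    by (simp add: adj_H_plus_scale[OF pair] R_bold_scale L_minus x complex_vs.scale_right_diff_distrib)
  then show "?T (c \<cdot>\<^sub>v x) = c \<cdot>\<^sub>v ?T x"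
    by (intro cprod_ext[of _ p])
      (simp_all add: L_adj minus_spaceD(2)[OF L_minus] R_hat_L_plus x cprod_scale_left[of _ p])
  assume y: "y \<in> carrier_vec p"
  have "?R (x + y) = ?R x + ?R y"
    unfolding R_hat_def R_tilde_def L_add[OF x y]
    by (simp add: adj_H_plus_add[OF pair] R_bold_add L_minus x y)
  then show "?T (x + y) = ?T x + ?T y"
    by (intro cprod_ext[of _ p])
      (simp_all add: L_adj minus_spaceD(1)[OF L_minus] R_hat_L_plus x y cprod_add_left[of _ p])
qed

text \<open>Both sides differ by an element of the defect space at \<open>z\<close> that is annihilated by \<open>L\<close>.\<close>

lemma Gv_cnj:
  assumes x: "x \<in> carrier_vec p" and \<eta>: "\<eta> \<in> carrier_vec p"
  defines "y \<equiv> a21 *\<^sub>v \<eta> - a22 *\<^sub>v x"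
  shows "Gv (cnj z) x y = - R_tilde R0 z (L x) + gamma_field A \<Gamma>0 z \<eta>"
proof -
  let ?u = "R_tilde R0 z (L x)" and ?g = "gamma_field A \<Gamma>0 z \<eta>" and ?f = "Gv (cnj z) x y"
  have a: "a21 *\<^sub>v \<eta> \<in> carrier_vec p" "a22 *\<^sub>v x \<in> carrier_vec p"
    by (simp_all add: a21[OF \<eta>] a22[OF x] L_adj)
  have y: "y \<in> carrier_vec p" using a by (simp add: y_def)
  \<comment> \<open>\<open>L \<mu> n\<close> is \<open>\<mu>\<close> paired with \<open>y\<close>
    plus \<open>a22 *\<^sub>v x\<close> minus \<open>a21 *\<^sub>v \<eta>\<close>, and
    \<open>y\<close> is chosen to make this zero. Defect vectors at \<open>z\<close> are handled by
    \<open>defect_determined\<close> at the gauge point \<open>cnj z\<close>.\<close>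
  define n where "n = ?f + ?u - ?g"
  have f: "(?f, \<lambda>h. (- 1) * L x h + emb A (z *\<^sub>C ?f) h) \<in> ext_rel A A"
    using Gh_in[OF z\<rho>(2) x y] by (simp add: Gh_def)
  note u = E_R0(3)[OF zA0 L_minus[OF x]]
  have "(?f + ?u, emb A (z *\<^sub>C (?f + ?u))) =
      (?f + ?u, \<lambda>h. ((- 1) * L x h + emb A (z *\<^sub>C ?f) h) + (L x h + emb A (z *\<^sub>C ?u) h))"
    by (simp add: emb_simps fun_eq_iff scaleC_add_right algebra_simps)
  also have "\<dots> \<in> ext_rel A A" by (rule ext_rel_add[OF f u])
  finally have "(?f + ?u, z *\<^sub>C (?f + ?u)) \<in> rel_adjoint A" by (simp add: ext_rel_emb_iff)
  from rel_adjoint_diff[OF this gamma_hat(1)[OF zA0 \<eta>]]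
  have n: "(n, cnj (cnj z) *\<^sub>C n) \<in> rel_adjoint A"
    by (simp add: n_def complex_vs.scale_right_diff_distrib)
  have "n = 0"
  proof (rule defect_determined[OF z\<rho>(2) n])
    fix \<mu> :: "complex vec" assume \<mu>: "\<mu> \<in> carrier_vec p"
    have eq: "n = ((?f + Rb (L x)) + R_hat p A \<Gamma>0 R0 z (L x)) - ?g"
      by (simp add: n_def R_hat_def)
    note pl = L_Gv(1)[OF z\<rho>(2) x y \<mu>] R_hat_L_plus[OF x] gamma_plus[OF zA0 \<eta>]
    have L1: "L \<mu> (R_hat p A \<Gamma>0 R0 z (L x)) = \<mu> \<bullet>c (a22 *\<^sub>v x)"
      using cprod_commute[OF \<mu> a(2)] L_adj(2)[OF \<mu>] by (simp add: a22[OF x])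
    have L2: "L \<mu> ?g = \<mu> \<bullet>c (a21 *\<^sub>v \<eta>)"
      using cprod_commute[OF \<mu> a(1)] L_adj(2)[OF \<mu>] by (simp add: a21[OF \<eta>])
    have "\<mu> \<bullet>c (a21 *\<^sub>v \<eta>) = \<mu> \<bullet>c (y + a22 *\<^sub>v x)"
      unfolding y_def vec_diff_add_cancel[OF a] ..
    also have "\<dots> = \<mu> \<bullet>c y + \<mu> \<bullet>c (a22 *\<^sub>v x)" by (rule cprod_add_right[OF y a(2) \<mu>])
    finally show "L \<mu> n = 0"
      unfolding eq minus_diff[OF L_minus[OF \<mu>] complex_vs.subspace_add[OF subspace_plus pl(1,2)] pl(3)]
        minus_spaceD(1)[OF L_minus[OF \<mu>] pl(1,2)] L_Gv(2)[OF z\<rho>(2) x y \<mu>] L1 L2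
      by simp
  qed
  then show ?thesis by (simp add: n_def algebra_simps)
qed

text \<open>By \<open>Gv_cnj\<close> the element at \<open>cnj z\<close> has boundary values
  \<open>\<eta>\<close> and \<open>a11 *\<^sub>v \<eta> - a12 *\<^sub>v x\<close>, and
  \<open>W_J_W\<close> turns them into a value of \<open>W z\<close>. Parametrizing by
  \<open>x\<close> and \<open>\<eta>\<close> avoids inverting \<open>a12\<close>.\<close>

lemma W_mult:
  assumes x: "x \<in> carrier_vec p" and \<eta>: "\<eta> \<in> carrier_vec p"
  shows "W z *\<^sub>v ((a12 *\<^sub>v x - a11 *\<^sub>v \<eta>) @\<^sub>v \<eta>) = (a22 *\<^sub>v x - a21 *\<^sub>v \<eta>) @\<^sub>v x"
proof -
  define y where "y = a21 *\<^sub>v \<eta> - a22 *\<^sub>v x"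
  have a: "a21 *\<^sub>v \<eta> \<in> carrier_vec p" "a22 *\<^sub>v x \<in> carrier_vec p"
    "a11 *\<^sub>v \<eta> \<in> carrier_vec p" "a12 *\<^sub>v x \<in> carrier_vec p"
    using gamma_hat(1)[OF zA0 \<eta>] gamma_adjoint(1)[OF cnj_zA0 L_minus[OF x]]
    by (simp_all add: a21[OF \<eta>] a22[OF x] a11[OF \<eta>] a12[OF x] L_adj Gamma_carrier)
  have y: "y \<in> carrier_vec p" using a by (simp add: y_def)
  let ?u = "R_tilde R0 z (L x)" and ?g = "gamma_field A \<Gamma>0 z \<eta>"
  note u = E_R0[OF zA0 L_minus[OF x]]
  have g: "(?g, emb A (z *\<^sub>C ?g)) \<in> ext_rel A A" by (simp add: ext_rel_emb_iff gamma_hat(1)[OF zA0 \<eta>])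
  have G: "Gh (cnj z) x y = ((- 1) *\<^sub>C ?u + ?g,
      \<lambda>h. (- 1) * (L x h + emb A (z *\<^sub>C ?u) h) + emb A (z *\<^sub>C ?g) h)"
    unfolding Gh_def Gv_cnj[OF x \<eta>, folded y_def]
    by (simp add: emb_simps fun_eq_iff scaleC_add_right algebra_simps)
  note su = ext_rel_scale[OF u(3), of "- 1"]
  have E0: "E0 (Gh (cnj z) x y) = \<eta>"
    unfolding G E_add(1)[OF su g] E_scale(1)[OF u(3)] u(1) E_Gamma(1)[OF gamma_hat(1)[OF zA0 \<eta>]]
      gamma_hat(2)[OF zA0 \<eta>] using \<eta> by (simp add: smult_zero_vec)
  have E1: "E1 (Gh (cnj z) x y) = a11 *\<^sub>v \<eta> - a12 *\<^sub>v x"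
    unfolding G E_add(2)[OF su g] E_scale(2)[OF u(3)] u(2) E_Gamma(2)[OF gamma_hat(1)[OF zA0 \<eta>]]
    a11[OF \<eta>, symmetric] a12[OF x, symmetric] by (rule vec_minus_smult_add[OF a(4,3)])
  let ?v = "(a12 *\<^sub>v x - a11 *\<^sub>v \<eta>) @\<^sub>v \<eta>"
  have v: "?v \<in> carrier_vec (p + p)" using a \<eta> by auto
  note c = W_carrier[of z] J_tilde_carrier[of p] mat_adjoint_carrier[OF W_carrier[of "cnj z"]]
  have xy: "x @\<^sub>v y \<in> carrier_vec (p + p)" using x y by auto
  have neg: "- (a11 *\<^sub>v \<eta> - a12 *\<^sub>v x) = a12 *\<^sub>v x - a11 *\<^sub>v \<eta>" by (rule vec_uminus_diff[OF a(3,4)])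
  have "\<i> \<cdot>\<^sub>v (W z *\<^sub>v ?v) = W z *\<^sub>v (\<i> \<cdot>\<^sub>v ?v)" by (rule mult_mat_vec[OF c(1) v, symmetric])
  also have "\<i> \<cdot>\<^sub>v ?v = J_tilde p *\<^sub>v (\<eta> @\<^sub>v (a11 *\<^sub>v \<eta> - a12 *\<^sub>v x))"
    using a \<eta> by (subst J_tilde_mult) (simp_all add: neg)
  also have "\<dots> = J_tilde p *\<^sub>v (mat_adjoint (W (cnj z)) *\<^sub>v (x @\<^sub>v y))"
    unfolding W_adjoint_mult[OF z\<rho>(2) x y] E0 E1 ..
  also have "W z *\<^sub>v \<dots> = (W z * J_tilde p * mat_adjoint (W (cnj z))) *\<^sub>v (x @\<^sub>v y)"
    using c xy by (simp add: assoc_mult_mat_vec[of _ "p + p" "p + p" _ "p + p"]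
        mult_carrier_mat[of _ "p + p" "p + p" _ "p + p"])
  also have "\<dots> = \<i> \<cdot>\<^sub>v ((- y) @\<^sub>v x)" unfolding W_J_W[OF z\<rho>] by (rule J_tilde_mult[OF x y])
  finally have "(- \<i>) \<cdot>\<^sub>v (\<i> \<cdot>\<^sub>v (W z *\<^sub>v ?v)) = (- \<i>) \<cdot>\<^sub>v (\<i> \<cdot>\<^sub>v ((- y) @\<^sub>v x))" by simp
  then have "W z *\<^sub>v ?v = (- y) @\<^sub>v x" by (simp add: smult_smult_assoc)
  moreover have "- y = a22 *\<^sub>v x - a21 *\<^sub>v \<eta>" unfolding y_def by (rule vec_uminus_diff[OF a(1,2)])
  ultimately show ?thesis by simp
qed

lemma W_eq_resolvent_matrix: "W z = resolvent_matrix p A \<Gamma>0 \<Gamma>1 L z"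
proof -
  have c: "a11 \<in> carrier_mat p p" "a12 \<in> carrier_mat p p" "a21 \<in> carrier_mat p p" "a22 \<in> carrier_mat p p"
    by simp_all
  obtain N where N: "mat_inverse a12 = Some N" "N \<in> carrier_mat p p" "a12 * N = 1\<^sub>m p" "N * a12 = 1\<^sub>m p"
  proof (rule injective_mat_inverse[OF c(2)])
    \<comment> \<open>With \<open>\<eta>\<close> zero, the argument of \<open>W z\<close> in
      \<open>W_mult\<close> is zero while \<open>x\<close> is the lower half of the value. So
      \<open>a12\<close> is invertible, and the \<open>the\<close> in
      \<open>resolvent_matrix\<close> denotes a genuine inverse.\<close>
    fix x :: "complex vec" assume x: "x \<in> carrier_vec p" and x0: "a12 *\<^sub>v x = 0\<^sub>v p"
    have a0: "a11 *\<^sub>v 0\<^sub>v p = 0\<^sub>v p" "a21 *\<^sub>v 0\<^sub>v p = 0\<^sub>v p"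
      by (intro eq_vecI; simp add: op_mat_def)+
    have "(0\<^sub>v p - 0\<^sub>v p) @\<^sub>v 0\<^sub>v p = (0\<^sub>v (p + p) :: complex vec)" by (intro eq_vecI) auto
    then have "W z *\<^sub>v 0\<^sub>v (p + p) = (a22 *\<^sub>v x - 0\<^sub>v p) @\<^sub>v x"
      using W_mult[OF x zero_carrier_vec] by (simp add: a0 x0)
    moreover have "W z *\<^sub>v 0\<^sub>v (p + p) = 0\<^sub>v p @\<^sub>v (0\<^sub>v p :: complex vec)"
      using W_carrier[of z] by (intro eq_vecI) auto
    ultimately have eq: "0\<^sub>v p @\<^sub>v (0\<^sub>v p :: complex vec) = (a22 *\<^sub>v x - 0\<^sub>v p) @\<^sub>v x" by simp
    have "a22 *\<^sub>v x - 0\<^sub>v p \<in> carrier_vec p"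
      by (rule minus_carrier_vec[OF mult_mat_vec_carrier[OF c(4) x] zero_carrier_vec])
    from append_vec_inject(2)[OF zero_carrier_vec this eq] show "x = 0\<^sub>v p" ..
  qed (rule that)
  let ?V = "four_block_mat (a22 * N) (a22 * N * a11 - a21) N (N * a11)"
  have cN: "a22 * N \<in> carrier_mat p p" "N * a11 \<in> carrier_mat p p" "a22 * N * a11 \<in> carrier_mat p p"
    "a22 * N * a11 - a21 \<in> carrier_mat p p"
    using c N(2) by (auto intro!: minus_carrier_mat mult_carrier_mat[of _ p p _ p])
  have "W z = ?V"
  proof (rule eq_mat_mult_vecI[OF W_carrier])
    show "?V \<in> carrier_mat (p + p) (p + p)" by (rule four_block_carrier_mat[OF cN(1,2)])
    fix v :: "complex vec" assume v: "v \<in> carrier_vec (p + p)"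
    define u \<eta> where "u = vec_first v p" and "\<eta> = vec_last v p"
    have u\<eta>: "u \<in> carrier_vec p" "\<eta> \<in> carrier_vec p" and vu: "v = u @\<^sub>v \<eta>"
      using v by (simp_all add: u_def \<eta>_def)
    \<comment> \<open>Solves \<open>a12 *\<^sub>v x - a11 *\<^sub>v \<eta> = u\<close>, so that
      \<open>W_mult\<close> evaluates \<open>W z\<close> at \<open>v\<close>.\<close>
    define x where "x = N *\<^sub>v (u + a11 *\<^sub>v \<eta>)"
    have a: "a11 *\<^sub>v \<eta> \<in> carrier_vec p" "a21 *\<^sub>v \<eta> \<in> carrier_vec p" using c u\<eta> by (auto simp: mult_mat_vec_carrier[of _ p p])
    have x: "x \<in> carrier_vec p" using N(2) u\<eta> a by (simp add: x_def mult_mat_vec_carrier[of _ p p])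
    have "a12 *\<^sub>v x = (a12 * N) *\<^sub>v (u + a11 *\<^sub>v \<eta>)"
      unfolding x_def using c(2) N(2) u\<eta> a by (simp add: assoc_mult_mat_vec[of _ p p _ p])
    then have "a12 *\<^sub>v x = u + a11 *\<^sub>v \<eta>" using u\<eta> a by (simp add: N(3))
    then have "a12 *\<^sub>v x - a11 *\<^sub>v \<eta> = u" using vec_add_diff_cancel[OF u\<eta>(1) a(1)] by simp
    then have W: "W z *\<^sub>v v = (a22 *\<^sub>v x - a21 *\<^sub>v \<eta>) @\<^sub>v x" using W_mult[OF x u\<eta>(2)] by (simp add: vu)
    have x_eq: "x = N *\<^sub>v u + (N * a11) *\<^sub>v \<eta>"
      unfolding x_def using N(2) c(1) u\<eta> a
      by (simp add: mult_add_distrib_mat_vec[of _ p p] assoc_mult_mat_vec[of _ p p _ p])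
    have a22x: "a22 *\<^sub>v x = (a22 * N) *\<^sub>v u + (a22 * N * a11) *\<^sub>v \<eta>"
    proof -
      have "a22 *\<^sub>v x = (a22 * N) *\<^sub>v (u + a11 *\<^sub>v \<eta>)"
        unfolding x_def using c(4) N(2) u\<eta> a by (simp add: assoc_mult_mat_vec[of _ p p _ p])
      also have "\<dots> = (a22 * N) *\<^sub>v u + (a22 * N) *\<^sub>v (a11 *\<^sub>v \<eta>)"
        by (rule mult_add_distrib_mat_vec[OF cN(1) u\<eta>(1) a(1)])
      also have "(a22 * N) *\<^sub>v (a11 *\<^sub>v \<eta>) = (a22 * N * a11) *\<^sub>v \<eta>"
        by (rule assoc_mult_mat_vec[OF cN(1) c(1) u\<eta>(2), symmetric])
      finally show ?thesis .
    qed
    have "?V *\<^sub>v v = ((a22 * N) *\<^sub>v u + (a22 * N * a11 - a21) *\<^sub>v \<eta>) @\<^sub>v (N *\<^sub>v u + (N * a11) *\<^sub>v \<eta>)"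
      unfolding vu by (rule four_block_mat_mult_vec[OF cN(1,4) N(2) cN(2) u\<eta>])
    also have "(a22 * N * a11 - a21) *\<^sub>v \<eta> = (a22 * N * a11) *\<^sub>v \<eta> - a21 *\<^sub>v \<eta>"
      by (rule minus_mult_distrib_mat_vec[OF cN(3) c(3) u\<eta>(2)])
    also have "(a22 * N) *\<^sub>v u + ((a22 * N * a11) *\<^sub>v \<eta> - a21 *\<^sub>v \<eta>) = a22 *\<^sub>v x - a21 *\<^sub>v \<eta>"
      unfolding a22x
      by (rule vec_add_diff_assoc[OF mult_mat_vec_carrier[OF cN(1) u\<eta>(1)]
            mult_mat_vec_carrier[OF cN(3) u\<eta>(2)] a(2)])
    finally show "W z *\<^sub>v v = ?V *\<^sub>v v" unfolding W x_eq[symmetric] by simp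
  qed
  then show ?thesis unfolding resolvent_matrix_def Let_def N(1) option.sel .
qed

end

end

theorem theorem4p13:
  fixes A :: "('h :: complex_hilbert \<times> 'h) set"
    and p :: nat
    and \<Gamma>0 \<Gamma>1 :: "'h \<times> 'h \<Rightarrow> complex vec"
    and E0 E1 :: "'h \<times> ('h \<Rightarrow> complex) \<Rightarrow> complex vec"
    and \<LL> :: "('h \<Rightarrow> complex) set"
    and L :: "complex vec \<Rightarrow> 'h \<Rightarrow> complex"
    and P :: "complex \<Rightarrow> ('h \<Rightarrow> complex) \<Rightarrow> complex vec"
    and Q :: "complex \<Rightarrow> 'h \<Rightarrow> complex vec"
    and W :: "complex \<Rightarrow> complex mat"
  assumes "closed A" and "symmetric_rel A" and "defect_numbers A p p"
    and "boundary_triple p A \<Gamma>0 \<Gamma>1"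
    and "extended_boundary_triple p A \<Gamma>0 \<Gamma>1 E0 E1"
    and "minus_subspace A \<LL>" and "gauge_set A \<LL> \<noteq> {}"
    and "linear_bij_minus p L \<LL>"
    and P_def: "P = P_op p A \<LL> L"
    and Q: "\<forall>z\<in>gauge_set A \<LL>. \<exists>(V :: 'h \<Rightarrow> 'k :: complex_hilbert) At D R.
              generalized_resolvent A V At D R \<and> z \<in> D \<and> Q z = Q_op p A \<Gamma>0 \<LL> L R z"
    and W_def: "W = W_hat p A E0 E1 L P Q"
  shows "(\<forall>z\<in>gauge_set A \<LL>. \<forall>\<zeta>\<in>gauge_set A \<LL>. z \<noteq> cnj \<zeta> \<longrightarrow>
            (\<forall>v\<in>carrier_vec (2 * p). W_kernel p W \<zeta> z *\<^sub>v v = G_op A P Q z (G_adj p A P Q \<zeta> v))) \<and>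
         (gauge_set A \<LL> \<inter> cnj ` gauge_set A \<LL> \<noteq> {} \<longrightarrow>
            (\<forall>z\<in>gauge_set A \<LL> \<inter> cnj ` gauge_set A \<LL>. invertible_mat (W z)) \<and>
            (\<forall>z\<in>gauge_set A \<LL> \<inter> cnj ` gauge_set A \<LL> \<inter> resolvent_set (ker_rel p A \<Gamma>0).
               W z = resolvent_matrix p A \<Gamma>0 \<Gamma>1 L z))"
proof -
  \<comment> \<open>The larger Hilbert space \<open>'k\<close> drops out here: the locale sees only
    operators on the space of \<open>A\<close>.\<close>
  interpret resolvent_gauge A p \<Gamma>0 \<Gamma>1 E0 E1 \<LL> L Q
  proof unfold_locales
    fix z assume "z \<in> gauge_set A \<LL>"
    then obtain V :: "'h \<Rightarrow> 'k" and At D R where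
      "generalized_resolvent A V At D R" "z \<in> D" "Q z = Q_op p A \<Gamma>0 \<LL> L R z"
      using Q by blast
    then show "\<exists>R. resolvent_pair A z (R z) (R (cnj z)) \<and> Q z = Q_op p A \<Gamma>0 \<LL> L R z"
      using generalized_resolvent_pair by blast
  qed fact+
  have "W_kernel p W \<zeta> z *\<^sub>v v = G_op A P Q z (G_adj p A P Q \<zeta> v)"
    if z: "z \<in> gauge_set A \<LL>" and \<zeta>: "\<zeta> \<in> gauge_set A \<LL>" and ne: "z \<noteq> cnj \<zeta>"
      and v: "v \<in> carrier_vec (2 * p)" for z \<zeta> v
  proof -
    have v': "v \<in> carrier_vec (p + p)" using v by (simp add: mult_2)
    let ?M = "J_tilde p - W z * J_tilde p * mat_adjoint (W \<zeta>)"
    have M: "?M \<in> carrier_mat (p + p) (p + p)"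
      unfolding W_def P_def using W_carrier mat_adjoint_carrier J_tilde_carrier
      by (meson minus_carrier_mat mult_carrier_mat)
    show ?thesis
      unfolding W_kernel_def smult_mat_mult_vec[OF M v']
      using kernel_identity[OF z \<zeta> v'] ne
      by (simp add: W_def P_def smult_smult_assoc)
  qed
  moreover have "invertible_mat (W z)"
    if "z \<in> gauge_set A \<LL> \<inter> cnj ` gauge_set A \<LL>" for z
    using that W_invertible[of z] by (auto simp: W_def P_def)
  moreover have "W z = resolvent_matrix p A \<Gamma>0 \<Gamma>1 L z"
    if "z \<in> gauge_set A \<LL> \<inter> cnj ` gauge_set A \<LL> \<inter> resolvent_set (ker_rel p A \<Gamma>0)" for z
    using that W_eq_resolvent_matrix[of z] by (auto simp: W_def P_def)
  ultimately show ?thesis by blast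
qed

end
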